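(* Let $(\vartheta_i)_{i\ge1}$ be positive real numbers, $(m_n)_{n\ge1}$ non-negative integers, and let \[ \boldsymbol{z}^{(n)}=\mathrm{ord}\big((\underbrace{1,1,\dots,1}_{n\text{ times}},\vartheta_1,\vartheta_2,\dots,\vartheta_{m_n},0,0,\dots)\big). \] Let $K_{\mathrm{gER}}^{(n)}(t)$ denote the number of connected components at time $t\ge0$ of the multiplicative random graph process with initial masses $\boldsymbol{z}^{(n)}$. Assume there exist two non-negative constants $\beta_1$ and $\beta_2$ such that \[ \frac{m_n}{\sqrt n}\xrightarrow[n\to\infty]{}\beta_1,\qquad \frac{2}{\sqrt n}\sum_{i=1}^{m_n}\vartheta_i\xrightarrow[n\to\infty]{}\beta_2,\qquad \frac1n\sum_{i=1}^{m_n}\vartheta_i^2\xrightarrow[n\to\infty]{}0 . \] Then, for every $[0,c]$ with $0\le c<1$, \[ \left(\frac1n K_{\mathrm{gER}}^{(n)}\Big(\frac tn\Big)\right)_{t\in[0,c]}\Rightarrow\left(1-\frac t2\right)_{t\in[0,c]}\quad\text{in } D([0,c],\mathbb{R})\text{ as } n\to\infty . \] In addition, \[ \left(\sqrt n\left(\frac1n K_{\mathrm{gER}}^{(n)}\Big(\frac tn\Big)-\Big(1-\frac t2\Big)\right)\right)_{t\in[0,c]}\Rightarrow\left(\beta_1-\beta_2\frac{t}{2}+B\Big(\frac t2\Big)\right)_{t\in[0,c]} \] in $D([0,c],\mathbb{R})$ as $n\to\infty$, where $B$ is a (standard one-dimensional) Brownian motion.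
   Context: $\mathrm{ord}$ maps a square-summable sequence of non-negative reals to the same sequence rearranged in decreasing (non-increasing) order. For a decreasing sequence $\boldsymbol{z}=(z_1,z_2,\dots)$ of non-negative reals with finitely many non-zero entries, the multiplicative random graph process with initial masses $\boldsymbol{z}$ is the graph-valued continuous-time Markov process whose vertices are the indices $i$ with $z_i>0$, vertex $i$ having mass $z_i$, which starts with no edges at time $0$, and in which the edge between each pair $i\neq j$ appears (and then stays forever) after an exponential time with rate $z_iz_j$, independently of the other edges. $D([0,c],\mathbb{R})$ is the space of càdlàg real-valued functions on $[0,c]$ with the Skorokhod $J_1$ topology, and $\Rightarrow$ denotes convergence in distribution. *)

theory Defs
  imports "HOL-Probability.Probability"
begin

text \<open>
  Functions on \<open>[0,c]\<close> are represented as extensional functions, so that equality of functions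
  is equality on \<open>[0,c]\<close>.
\<close>

definition cadlag :: "real \<Rightarrow> (real \<Rightarrow> real) set" where
  "cadlag c = {f \<in> extensional {0..c}.
     (\<forall>t\<in>{0..<c}. (f \<longlongrightarrow> f t) (at_right t)) \<and>
     (\<forall>t\<in>{0<..c}. \<exists>l. (f \<longlongrightarrow> l) (at_left t))}"

definition time_changes :: "real \<Rightarrow> (real \<Rightarrow> real) set" where
  "time_changes c = {h. continuous_on {0..c} h \<and> strict_mono_on {0..c} h \<and> h ` {0..c} = {0..c}}"

text \<open>
  Skorokhod's distance: the infimum of the \<open>e > 0\<close> for which some time change \<open>h\<close> satisfies
  \<open>sup \<bar>h t - t\<bar> \<le> e\<close> and \<open>sup \<bar>f t - g (h t)\<bar> \<le> e\<close>. It induces the \<open>J\<^sub>1\<close> topology. The value 0 outside the space only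
  serves to meet the locale \<open>Metric_space\<close>, whose non-negativity and symmetry axioms are not
  relativised to the carrier.
\<close>

definition skorokhod_close :: "real \<Rightarrow> real \<Rightarrow> (real \<Rightarrow> real) \<Rightarrow> (real \<Rightarrow> real) \<Rightarrow> bool" where
  "skorokhod_close c e f g \<longleftrightarrow>
     (\<exists>h\<in>time_changes c. \<forall>t\<in>{0..c}. \<bar>h t - t\<bar> \<le> e \<and> \<bar>f t - g (h t)\<bar> \<le> e)"

definition skorokhod_dist :: "real \<Rightarrow> (real \<Rightarrow> real) \<Rightarrow> (real \<Rightarrow> real) \<Rightarrow> real" where
  "skorokhod_dist c f g =
     (if f \<in> cadlag c \<and> g \<in> cadlag c then Inf {e. 0 < e \<and> skorokhod_close c e f g} else 0)"

definition skorokhod_topology :: "real \<Rightarrow> (real \<Rightarrow> real) topology" where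
  "skorokhod_topology c = Metric_space.mtopology (cadlag c) (skorokhod_dist c)"

lemma cadlag_locally_bounded:
  assumes f: "f \<in> cadlag c" and t: "t \<in> {0..c}"
  shows "\<exists>d>0. \<exists>B. \<forall>s\<in>{0..c}. \<bar>s - t\<bar> < d \<longrightarrow> \<bar>f s\<bar> \<le> B"
proof -
  have "\<exists>d>0. \<exists>B. \<forall>s\<in>{0..c}. t < s \<and> s < t + d \<longrightarrow> \<bar>f s\<bar> \<le> B"
  proof (cases "t < c")
    case True
    then have "(f \<longlongrightarrow> f t) (at_right t)"
      using f t by (auto simp: cadlag_def)
    then have "eventually (\<lambda>s. dist (f s) (f t) < 1) (at_right t)"
      by (rule tendstoD) simp
    then obtain b where b: "b > t" "\<And>s. t < s \<Longrightarrow> s < b \<Longrightarrow> dist (f s) (f t) < 1"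
      by (auto simp: eventually_at_right_field)
    have "\<bar>f s\<bar> \<le> \<bar>f t\<bar> + 1" if "t < s" "s < t + (b - t)" for s
      using b(2)[of s] that by (simp add: dist_real_def)
    then show ?thesis using b(1) by (intro exI[of _ "b - t"] conjI exI[of _ "\<bar>f t\<bar> + 1"]) auto
  next
    case False
    then show ?thesis using t by (intro exI[of _ 1]) auto
  qed
  then obtain d1 B1 where 1: "d1 > 0" "\<And>s. s \<in> {0..c} \<Longrightarrow> t < s \<Longrightarrow> s < t + d1 \<Longrightarrow> \<bar>f s\<bar> \<le> B1"
    by blast
  have "\<exists>d>0. \<exists>B. \<forall>s\<in>{0..c}. s < t \<and> t - d < s \<longrightarrow> \<bar>f s\<bar> \<le> B"
  proof (cases "0 < t")
    case True
    then have "t \<in> {0<..c}" using t by simp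
    then obtain l where "(f \<longlongrightarrow> l) (at_left t)"
      using f unfolding cadlag_def by blast
    then have "eventually (\<lambda>s. dist (f s) l < 1) (at_left t)"
      by (rule tendstoD) simp
    then obtain b where b: "b < t" "\<And>s. b < s \<Longrightarrow> s < t \<Longrightarrow> dist (f s) l < 1"
      by (auto simp: eventually_at_left_field)
    have "\<bar>f s\<bar> \<le> \<bar>l\<bar> + 1" if "s < t" "t - (t - b) < s" for s
      using b(2)[of s] that by (simp add: dist_real_def)
    then show ?thesis using b(1) by (intro exI[of _ "t - b"] conjI exI[of _ "\<bar>l\<bar> + 1"]) auto
  next
    case False
    then show ?thesis using t by (intro exI[of _ 1]) auto
  qed
  then obtain d2 B2 where 2: "d2 > 0" "\<And>s. s \<in> {0..c} \<Longrightarrow> s < t \<Longrightarrow> t - d2 < s \<Longrightarrow> \<bar>f s\<bar> \<le> B2"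
    by blast
  have "\<bar>f s\<bar> \<le> max (max B1 B2) \<bar>f t\<bar>" if s: "s \<in> {0..c}" "\<bar>s - t\<bar> < min d1 d2" for s
  proof (cases s t rule: linorder_cases)
    case less
    then have "\<bar>f s\<bar> \<le> B2" using s by (intro 2) auto
    then show ?thesis by auto
  next
    case greater
    then have "\<bar>f s\<bar> \<le> B1" using s by (intro 1) auto
    then show ?thesis by auto
  qed auto
  then show ?thesis
    using 1(1) 2(1)
    by (intro exI[of _ "min d1 d2"] conjI exI[of _ "max (max B1 B2) \<bar>f t\<bar>"] ballI impI) auto
qed

lemma cadlag_bounded:
  assumes f: "f \<in> cadlag c"
  obtains B where "\<And>t. t \<in> {0..c} \<Longrightarrow> \<bar>f t\<bar> \<le> B"
proof -
  obtain d B where d: "\<And>t. t \<in> {0..c} \<Longrightarrow> 0 < d t"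
    and B: "\<And>t s. t \<in> {0..c} \<Longrightarrow> s \<in> {0..c} \<Longrightarrow> \<bar>s - t\<bar> < d t \<Longrightarrow> \<bar>f s\<bar> \<le> B t"
    using cadlag_locally_bounded[OF f] by metis
  have cover: "{0..c} \<subseteq> (\<Union>t\<in>{0..c}. ball t (d t))"
    using d by force
  obtain T where T: "T \<subseteq> {0..c}" "finite T" "{0..c} \<subseteq> (\<Union>t\<in>T. ball t (d t))"
    by (rule compactE_image[OF compact_Icc _ cover]) auto
  have "\<bar>f s\<bar> \<le> Max (insert 0 (B ` T))" if s: "s \<in> {0..c}" for s
  proof -
    obtain t where t: "t \<in> T" "s \<in> ball t (d t)" using s T(3) by blast
    then have "\<bar>f s\<bar> \<le> B t"
      using s T(1) by (intro B) (auto simp: dist_real_def)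
    also have "\<dots> \<le> Max (insert 0 (B ` T))" using t(1) T(2) by (intro Max_ge) auto
    finally show ?thesis .
  qed
  then show ?thesis by (rule that)
qed

lemma id_time_change: "(\<lambda>t. t) \<in> time_changes c"
  by (simp add: time_changes_def strict_mono_on_def)

lemma time_change_comp:
  assumes "h \<in> time_changes c" "k \<in> time_changes c"
  shows "k \<circ> h \<in> time_changes c"
proof -
  have h: "continuous_on {0..c} h" "strict_mono_on {0..c} h" "h ` {0..c} = {0..c}"
    and k: "continuous_on {0..c} k" "strict_mono_on {0..c} k" "k ` {0..c} = {0..c}"
    using assms by (auto simp: time_changes_def)
  have "continuous_on {0..c} (k \<circ> h)"
    using h k by (intro continuous_on_compose) auto
  moreover have "strict_mono_on {0..c} (k \<circ> h)"
  proof (rule strict_mono_onI)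
    fix r s assume rs: "r \<in> {0..c}" "s \<in> {0..c}" "r < s"
    then have "h r < h s" "h r \<in> {0..c}" "h s \<in> {0..c}"
      using h(3) by (auto intro: strict_mono_onD[OF h(2)])
    then show "(k \<circ> h) r < (k \<circ> h) s"
      using strict_mono_onD[OF k(2)] by simp
  qed
  moreover have "(k \<circ> h) ` {0..c} = {0..c}"
    using h(3) k(3) by (metis image_comp)
  ultimately show ?thesis by (simp add: time_changes_def)
qed

lemma time_change_inverse:
  assumes h: "h \<in> time_changes c"
  shows "inv_into {0..c} h \<in> time_changes c"
proof -
  have 1: "continuous_on {0..c} h" "strict_mono_on {0..c} h" "h ` {0..c} = {0..c}"
    using h by (auto simp: time_changes_def)
  have inj: "inj_on h {0..c}"
    using 1(2) by (rule strict_mono_on_imp_inj_on)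
  have "continuous_on (h ` {0..c}) (inv_into {0..c} h)"
    using 1(1) inj by (intro continuous_on_inv) auto
  moreover have "inv_into {0..c} h ` {0..c} = {0..c}"
    using inj 1(3) by (metis inv_into_image_cancel subset_refl)
  moreover have "strict_mono_on {0..c} (inv_into {0..c} h)"
  proof (rule strict_mono_onI, rule ccontr)
    fix r s assume rs: "r \<in> {0..c}" "s \<in> {0..c}" "r < s"
      and "\<not> inv_into {0..c} h r < inv_into {0..c} h s"
    then have le: "inv_into {0..c} h s \<le> inv_into {0..c} h r" by simp
    have "inv_into {0..c} h s \<in> {0..c}" "inv_into {0..c} h r \<in> {0..c}"
      using rs 1(3) by (metis inv_into_into)+
    then have "h (inv_into {0..c} h s) \<le> h (inv_into {0..c} h r)"
      using le 1(2) by (meson strict_mono_on_leD)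
    then show False using rs 1(3) by (simp add: f_inv_into_f)
  qed
  ultimately show ?thesis using 1(3) by (simp add: time_changes_def)
qed

lemma time_change_endpoint:
  assumes h: "h \<in> time_changes c" and c: "0 \<le> c"
  shows "h c = c"
proof -
  have 1: "strict_mono_on {0..c} h" "h ` {0..c} = {0..c}"
    using h by (auto simp: time_changes_def)
  obtain s where s: "s \<in> {0..c}" "h s = c" using 1(2) c by (metis atLeastAtMost_iff imageE order_refl)
  have "c \<in> {0..c}" using c by simp
  then have "h c \<in> {0..c}" using 1(2) by blast
  moreover have "h s \<le> h c"
    using strict_mono_on_leD[OF 1(1) s(1) \<open>c \<in> {0..c}\<close>] s(1) by simp
  ultimately show ?thesis using s(2) by simp
qed

lemma skorokhod_close_sym:
  assumes "skorokhod_close c e f g"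
  shows "skorokhod_close c e g f"
proof -
  obtain h where h: "h \<in> time_changes c"
    "\<And>t. t \<in> {0..c} \<Longrightarrow> \<bar>h t - t\<bar> \<le> e \<and> \<bar>f t - g (h t)\<bar> \<le> e"
    using assms by (auto simp: skorokhod_close_def)
  have im: "h ` {0..c} = {0..c}" using h(1) by (simp add: time_changes_def)
  show ?thesis unfolding skorokhod_close_def
  proof (intro bexI[OF _ time_change_inverse[OF h(1)]] ballI)
    fix t assume t: "t \<in> {0..c}"
    let ?s = "inv_into {0..c} h t"
    have "?s \<in> {0..c}" "h ?s = t" using t im by (metis inv_into_into, metis f_inv_into_f)
    then show "\<bar>?s - t\<bar> \<le> e \<and> \<bar>g t - f ?s\<bar> \<le> e"
      using h(2)[of ?s] by (auto simp: abs_minus_commute)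
  qed
qed

lemma skorokhod_close_trans:
  assumes "skorokhod_close c e f g" "skorokhod_close c e' g g'"
  shows "skorokhod_close c (e + e') f g'"
proof -
  obtain h where h: "h \<in> time_changes c"
    "\<And>t. t \<in> {0..c} \<Longrightarrow> \<bar>h t - t\<bar> \<le> e \<and> \<bar>f t - g (h t)\<bar> \<le> e"
    using assms(1) by (auto simp: skorokhod_close_def)
  obtain k where k: "k \<in> time_changes c"
    "\<And>t. t \<in> {0..c} \<Longrightarrow> \<bar>k t - t\<bar> \<le> e' \<and> \<bar>g t - g' (k t)\<bar> \<le> e'"
    using assms(2) by (auto simp: skorokhod_close_def)
  show ?thesis unfolding skorokhod_close_def
  proof (intro bexI[OF _ time_change_comp[OF h(1) k(1)]] ballI)
    fix t assume t: "t \<in> {0..c}"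
    then have "h t \<in> {0..c}" using h(1) by (auto simp: time_changes_def)
    then show "\<bar>(k \<circ> h) t - t\<bar> \<le> e + e' \<and> \<bar>f t - g' ((k \<circ> h) t)\<bar> \<le> e + e'"
      using h(2)[OF t] k(2)[of "h t"] by auto
  qed
qed

lemma skorokhod_close_exists:
  assumes "f \<in> cadlag c" "g \<in> cadlag c"
  shows "\<exists>e>0. skorokhod_close c e f g"
proof -
  obtain A B where AB: "\<And>t. t \<in> {0..c} \<Longrightarrow> \<bar>f t\<bar> \<le> A" "\<And>t. t \<in> {0..c} \<Longrightarrow> \<bar>g t\<bar> \<le> B"
    using cadlag_bounded[OF assms(1)] cadlag_bounded[OF assms(2)] by metis
  have "skorokhod_close c (\<bar>A\<bar> + \<bar>B\<bar> + 1) f g"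
    unfolding skorokhod_close_def
  proof (intro bexI[OF _ id_time_change] ballI)
    fix t assume "t \<in> {0..c}"
    from AB[OF this] show "\<bar>t - t\<bar> \<le> \<bar>A\<bar> + \<bar>B\<bar> + 1 \<and> \<bar>f t - g t\<bar> \<le> \<bar>A\<bar> + \<bar>B\<bar> + 1"
      by linarith
  qed
  then show ?thesis by (intro exI[of _ "\<bar>A\<bar> + \<bar>B\<bar> + 1"]) auto
qed

lemma skorokhod_dist_less:
  assumes "f \<in> cadlag c" "g \<in> cadlag c" "skorokhod_dist c f g < r"
  obtains e where "0 < e" "e < r" "skorokhod_close c e f g"
proof -
  have "{e. 0 < e \<and> skorokhod_close c e f g} \<noteq> {}"
    using skorokhod_close_exists[OF assms(1,2)] by auto
  from cInf_lessD[OF this, of r] assms that show ?thesis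
    by (auto simp: skorokhod_dist_def)
qed

lemma skorokhod_dist_le:
  assumes "0 < e" "skorokhod_close c e f g"
  shows "skorokhod_dist c f g \<le> e"
proof -
  have "Inf {e. 0 < e \<and> skorokhod_close c e f g} \<le> e"
    using assms by (intro cInf_lower bdd_belowI[of _ 0]) auto
  then show ?thesis using assms by (simp add: skorokhod_dist_def)
qed

lemma Metric_space_skorokhod:
  assumes c: "0 \<le> c"
  shows "Metric_space (cadlag c) (skorokhod_dist c)"
proof
  show nonneg: "0 \<le> skorokhod_dist c f g" for f g
  proof (cases "f \<in> cadlag c \<and> g \<in> cadlag c")
    case True
    then have "{e. 0 < e \<and> skorokhod_close c e f g} \<noteq> {}"
      using skorokhod_close_exists by auto
    then have "0 \<le> Inf {e. 0 < e \<and> skorokhod_close c e f g}"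
      by (intro cInf_greatest) auto
    then show ?thesis using True by (simp add: skorokhod_dist_def)
  qed (auto simp: skorokhod_dist_def)
  show "skorokhod_dist c f g = skorokhod_dist c g f" for f g
  proof -
    have "{e. 0 < e \<and> skorokhod_close c e f g} = {e. 0 < e \<and> skorokhod_close c e g f}"
      using skorokhod_close_sym by blast
    then show ?thesis by (simp add: skorokhod_dist_def)
  qed
  show "skorokhod_dist c f g = 0 \<longleftrightarrow> f = g" if fg: "f \<in> cadlag c" "g \<in> cadlag c" for f g
  proof
    assume 0: "skorokhod_dist c f g = 0"
    have "f t = g t" if t: "t \<in> {0..c}" for t
    proof (rule ccontr)
      assume ne: "f t \<noteq> g t"
      define r where "r = \<bar>f t - g t\<bar> / 3"
      have r: "r > 0" using ne by (simp add: r_def)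
      show False
      proof (cases "t < c")
        case True
        then have "(f \<longlongrightarrow> f t) (at_right t)" "(g \<longlongrightarrow> g t) (at_right t)"
          using fg t by (auto simp: cadlag_def)
        then have "eventually (\<lambda>s. dist (f s) (f t) < r) (at_right t)"
          "eventually (\<lambda>s. dist (g s) (g t) < r) (at_right t)"
          using r by (auto dest: tendstoD)
        then obtain b1 b2 where b: "b1 > t" "\<And>s. t < s \<Longrightarrow> s < b1 \<Longrightarrow> dist (f s) (f t) < r"
          "b2 > t" "\<And>s. t < s \<Longrightarrow> s < b2 \<Longrightarrow> dist (g s) (g t) < r"
          by (auto simp: eventually_at_right_field)
        define u where "u = min (min b1 b2) c"
        have u: "t < u" "u \<le> b1" "u \<le> b2" "u \<le> c"
          using b(1,3) True by (auto simp: u_def)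
        define d where "d = (u - t) / 2"
        have "t + 2 * d = u" unfolding d_def by (simp add: field_simps)
        then have d: "d > 0" "t + 2 * d \<le> b1" "t + 2 * d \<le> b2" "t + 2 * d \<le> c"
          using u by linarith+
        obtain e where e: "0 < e" "e < min d r" "skorokhod_close c e f g"
          using skorokhod_dist_less[OF fg, of "min d r"] 0 d r by (metis min_less_iff_conj)
        obtain h where h: "\<And>t. t \<in> {0..c} \<Longrightarrow> \<bar>h t - t\<bar> \<le> e \<and> \<bar>f t - g (h t)\<bar> \<le> e"
          using e(3) unfolding skorokhod_close_def by blast
        have hs: "\<bar>h (t + d) - (t + d)\<bar> \<le> e" "\<bar>f (t + d) - g (h (t + d))\<bar> \<le> e"
          using h[of "t + d"] t d by auto
        have "t < h (t + d)" "h (t + d) < b2"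
          using hs(1) e d by linarith+
        then have "dist (g (h (t + d))) (g t) < r"
          using b(4)[of "h (t + d)"] by auto
        moreover have "dist (f (t + d)) (f t) < r" using d by (intro b) auto
        ultimately have "\<bar>f t - g t\<bar> < 3 * r" using hs(2) e(2)
          unfolding dist_real_def by linarith
        then show False by (simp add: r_def)
      next
        case False
        then have tc: "t = c" using t by auto
        obtain e where e: "0 < e" "e < r" "skorokhod_close c e f g"
          using skorokhod_dist_less[OF fg, of r] 0 r by auto
        then obtain h where "h \<in> time_changes c" "\<bar>f c - g (h c)\<bar> \<le> e"
          using c by (auto simp: skorokhod_close_def)
        then have "\<bar>f c - g c\<bar> \<le> e"
          by (simp add: time_change_endpoint[OF _ c])
        then show False using e r by (simp add: r_def tc)
      qed
    qed
    then show "f = g"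
      using fg by (intro extensionalityI[of f "{0..c}" g]) (auto simp: cadlag_def)
  next
    assume "f = g"
    then have close: "skorokhod_close c e f g" if "0 < e" for e
      unfolding skorokhod_close_def by (intro bexI[OF _ id_time_change]) (use that in auto)
    have "skorokhod_dist c f g \<le> 0 + e" if "0 < e" for e
      using skorokhod_dist_le[OF that close[OF that]] by simp
    then have "skorokhod_dist c f g \<le> 0" by (rule field_le_epsilon)
    then show "skorokhod_dist c f g = 0"
      using nonneg[of f g] by linarith
  qed
  show "skorokhod_dist c f k \<le> skorokhod_dist c f g + skorokhod_dist c g k"
    if fgk: "f \<in> cadlag c" "g \<in> cadlag c" "k \<in> cadlag c" for f g k
  proof (rule field_le_epsilon)
    fix r :: real assume r: "0 < r"
    obtain a where a: "0 < a" "a < skorokhod_dist c f g + r / 2" "skorokhod_close c a f g"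
      using skorokhod_dist_less[OF fgk(1,2), of "skorokhod_dist c f g + r / 2"] r by auto
    obtain b where b: "0 < b" "b < skorokhod_dist c g k + r / 2" "skorokhod_close c b g k"
      using skorokhod_dist_less[OF fgk(2,3), of "skorokhod_dist c g k + r / 2"] r by auto
    have "skorokhod_dist c f k \<le> a + b"
      using a b by (intro skorokhod_dist_le skorokhod_close_trans) auto
    then show "skorokhod_dist c f k \<le> skorokhod_dist c f g + skorokhod_dist c g k + r"
      using a b by linarith
  qed
qed

definition borel_sigma :: "'a topology \<Rightarrow> 'a measure" where
  "borel_sigma T = sigma (topspace T) {U. openin T U}"

text \<open>
  Sequences are indexed by \<open>n \<ge> 1\<close>; nothing is required of the term with index 0.
\<close>

definition converges_in_distribution ::
  "'a topology \<Rightarrow> (nat \<Rightarrow> 'w measure) \<Rightarrow> (nat \<Rightarrow> 'w \<Rightarrow> 'a) \<Rightarrow> 'v measure \<Rightarrow> ('v \<Rightarrow> 'a) \<Rightarrow> bool"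
where
  "converges_in_distribution T M X N Y \<longleftrightarrow>
     (\<forall>n\<ge>1. prob_space (M n) \<and> X n \<in> M n \<rightarrow>\<^sub>M borel_sigma T) \<and>
     prob_space N \<and> Y \<in> N \<rightarrow>\<^sub>M borel_sigma T \<and>
     (\<forall>\<phi>. continuous_map T euclideanreal \<phi> \<and> bounded (\<phi> ` topspace T) \<longrightarrow>
        (\<lambda>n. \<integral>\<omega>. \<phi> (X n \<omega>) \<partial>M n) \<longlonglongrightarrow> (\<integral>\<omega>. \<phi> (Y \<omega>) \<partial>N))"

definition standard_brownian_motion :: "'v measure \<Rightarrow> (real \<Rightarrow> 'v \<Rightarrow> real) \<Rightarrow> bool" where
  "standard_brownian_motion N B \<longleftrightarrow>
     prob_space N \<and>
     (\<forall>\<omega>\<in>space N. B 0 \<omega> = 0) \<and>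
     (\<forall>\<omega>\<in>space N. continuous_on {0..} (\<lambda>t. B t \<omega>)) \<and>
     (\<forall>s t. 0 \<le> s \<and> s < t \<longrightarrow>
        distributed N lborel (\<lambda>\<omega>. B t \<omega> - B s \<omega>) (normal_density 0 (sqrt (t - s)))) \<and>
     (\<forall>\<tau> k. 0 \<le> \<tau> 0 \<and> strict_mono \<tau> \<longrightarrow>
        prob_space.indep_vars N (\<lambda>_. borel)
          (\<lambda>i \<omega>. B (\<tau> (Suc i)) \<omega> - B (\<tau> i) \<omega>) {..<k::nat})"

text \<open>
  Sequences are indexed from 0. Only the positive entries are matched up by the bijection, since a
  sequence with infinitely many positive entries and some zero entry has no decreasing
  rearrangement that keeps the zero entries.
\<close>

definition is_decreasing_rearrangement :: "(nat \<Rightarrow> real) \<Rightarrow> (nat \<Rightarrow> real) \<Rightarrow> bool" where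
  "is_decreasing_rearrangement x y \<longleftrightarrow>
     decseq y \<and> (\<forall>i. 0 \<le> y i) \<and>
     (\<exists>p. bij_betw p {i. 0 < y i} {i. 0 < x i} \<and> (\<forall>i\<in>{i. 0 < y i}. y i = x (p i)))"

definition decreasing_rearrangement :: "(nat \<Rightarrow> real) \<Rightarrow> nat \<Rightarrow> real" where
  "decreasing_rearrangement x = (THE y. is_decreasing_rearrangement x y)"

lemma is_decreasing_rearrangement_unique_aux:
  assumes fin: "\<And>s. 0 < s \<Longrightarrow> finite {i. s < x i}"
    and y: "is_decreasing_rearrangement x y" and s: "0 < s"
  shows "s < y k \<longleftrightarrow> k < card {i. s < x i}"
proof -
  obtain p where dec: "decseq y" and p: "bij_betw p {i. 0 < y i} {i. 0 < x i}"
    and yp: "\<And>i. 0 < y i \<Longrightarrow> y i = x (p i)"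
    using y by (auto simp: is_decreasing_rearrangement_def)
  have "bij_betw p {i. s < y i} {i. s < x i}"
    unfolding bij_betw_def
  proof
    have "{i. s < y i} \<subseteq> {i. 0 < y i}" using s by auto
    then show "inj_on p {i. s < y i}"
      using p unfolding bij_betw_def by (meson inj_on_subset)
    show "p ` {i. s < y i} = {i. s < x i}"
    proof safe
      fix i assume "s < y i"
      then show "s < x (p i)" using yp[of i] s by simp
    next
      fix j assume j: "s < x j"
      then have "j \<in> p ` {i. 0 < y i}" using p s by (auto simp: bij_betw_def)
      then obtain i where "0 < y i" "j = p i" by auto
      then show "j \<in> p ` {i. s < y i}" using yp[of i] j by auto
    qed
  qed
  then have card: "card {i. s < y i} = card {i. s < x i}" "finite {i. s < y i}"
    using fin[OF s] by (auto simp: bij_betw_same_card bij_betw_finite)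
  show ?thesis
  proof
    assume k: "s < y k"
    have "{..k} \<subseteq> {i. s < y i}" using k decseqD[OF dec] by fastforce
    then have "card {..k} \<le> card {i. s < y i}" using card(2) by (rule card_mono[rotated])
    then show "k < card {i. s < x i}" using card by simp
  next
    assume k: "k < card {i. s < x i}"
    show "s < y k"
    proof (rule ccontr)
      assume nk: "\<not> s < y k"
      have "i < k" if "s < y i" for i
      proof (rule ccontr)
        assume "\<not> i < k"
        then have "y i \<le> y k" using decseqD[OF dec, of k i] by simp
        then show False using that nk by simp
      qed
      then have "{i. s < y i} \<subseteq> {..<k}" by auto
      then have "card {i. s < y i} \<le> card {..<k}" by (rule card_mono[rotated]) simp
      then show False using k card by simp
    qed
  qed
qed

lemma is_decreasing_rearrangement_unique:
  assumes fin: "\<And>s. 0 < s \<Longrightarrow> finite {i. s < x i}"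
    and y: "is_decreasing_rearrangement x y" and z: "is_decreasing_rearrangement x z"
  shows "y = z"
proof
  fix k
  have iff: "s < y k \<longleftrightarrow> s < z k" if "0 < s" for s
    using is_decreasing_rearrangement_unique_aux[of x, OF fin _ that] y z by simp
  have nn: "0 \<le> y k" "0 \<le> z k" using y z by (auto simp: is_decreasing_rearrangement_def)
  show "y k = z k"
  proof (cases "y k" "z k" rule: linorder_cases)
    case less
    then obtain s where "y k < s" "s < z k" using dense by blast
    then show ?thesis using iff[of s] nn by simp
  next
    case greater
    then obtain s where "z k < s" "s < y k" using dense by blast
    then show ?thesis using iff[of s] nn by simp
  qed
qed

lemma is_decreasing_rearrangement_decreasing_rearrangement:
  assumes fin: "finite {i. 0 < x i}"
  shows "is_decreasing_rearrangement x (decreasing_rearrangement x)"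
proof -
  define l where "l = sort_key (\<lambda>i. - x i) (sorted_list_of_set {i. 0 < x i})"
  define y where "y = (\<lambda>k. if k < length l then x (l ! k) else 0)"
  have l: "set l = {i. 0 < x i}" "distinct l" "sorted (map (\<lambda>i. - x i) l)"
    using fin by (auto simp: l_def)
  have pos: "0 < x (l ! k)" if "k < length l" for k
    using l(1) nth_mem[OF that] by auto
  have ypos: "{k. 0 < y k} = {..<length l}"
    using pos by (auto simp: y_def split: if_splits)
  have "decseq y"
  proof (rule decseq_SucI)
    fix k
    show "y (Suc k) \<le> y k"
      using sorted_nth_mono[OF l(3), of k "Suc k"] pos[of k] by (auto simp: y_def)
  qed
  moreover have "0 \<le> y k" for k using pos[of k] by (auto simp: y_def)
  moreover have "bij_betw ((!) l) {k. 0 < y k} {i. 0 < x i}"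
    using bij_betw_nth[OF l(2) _ l(1)[symmetric]] ypos by simp
  moreover have "\<forall>k\<in>{k. 0 < y k}. y k = x (l ! k)" unfolding ypos by (simp add: y_def)
  ultimately have y: "is_decreasing_rearrangement x y"
    unfolding is_decreasing_rearrangement_def by blast
  have fin': "finite {i. s < x i}" if "0 < s" for s
    by (rule finite_subset[OF _ fin]) (use that in auto)
  show ?thesis
    unfolding decreasing_rearrangement_def
    by (rule theI[of _ y]) (use y is_decreasing_rearrangement_unique[of x, OF fin'] in blast)+
qed

text \<open>
  A graph is a pair of a vertex set and a set of edges, an edge being an unordered pair
  \<open>{i, j}\<close> with \<open>i \<noteq> j\<close>.
\<close>

type_synonym graph = "nat set \<times> nat set set"

definition connected_in :: "graph \<Rightarrow> (nat \<times> nat) set" where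
  "connected_in G = {(i, j). i \<in> fst G \<and> j \<in> fst G \<and> (i, j) \<in> {(k, l). {k, l} \<in> snd G}\<^sup>*}"

definition num_components :: "graph \<Rightarrow> nat" where
  "num_components G = card (fst G // connected_in G)"

definition potential_edges :: "(nat \<Rightarrow> real) \<Rightarrow> nat set set" where
  "potential_edges z = {{i, j} | i j. i \<noteq> j \<and> 0 < z i \<and> 0 < z j}"

text \<open>
  \<open>\<xi> e\<close> is the time at which the edge \<open>e\<close> appears. Independent exponential appearance times determine
  the law of the process and make it Markov.
\<close>

definition multiplicative_graph_process ::
  "'w measure \<Rightarrow> (nat \<Rightarrow> real) \<Rightarrow> (real \<Rightarrow> 'w \<Rightarrow> graph) \<Rightarrow> bool" where
  "multiplicative_graph_process M z G \<longleftrightarrow>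
     prob_space M \<and>
     (\<exists>\<xi>. prob_space.indep_vars M (\<lambda>_. borel) \<xi> (potential_edges z) \<and>
        (\<forall>i j. i \<noteq> j \<and> 0 < z i \<and> 0 < z j \<longrightarrow>
           distributed M lborel (\<xi> {i, j}) (exponential_density (z i * z j))) \<and>
        (\<forall>t\<ge>0. \<forall>\<omega>\<in>space M.
           G t \<omega> = ({i. 0 < z i}, {e \<in> potential_edges z. \<xi> e \<omega> \<le> t})))"

text \<open>
  \<open>\<theta>\<close> is indexed from 0, so its first \<open>m n\<close> terms are \<open>\<theta> 0, \<dots>, \<theta> (m n - 1)\<close>.
\<close>

definition initial_masses :: "(nat \<Rightarrow> real) \<Rightarrow> (nat \<Rightarrow> nat) \<Rightarrow> nat \<Rightarrow> nat \<Rightarrow> real" where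
  "initial_masses \<theta> m n = decreasing_rearrangement
     (\<lambda>k. if k < n then 1 else if k < n + m n then \<theta> (k - n) else 0)"

end

theory Submission
  imports Defs
begin

text \<open>
  The number of components equals the number of vertices minus the number of edges plus the excess.
  The excess is at most the number of edges lying on a cycle, and since cycles of length \<open>k\<close> at time
  \<open>t/n\<close> contribute at most \<open>(t/n \<Sum> z\<^sub>i\<^sup>2)\<^sup>k\<close> to the expected number of cycles, that number stays bounded for
  \<open>t \<le> c < 1\<close>. The fluctuations of order \<open>\<surd>n\<close> are therefore those of the edge count, which is a sum of
  independent indicators: its increments have Gaussian limits by a computation of characteristic
  functions, and it is tight by a fourth moment bound and dyadic chaining. The limit has continuous
  paths, so that the approximation by step functions on dyadic grids is uniform, and time changes
  are needed only for the measurability of the paths.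
\<close>

text \<open>The obstacle is that the available continuity theorem for characteristic functions is
  one-dimensional, while the claim concerns laws on a path space whose Borel sets come from a metric
  with time changes. Bounded Lipschitz functionals bridge the gap: they decide measurability and
  convergence, and on step paths they depend on finitely many coordinates.

  The constants of the limit come from the total rate. With \<open>S\<close> the sum of the first
  \<open>m n\<close> terms of \<theta>, about \<open>(n + S)^2 / 2 * (t / n)\<close>, that is
  \<open>n * t / 2 + S * t\<close>, edges are expected at time \<open>t / n\<close>. The first term
  gives the centring \<open>1 - t/2\<close> and, as the variance of a nearly Poisson count, the
  clock \<open>t/2\<close> of the Brownian motion. The second comes from pairs of a unit vertex and
  an added one; divided by \<open>sqrt n\<close> it tends to \<open>\<beta>\<^sub>2 * t / 2\<close>.
  The added vertices themselves give \<open>\<beta>\<^sub>1\<close>. The assumption on the squares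
  makes the sum of the squared masses equivalent to \<open>n\<close>: hence the threshold
  \<open>c < 1\<close> for cycles, and hence the bounded effect of the quadratic terms in the edge
  probabilities.\<close>

lemma space_borel_sigma: "space (borel_sigma T) = topspace T"
proof -
  have "{U. openin T U} \<subseteq> Pow (topspace T)" using openin_subset by blast
  then show ?thesis unfolding borel_sigma_def by (rule space_measure_of)
qed

section \<open>Lipschitz test functions on metric spaces\<close>

context Metric_space
begin

definition lipschitz_test :: "real \<Rightarrow> real \<Rightarrow> ('a \<Rightarrow> real) \<Rightarrow> bool" where
  "lipschitz_test C L \<phi> \<longleftrightarrow>
     (\<forall>x\<in>M. \<bar>\<phi> x\<bar> \<le> C) \<and> (\<forall>x\<in>M. \<forall>y\<in>M. \<bar>\<phi> x - \<phi> y\<bar> \<le> L * d x y)"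

lemma lipschitz_testD:
  assumes "lipschitz_test C L \<phi>" "x \<in> M"
  shows "\<bar>\<phi> x\<bar> \<le> C" and "y \<in> M \<Longrightarrow> \<bar>\<phi> x - \<phi> y\<bar> \<le> L * d x y"
  using assms unfolding lipschitz_test_def by auto

text \<open>The infimal convolution of \<open>\<phi>\<close> with \<open>k * d\<close>, also called
  Pasch-Hausdorff envelope: for bounded \<open>\<phi>\<close> and \<open>k \<ge> 0\<close> it is the
  largest \<open>k\<close>-Lipschitz minorant of \<open>\<phi>\<close> on \<open>M\<close>.\<close>

definition lip_reg :: "('a \<Rightarrow> real) \<Rightarrow> real \<Rightarrow> 'a \<Rightarrow> real" where
  "lip_reg \<phi> k x = (INF y\<in>M. \<phi> y + k * d x y)"

lemma lip_reg_bdd_below: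
  assumes "\<And>y. y \<in> M \<Longrightarrow> \<bar>\<phi> y\<bar> \<le> C" "0 \<le> k"
  shows "bdd_below ((\<lambda>y. \<phi> y + k * d x y) ` M)"
proof (rule bdd_belowI2)
  fix y assume "y \<in> M"
  then show "- C \<le> \<phi> y + k * d x y"
    using assms(1)[of y] mult_nonneg_nonneg[OF assms(2) nonneg[of x y]] by linarith
qed

lemma lip_reg_le:
  assumes "\<And>y. y \<in> M \<Longrightarrow> \<bar>\<phi> y\<bar> \<le> C" "0 \<le> k" "x \<in> M"
  shows "lip_reg \<phi> k x \<le> \<phi> x"
  unfolding lip_reg_def
  using cINF_lower[OF lip_reg_bdd_below[where x=x, OF assms(1,2)] assms(3)] assms(3) by simp

lemma lip_reg_ge:
  assumes "x \<in> M" "\<And>y. y \<in> M \<Longrightarrow> a \<le> \<phi> y + k * d x y"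
  shows "a \<le> lip_reg \<phi> k x"
  unfolding lip_reg_def using assms by (intro cINF_greatest) auto

text \<open>By the triangle inequality every function
  \<open>\<lambda>x. \<phi> y + k * d x y\<close> is \<open>k\<close>-Lipschitz, and a common
  Lipschitz constant passes to the infimum over \<open>y\<close>.\<close>

lemma lipschitz_test_lip_reg:
  assumes C: "\<And>y. y \<in> M \<Longrightarrow> \<bar>\<phi> y\<bar> \<le> C" and k: "0 \<le> k"
  shows "lipschitz_test C k (lip_reg \<phi> k)"
proof -
  have ge: "- C \<le> lip_reg \<phi> k x" if "x \<in> M" for x
  proof (rule lip_reg_ge[OF that])
    fix y assume "y \<in> M"
    then show "- C \<le> \<phi> y + k * d x y"
      using C[of y] mult_nonneg_nonneg[OF k nonneg[of x y]] by linarith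
  qed
  have "lip_reg \<phi> k x - k * d x x' \<le> lip_reg \<phi> k x'" if x: "x \<in> M" "x' \<in> M" for x x'
  proof (rule lip_reg_ge[OF x(2)])
    fix y assume y: "y \<in> M"
    have "lip_reg \<phi> k x \<le> \<phi> y + k * d x y"
      unfolding lip_reg_def by (rule cINF_lower[OF lip_reg_bdd_below[OF C k] y])
    moreover have "k * d x y \<le> k * (d x x' + d x' y)"
      using triangle[OF x y] k by (intro mult_left_mono)
    ultimately show "lip_reg \<phi> k x - k * d x x' \<le> \<phi> y + k * d x' y"
      by (simp add: algebra_simps)
  qed
  note * = this
  have "\<bar>lip_reg \<phi> k x - lip_reg \<phi> k y\<bar> \<le> k * d x y" if "x \<in> M" "y \<in> M" for x y
    using *[OF that] *[OF that(2,1)] commute[of x y] by (simp add: abs_le_iff)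
  moreover have "\<bar>lip_reg \<phi> k x\<bar> \<le> C" if "x \<in> M" for x
    using ge[OF that] lip_reg_le[where \<phi>=\<phi> and C=C, OF C k that] C[OF that] by linarith
  ultimately show ?thesis by (simp add: lipschitz_test_def)
qed

text \<open>Points \<open>y\<close> close to \<open>x\<close> have \<open>\<phi> y\<close> above
  \<open>\<phi> x - r/2\<close> by continuity. Points at distance at least \<open>e\<close> pay a
  penalty \<open>k * e \<ge> 2 * C\<close>, which exceeds any possible gain, since
  \<open>\<phi>\<close> varies by at most \<open>2 * C\<close>.\<close>

lemma lip_reg_tendsto:
  assumes C: "\<And>y. y \<in> M \<Longrightarrow> \<bar>\<phi> y\<bar> \<le> C" and cont: "continuous_map mtopology euclideanreal \<phi>"
    and x: "x \<in> M"
  shows "(\<lambda>k. lip_reg \<phi> (real k) x) \<longlonglongrightarrow> \<phi> x"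
proof (rule LIMSEQ_I)
  fix r :: real assume r: "0 < r"
  have "openin mtopology {y \<in> topspace mtopology. \<phi> y \<in> {\<phi> x - r/2<..}}"
    using cont by (rule openin_continuous_map_preimage) simp
  then obtain e where e: "e > 0" "mball x e \<subseteq> {y \<in> M. \<phi> x - r/2 < \<phi> y}"
    using x r unfolding openin_mtopology by auto
  obtain k0 :: nat where k0: "2 * C / e \<le> real k0" using real_arch_simple by blast
  have C0: "0 \<le> C" using C[OF x] by simp
  have "norm (lip_reg \<phi> (real k) x - \<phi> x) < r" if k: "k \<ge> k0" for k
  proof -
    have "\<phi> x - r/2 \<le> lip_reg \<phi> (real k) x"
    proof (rule lip_reg_ge[OF x])
      fix y assume y: "y \<in> M"
      show "\<phi> x - r/2 \<le> \<phi> y + real k * d x y"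
      proof (cases "d x y < e")
        case True
        then have "\<phi> x - r/2 < \<phi> y" using e(2) x y by auto
        moreover have "0 \<le> real k * d x y" by simp
        ultimately show ?thesis by linarith
      next
        case False
        have "2 * C \<le> real k0 * e" using k0 e(1) by (simp add: field_simps)
        also have "\<dots> \<le> real k * d x y" using k False e(1) by (intro mult_mono) auto
        finally show ?thesis using C[OF x] C[OF y] r by linarith
      qed
    qed
    then show ?thesis using lip_reg_le[where \<phi>=\<phi> and C=C and k="real k", OF C _ x] r by simp
  qed
  then show "\<exists>k0. \<forall>k\<ge>k0. norm (lip_reg \<phi> (real k) x - \<phi> x) < r" by blast
qed

text \<open>Every open set is the positivity set of a 1-Lipschitz function, so the preimages of the
  generating sets are obtained from measurability of real-valued functions.\<close>

lemma measurable_borel_sigma_lipschitz: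
  assumes X: "\<And>\<omega>. \<omega> \<in> space N \<Longrightarrow> X \<omega> \<in> M"
    and meas: "\<And>C L \<phi>. 0 \<le> L \<Longrightarrow> lipschitz_test C L \<phi> \<Longrightarrow> (\<lambda>\<omega>. \<phi> (X \<omega>)) \<in> borel_measurable N"
  shows "X \<in> N \<rightarrow>\<^sub>M borel_sigma mtopology"
  unfolding borel_sigma_def
proof (rule measurable_measure_of)
  show "{U. openin mtopology U} \<subseteq> Pow (topspace mtopology)"
    using openin_subset by blast
  show "X \<in> space N \<rightarrow> topspace mtopology" using X by auto
  fix U assume "U \<in> {U. openin mtopology U}"
  then have U: "openin mtopology U" by simp
  define \<phi> where "\<phi> = lip_reg (indicator U) 1"
  have C: "\<bar>indicator U y :: real\<bar> \<le> 1" for y by (simp add: indicator_def)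
  \<comment> \<open>If the ball of radius \<open>e\<close> about \<open>x\<close> lies in
    \<open>U\<close>, then a point \<open>y\<close> of \<open>U\<close> has indicator 1 and any
    other point has distance at least \<open>e\<close> from \<open>x\<close>; hence the bound
    \<open>min 1 e\<close>. Off \<open>U\<close> the envelope lies below the indicator, which is
    0.\<close>
  have "U = {x \<in> M. 0 < \<phi> x}"
  proof (intro equalityI subsetI)
    fix x assume x: "x \<in> U"
    then obtain e where e: "e > 0" "mball x e \<subseteq> U" and xM: "x \<in> M"
      using U unfolding openin_mtopology by blast
    have "min 1 e \<le> \<phi> x" unfolding \<phi>_def
    proof (rule lip_reg_ge[OF xM])
      fix y assume y: "y \<in> M"
      show "min 1 e \<le> indicator U y + 1 * d x y"
      proof (cases "y \<in> U")
        case True then show ?thesis using nonneg[of x y] by (simp add: min.coboundedI1)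
      next
        case False
        then have "\<not> d x y < e" using e xM y by auto
        then show ?thesis by (simp add: min.coboundedI2 indicator_def)
      qed
    qed
    then show "x \<in> {x \<in> M. 0 < \<phi> x}" using e(1) xM by auto
  next
    fix x assume x: "x \<in> {x \<in> M. 0 < \<phi> x}"
    then have "0 < (indicator U x :: real)"
      using lip_reg_le[of "indicator U" 1 1 x] C unfolding \<phi>_def by fastforce
    then show "x \<in> U" by (simp add: indicator_def split: if_splits)
  qed
  then have eq: "X -` U \<inter> space N = {\<omega> \<in> space N. 0 < \<phi> (X \<omega>)}" using X by auto
  have "lipschitz_test 1 1 \<phi>" unfolding \<phi>_def by (rule lipschitz_test_lip_reg) (use C in auto)
  then have [measurable]: "(\<lambda>\<omega>. \<phi> (X \<omega>)) \<in> borel_measurable N" by (intro meas) auto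
  show "X -` U \<inter> space N \<in> sets N" unfolding eq by measurable
qed

lemma measurable_continuous_map:
  assumes X: "X \<in> N \<rightarrow>\<^sub>M borel_sigma mtopology" and cont: "continuous_map mtopology euclideanreal \<phi>"
  shows "(\<lambda>\<omega>. \<phi> (X \<omega>)) \<in> borel_measurable N"
proof (rule borel_measurableI)
  fix S :: "real set" assume "open S"
  then have o: "openin mtopology {y \<in> topspace mtopology. \<phi> y \<in> S}"
    using cont by (intro openin_continuous_map_preimage[of _ euclideanreal]) auto
  have sp: "space (borel_sigma mtopology) = M"
    by (simp add: space_borel_sigma)
  have "{y \<in> topspace mtopology. \<phi> y \<in> S} \<in> sets (borel_sigma mtopology)"
    unfolding borel_sigma_def using o openin_subset by (subst sets_measure_of) blast+
  from measurable_sets[OF X this]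
  have "X -` {y \<in> topspace mtopology. \<phi> y \<in> S} \<inter> space N \<in> sets N" .
  also have "X -` {y \<in> topspace mtopology. \<phi> y \<in> S} \<inter> space N = (\<lambda>\<omega>. \<phi> (X \<omega>)) -` S \<inter> space N"
    using measurable_space[OF X] sp by auto
  finally show "(\<lambda>\<omega>. \<phi> (X \<omega>)) -` S \<inter> space N \<in> sets N" .
qed

lemma continuous_map_lipschitz_test:
  assumes "0 \<le> L" "lipschitz_test C L \<phi>"
  shows "continuous_map mtopology euclideanreal \<phi>"
proof -
  have "continuous_map mtopology (Met_TC.mtopology) \<phi>"
    unfolding metric_continuous_map[OF Met_TC.Metric_space_axioms]
  proof (intro conjI ballI allI impI)
    fix a and e :: real assume a: "a \<in> M" and e: "0 < e"
    show "\<exists>\<delta>>0. \<forall>x. x \<in> M \<and> d a x < \<delta> \<longrightarrow> dist (\<phi> a) (\<phi> x) < e"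
    \<comment> \<open>\<open>L + 1\<close> in place of \<open>L\<close> keeps the radius defined
      when \<open>L = 0\<close>.\<close>
    proof (intro exI[of _ "e / (L + 1)"] conjI allI impI)
      show "0 < e / (L + 1)" using e assms(1) by simp
      fix x assume x: "x \<in> M \<and> d a x < e / (L + 1)"
      have "dist (\<phi> a) (\<phi> x) \<le> L * d a x"
        using assms(2) a x by (simp add: lipschitz_test_def dist_real_def)
      also have "\<dots> \<le> (L + 1) * d a x" by (simp add: algebra_simps)
      also have "\<dots> < e" using x assms(1) by (simp add: field_simps)
      finally show "dist (\<phi> a) (\<phi> x) < e" .
    qed
  qed auto
  then show ?thesis by (simp add: mtopology_is_euclidean)
qed

text \<open>
  Portmanteau: a bounded continuous function is the increasing limit of its Lipschitz
  regularisations, which gives \<open>liminf E \<phi>(X\<^sub>n) \<ge> E \<phi>(Y)\<close>; the same is applied to \<open>- \<phi>\<close>.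
\<close>

lemma tendsto_expectation_of_lipschitz:
  assumes N: "\<And>n. n \<ge> n0 \<Longrightarrow> prob_space (N n)"
    and X: "\<And>n. n \<ge> n0 \<Longrightarrow> X n \<in> N n \<rightarrow>\<^sub>M borel_sigma mtopology"
    and N': "prob_space N'" and Y: "Y \<in> N' \<rightarrow>\<^sub>M borel_sigma mtopology"
    and lip: "\<And>C L \<phi>. 0 \<le> L \<Longrightarrow> lipschitz_test C L \<phi> \<Longrightarrow>
        (\<lambda>n. \<integral>\<omega>. \<phi> (X n \<omega>) \<partial>N n) \<longlonglongrightarrow> (\<integral>\<omega>. \<phi> (Y \<omega>) \<partial>N')"
    and \<phi>: "continuous_map mtopology euclideanreal \<phi>" "bounded (\<phi> ` M)"
  shows "(\<lambda>n. \<integral>\<omega>. \<phi> (X n \<omega>) \<partial>N n) \<longlonglongrightarrow> (\<integral>\<omega>. \<phi> (Y \<omega>) \<partial>N')"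
proof -
  have sp: "space (borel_sigma mtopology) = M"
    by (simp add: space_borel_sigma)
  \<comment> \<open>Half of \<open>r\<close> pays for replacing \<open>\<psi>\<close> by a fixed
    Lipschitz minorant under \<open>Y\<close>, the other half for the convergence of the
    expectations of that minorant. Under \<open>X n\<close> the minorant is simply below
    \<open>\<psi>\<close>.\<close>
  have lower: "\<exists>n1. \<forall>n\<ge>n1. (\<integral>\<omega>. \<psi> (Y \<omega>) \<partial>N') - r < (\<integral>\<omega>. \<psi> (X n \<omega>) \<partial>N n)"
    if \<psi>: "continuous_map mtopology euclideanreal \<psi>" and C: "\<And>y. y \<in> M \<Longrightarrow> \<bar>\<psi> y\<bar> \<le> C" and r: "0 < r"
    for \<psi> C r
  proof -
    have mY: "Y \<omega> \<in> M" if "\<omega> \<in> space N'" for \<omega> using measurable_space[OF Y that] sp by simp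
    have mX: "X n \<omega> \<in> M" if "\<omega> \<in> space (N n)" "n \<ge> n0" for n \<omega>
      using measurable_space[OF X that(1)] that(2) sp by simp
    have lt: "lipschitz_test C (real k) (lip_reg \<psi> (real k))" for k
      by (rule lipschitz_test_lip_reg) (use C in auto)
    note lc = continuous_map_lipschitz_test[OF _ lt]
    have b: "\<bar>lip_reg \<psi> (real k) x\<bar> \<le> C" if "x \<in> M" for x k
      using lt[of k] that by (simp add: lipschitz_test_def)
    interpret N': prob_space N' by (rule N')
    have "(\<lambda>k. \<integral>\<omega>. lip_reg \<psi> (real k) (Y \<omega>) \<partial>N') \<longlonglongrightarrow> (\<integral>\<omega>. \<psi> (Y \<omega>) \<partial>N')"
    proof (rule integral_dominated_convergence[where w="\<lambda>_. C"])
      show "AE x in N'. (\<lambda>k. lip_reg \<psi> (real k) (Y x)) \<longlonglongrightarrow> \<psi> (Y x)"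
        using lip_reg_tendsto[OF C \<psi>] mY by auto
      show "AE x in N'. norm (lip_reg \<psi> (real k) (Y x)) \<le> C" for k using b mY by auto
    qed (auto intro!: measurable_continuous_map[OF Y] lc \<psi>)
    then have "eventually (\<lambda>k. (\<integral>\<omega>. \<psi> (Y \<omega>) \<partial>N') - r/2 < (\<integral>\<omega>. lip_reg \<psi> (real k) (Y \<omega>) \<partial>N')) sequentially"
      by (rule order_tendstoD) (use r in simp)
    then obtain k where k: "(\<integral>\<omega>. \<psi> (Y \<omega>) \<partial>N') - r/2 < (\<integral>\<omega>. lip_reg \<psi> (real k) (Y \<omega>) \<partial>N')"
      by (auto simp: eventually_sequentially)
    have "eventually (\<lambda>n. (\<integral>\<omega>. lip_reg \<psi> (real k) (Y \<omega>) \<partial>N') - r/2 <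
        (\<integral>\<omega>. lip_reg \<psi> (real k) (X n \<omega>) \<partial>N n)) sequentially"
      using r by (intro order_tendstoD(1)[OF lip[OF _ lt]]) auto
    then obtain n1 where n1: "\<And>n. n \<ge> n1 \<Longrightarrow> (\<integral>\<omega>. lip_reg \<psi> (real k) (Y \<omega>) \<partial>N') - r/2 <
        (\<integral>\<omega>. lip_reg \<psi> (real k) (X n \<omega>) \<partial>N n)"
      by (auto simp: eventually_sequentially)
    have "(\<integral>\<omega>. \<psi> (Y \<omega>) \<partial>N') - r < (\<integral>\<omega>. \<psi> (X n \<omega>) \<partial>N n)" if n: "n \<ge> max n0 n1" for n
    proof -
      have nn: "n \<ge> n0" "n \<ge> n1" using n by auto
      interpret Nn: prob_space "N n" using N[OF nn(1)] .
      have "(\<integral>\<omega>. lip_reg \<psi> (real k) (X n \<omega>) \<partial>N n) \<le> (\<integral>\<omega>. \<psi> (X n \<omega>) \<partial>N n)"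
      proof (rule integral_mono)
        show "integrable (N n) (\<lambda>\<omega>. lip_reg \<psi> (real k) (X n \<omega>))"
          by (rule Nn.integrable_const_bound[where B=C])
            (auto intro!: measurable_continuous_map[OF X[OF nn(1)]] lc b mX nn)
        show "integrable (N n) (\<lambda>\<omega>. \<psi> (X n \<omega>))"
          by (rule Nn.integrable_const_bound[where B=C])
            (auto intro!: measurable_continuous_map[OF X[OF nn(1)]] \<psi> C mX nn)
        show "lip_reg \<psi> (real k) (X n \<omega>) \<le> \<psi> (X n \<omega>)" if "\<omega> \<in> space (N n)" for \<omega>
          by (rule lip_reg_le[OF C]) (use mX[OF that nn(1)] in auto)
      qed
      then show ?thesis using k n1[OF nn(2)] by linarith
    qed
    then show ?thesis by blast
  qed
  obtain C where C: "\<And>y. y \<in> M \<Longrightarrow> \<bar>\<phi> y\<bar> \<le> C"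
    using \<phi>(2) unfolding bounded_iff by auto
  show ?thesis
  proof (rule LIMSEQ_I)
    fix r :: real assume r: "0 < r"
    obtain n1 where n1: "\<And>n. n \<ge> n1 \<Longrightarrow> (\<integral>\<omega>. \<phi> (Y \<omega>) \<partial>N') - r < (\<integral>\<omega>. \<phi> (X n \<omega>) \<partial>N n)"
      using lower[OF \<phi>(1) C r] by blast
    have "continuous_map mtopology euclideanreal (\<lambda>x. - \<phi> x)"
      using \<phi>(1) by (rule continuous_map_minus)
    then have "\<exists>n2. \<forall>n\<ge>n2. (\<integral>\<omega>. - \<phi> (Y \<omega>) \<partial>N') - r < (\<integral>\<omega>. - \<phi> (X n \<omega>) \<partial>N n)"
      by (rule lower[of "\<lambda>x. - \<phi> x" C r]) (use C r in auto)
    then obtain n2 where n2: "\<And>n. n \<ge> n2 \<Longrightarrow> (\<integral>\<omega>. \<phi> (X n \<omega>) \<partial>N n) < (\<integral>\<omega>. \<phi> (Y \<omega>) \<partial>N') + r"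
      by (auto simp: algebra_simps)
    show "\<exists>no. \<forall>n\<ge>no. norm ((\<integral>\<omega>. \<phi> (X n \<omega>) \<partial>N n) - (\<integral>\<omega>. \<phi> (Y \<omega>) \<partial>N')) < r"
      using n1 n2 by (intro exI[of _ "max n1 n2"]) (force simp: abs_less_iff)
  qed
qed

end

section \<open>Step functions in the Skorokhod space\<close>

text \<open>Lipschitz continuity for the maximum norm of the coordinates \<open>0..k\<close>. The
  case \<open>e = 0\<close> is included, so \<open>g\<close> is a function of these coordinates
  only.\<close>

definition coord_lipschitz :: "nat \<Rightarrow> real \<Rightarrow> ((nat \<Rightarrow> real) \<Rightarrow> real) \<Rightarrow> bool" where
  "coord_lipschitz k L g \<longleftrightarrow>
     (\<forall>v w e. (\<forall>j\<le>k. \<bar>v j - w j\<bar> \<le> e) \<longrightarrow> \<bar>g v - g w\<bar> \<le> L * e)"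

lemma coord_lipschitzD:
  "coord_lipschitz k L g \<Longrightarrow> (\<And>j. j \<le> k \<Longrightarrow> \<bar>v j - w j\<bar> \<le> e) \<Longrightarrow> \<bar>g v - g w\<bar> \<le> L * e"
  unfolding coord_lipschitz_def by blast

text \<open>Depending continuously on finitely many coordinates, \<open>g\<close> is continuous in
  the product topology, whose Borel sets make coordinatewise measurable maps measurable.\<close>

lemma measurable_coord_lipschitz:
  assumes g: "coord_lipschitz k L g" and L: "0 \<le> L"
    and V: "\<And>j. V j \<in> borel_measurable N"
  shows "(\<lambda>\<omega>. g (\<lambda>j. V j \<omega>)) \<in> borel_measurable N"
proof -
  have "isCont g v" for v
    unfolding continuous_at_sequentially
  proof (intro allI impI)
    fix x assume x: "x \<longlonglongrightarrow> v"
    have xj: "(\<lambda>n. x n j) \<longlonglongrightarrow> v j" for j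
    proof -
      have "isCont (\<lambda>y::nat \<Rightarrow> real. y j) v"
      proof -
        have "continuous_on UNIV (\<lambda>y::nat \<Rightarrow> real. y j)" by (rule continuous_on_product_coordinates)
        then show ?thesis using continuous_on_eq_continuous_at[OF open_UNIV] by blast
      qed
      from isCont_tendsto_compose[OF this x] show ?thesis .
    qed
    show "(g \<circ> x) \<longlonglongrightarrow> g v"
    proof (rule tendstoI)
      fix e :: real assume e: "0 < e"
      have "eventually (\<lambda>n. \<forall>j\<in>{..k}. dist (x n j) (v j) < e / (L + 1)) sequentially"
        using e L tendstoD[OF xj] by (intro eventually_ball_finite) auto
      then show "eventually (\<lambda>n. dist ((g \<circ> x) n) (g v) < e) sequentially"
      proof eventually_elim
        fix n assume *: "\<forall>j\<in>{..k}. dist (x n j) (v j) < e / (L + 1)"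
        have "\<bar>g (x n) - g v\<bar> \<le> L * (e / (L + 1))"
          by (rule coord_lipschitzD[OF g]) (use * in \<open>force simp: dist_real_def\<close>)
        also have "\<dots> < e" using e L by (simp add: field_simps)
        finally show "dist ((g \<circ> x) n) (g v) < e" by (simp add: dist_real_def)
      qed
    qed
  qed
  then have "continuous_on UNIV g" by (simp add: continuous_on_eq_continuous_at)
  then have "g \<in> borel_measurable borel" by (rule borel_measurable_continuous_onI)
  moreover have "(\<lambda>\<omega> j. V j \<omega>) \<in> N \<rightarrow>\<^sub>M borel"
    using V by (rule measurable_coordinatewise_then_product)
  ultimately show ?thesis by (rule measurable_compose[rotated])
qed

definition step_path :: "real \<Rightarrow> real \<Rightarrow> (nat \<Rightarrow> real) \<Rightarrow> real \<Rightarrow> real" where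
  "step_path c a v = (\<lambda>t\<in>{0..c}. v (nat \<lfloor>a * t\<rfloor>))"

text \<open>A right-continuous step function, described by the set of jump times already passed.
  This form orders no jump times, allows several jumps at once, and is immediate for any function of
  the set of edges present.\<close>

definition steps_at :: "real \<Rightarrow> real set \<Rightarrow> (real \<Rightarrow> real) \<Rightarrow> bool" where
  "steps_at c S f \<longleftrightarrow> finite S \<and>
     (\<forall>t\<in>{0..c}. \<forall>u\<in>{0..c}. {s\<in>S. s \<le> t} = {s\<in>S. s \<le> u} \<longrightarrow> f t = f u)"

text \<open>Just after \<open>t\<close> no further point of the finite set \<open>S\<close> has been
  passed, and just before \<open>t\<close> exactly the points below \<open>t\<close> have been; so
  the step part is locally constant on both sides.\<close>

lemma cadlag_steps_plus_continuous:
  assumes f: "steps_at c S f" and g: "continuous_on {0..c} g"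
  shows "(\<lambda>t\<in>{0..c}. f t + g t) \<in> cadlag c"
proof -
  have fin: "finite S"
    and eq: "\<And>t u. t \<in> {0..c} \<Longrightarrow> u \<in> {0..c} \<Longrightarrow> {s\<in>S. s \<le> t} = {s\<in>S. s \<le> u} \<Longrightarrow> f t = f u"
    using f unfolding steps_at_def by blast+
  have g_within: "(g \<longlongrightarrow> g t) (at t within {0..c})" if "t \<in> {0..c}" for t
    using g that by (auto simp: continuous_on_def)
  let ?F = "\<lambda>t\<in>{0..c}. f t + g t"
  have right: "(?F \<longlongrightarrow> ?F t) (at_right t)" if t: "t \<in> {0..<c}" for t
  proof -
    have "eventually (\<lambda>u. \<forall>s\<in>S. s \<le> u \<longleftrightarrow> s \<le> t) (at_right t)"
    proof (rule eventually_ball_finite[OF fin], intro ballI)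
      fix s
      show "eventually (\<lambda>u. s \<le> u \<longleftrightarrow> s \<le> t) (at_right t)"
      proof (cases "s \<le> t")
        case True then show ?thesis
          by (intro eventually_at_rightI[of t "t + 1"]) auto
      next
        case False then show ?thesis
          by (intro eventually_at_rightI[of t s]) auto
      qed
    qed
    moreover have "eventually (\<lambda>u. t < u \<and> u < c) (at_right t)"
      using t by (intro eventually_at_rightI[of t c]) auto
    ultimately have ev: "eventually (\<lambda>u. ?F u = f t + g u) (at_right t)"
    proof eventually_elim
      case (elim u)
      then have "{s\<in>S. s \<le> u} = {s\<in>S. s \<le> t}" by auto
      then have "f u = f t" using elim t by (intro eq) auto
      then show ?case using elim t by simp
    qed
    have "(g \<longlongrightarrow> g t) (at t within {t..c})"
      using t by (intro tendsto_within_subset[OF g_within]) auto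
    then have "(g \<longlongrightarrow> g t) (at_right t)" using t by (simp add: at_within_Icc_at_right)
    then have "((\<lambda>u. f t + g u) \<longlongrightarrow> f t + g t) (at_right t)" by (intro tendsto_intros)
    then show ?thesis using t by (simp add: tendsto_cong[OF ev])
  qed
  have left: "\<exists>l. (?F \<longlongrightarrow> l) (at_left t)" if t: "t \<in> {0<..c}" for t
  proof -
    have "eventually (\<lambda>u. \<forall>s\<in>S. s \<le> u \<longleftrightarrow> s < t) (at_left t)"
    proof (rule eventually_ball_finite[OF fin], intro ballI)
      fix s
      show "eventually (\<lambda>u. s \<le> u \<longleftrightarrow> s < t) (at_left t)"
      proof (cases "s < t")
        case True then show ?thesis
          by (intro eventually_at_leftI[of s t]) auto
      next
        case False then show ?thesis
          by (intro eventually_at_leftI[of "t - 1" t]) auto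
      qed
    qed
    moreover have "eventually (\<lambda>u. 0 < u \<and> u < t) (at_left t)"
      using t by (intro eventually_at_leftI[of 0 t]) auto
    ultimately have "eventually (\<lambda>u. (\<forall>s\<in>S. s \<le> u \<longleftrightarrow> s < t) \<and> 0 < u \<and> u < t) (at_left t)"
      by (rule eventually_conj)
    then obtain b where b: "b < t" and
      bu: "\<And>u. b < u \<Longrightarrow> u < t \<Longrightarrow> (\<forall>s\<in>S. s \<le> u \<longleftrightarrow> s < t) \<and> 0 < u \<and> u < t"
      by (auto simp: eventually_at_left_field)
    \<comment> \<open>Any point of this interval, which is free of jump times, will do:
      \<open>f w\<close> is the left limit of \<open>f\<close> at \<open>t\<close>.\<close>
    define w where "w = (b + t) / 2"
    have w: "b < w" "w < t" using b by (auto simp: w_def)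
    have ev: "eventually (\<lambda>u. ?F u = f w + g u) (at_left t)"
    proof (rule eventually_at_leftI[OF _ b])
      fix u assume "u \<in> {b<..<t}"
      then have u: "b < u" "u < t" by auto
      have "{s\<in>S. s \<le> u} = {s\<in>S. s \<le> w}" using bu[OF u] bu[OF w] by auto
      then have "f u = f w" using bu[OF u] bu[OF w] t by (intro eq) auto
      then show "?F u = f w + g u" using bu[OF u] t by simp
    qed
    have "(g \<longlongrightarrow> g t) (at t within {0..t})"
      using t by (intro tendsto_within_subset[OF g_within]) auto
    then have "(g \<longlongrightarrow> g t) (at_left t)" using t by (simp add: at_within_Icc_at_left)
    then have "((\<lambda>u. f w + g u) \<longlongrightarrow> f w + g t) (at_left t)" by (intro tendsto_intros)
    then show ?thesis by (auto simp: tendsto_cong[OF ev])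
  qed
  show ?thesis unfolding cadlag_def using right left by auto
qed

lemma cadlag_step_path:
  assumes a: "0 \<le> a" and c: "0 \<le> c"
  shows "step_path c a v \<in> cadlag c"
proof -
  define S where "S = (\<lambda>j. real j / a) ` {0..nat \<lfloor>a * c\<rfloor>}"
  have "v (nat \<lfloor>a * t\<rfloor>) = v (nat \<lfloor>a * u\<rfloor>)"
    if t: "t \<in> {0..c}" and u: "u \<in> {0..c}" and eq: "{s\<in>S. s \<le> t} = {s\<in>S. s \<le> u}" for t u
  proof (cases "a = 0")
    case False
    then have a: "0 < a" using a by simp
    \<comment> \<open>The inclusion says that the grid point preceding \<open>t\<close> also
      precedes \<open>u\<close>; applied in both directions it identifies the two cells.\<close>
    have le: "nat \<lfloor>a * t\<rfloor> \<le> nat \<lfloor>a * u\<rfloor>"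
      if t: "t \<in> {0..c}" and u: "u \<in> {0..c}" and sub: "{s\<in>S. s \<le> t} \<subseteq> {s\<in>S. s \<le> u}" for t u
    proof -
      define j where "j = nat \<lfloor>a * t\<rfloor>"
      have j: "real j \<le> a * t" using a t by (simp add: j_def)
      have "a * t \<le> a * c" using a t by simp
      then have "j \<le> nat \<lfloor>a * c\<rfloor>" unfolding j_def by (intro nat_mono floor_mono)
      then have "real j / a \<in> {s\<in>S. s \<le> t}"
        using j a by (auto simp: S_def field_simps)
      then have "real j / a \<le> u" using sub by auto
      then have "real j \<le> a * u" using a by (simp add: field_simps)
      then show ?thesis unfolding j_def[symmetric] by (simp add: le_nat_floor)
    qed
    have "nat \<lfloor>a * t\<rfloor> = nat \<lfloor>a * u\<rfloor>"
      using eq by (intro antisym le t u) auto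
    then show ?thesis by simp
  qed simp
  moreover have "finite S" by (simp add: S_def)
  ultimately have "steps_at c S (\<lambda>t. v (nat \<lfloor>a * t\<rfloor>))" unfolding steps_at_def by blast
  from cadlag_steps_plus_continuous[OF this continuous_on_const[where c=0]]
  show ?thesis by (simp add: step_path_def)
qed

section \<open>Bounds on the Skorokhod distance and approximation by sampled step paths\<close>

lemma skorokhod_dist_le_nonneg:
  assumes "0 \<le> e" "skorokhod_close c e f g"
  shows "skorokhod_dist c f g \<le> e"
proof (rule field_le_epsilon)
  fix r :: real assume r: "0 < r"
  have "skorokhod_close c (e + r) f g"
    using assms(2) r unfolding skorokhod_close_def by force
  then show "skorokhod_dist c f g \<le> e + r" using assms r by (intro skorokhod_dist_le) auto
qed

lemma skorokhod_dist_le_uniform: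
  assumes "0 \<le> e" "\<And>t. t \<in> {0..c} \<Longrightarrow> \<bar>f t - g t\<bar> \<le> e"
  shows "skorokhod_dist c f g \<le> e"
  by (rule skorokhod_dist_le_nonneg[OF assms(1)], unfold skorokhod_close_def, rule bexI[OF _ id_time_change])
    (use assms in auto)

lemma finite_separated:
  fixes S :: "real set"
  assumes "finite S"
  shows "\<exists>\<delta>>0. \<forall>s\<in>S. \<forall>t\<in>S. s \<noteq> t \<longrightarrow> \<delta> \<le> \<bar>s - t\<bar>"
proof -
  \<comment> \<open>The element 1 keeps \<open>Min D\<close> meaningful when \<open>S\<close> has
    fewer than two points.\<close>
  define D where "D = insert 1 ((\<lambda>(s, t). \<bar>s - t\<bar>) ` {(s, t). s \<in> S \<and> t \<in> S \<and> s \<noteq> t})"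
  have "{(s, t). s \<in> S \<and> t \<in> S \<and> s \<noteq> t} \<subseteq> S \<times> S" by auto
  then have fin: "finite D"
    unfolding D_def using assms by (intro finite.insertI finite_imageI) (rule finite_subset, auto)
  show ?thesis
  proof (intro exI[of _ "Min D"] conjI ballI impI)
    show "0 < Min D" using fin by (subst Min_gr_iff) (auto simp: D_def)
    show "Min D \<le> \<bar>s - t\<bar>" if "s \<in> S" "t \<in> S" "s \<noteq> t" for s t
      using fin that by (intro Min_le) (auto simp: D_def)
  qed
qed

text \<open>
  The time change moves each jump time \<open>s\<close> to the next point \<open>cl s\<close> of the grid. Rounding up
  and rounding down form a Galois connection, so that \<open>s \<le> t\<close> iff \<open>s\<close> lies below the
  grid point preceding \<open>h t\<close>.
\<close>

lemma skorokhod_dist_step_path_tendsto: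
  assumes c: "0 \<le> c" and f: "steps_at c S f" and g: "continuous_on {0..c} g"
    and F: "\<And>t. t \<in> {0..c} \<Longrightarrow> F t = f t + g t"
  shows "(\<lambda>k. skorokhod_dist c (\<lambda>t\<in>{0..c}. F t)
           (step_path c (real (Suc k) / c) (\<lambda>j. F (min c (real j * c / real (Suc k)))))) \<longlonglongrightarrow> 0"
proof (cases "c = 0")
  \<comment> \<open>Here \<open>real (Suc k) / c\<close> is 0 by the convention for division, and
    both paths consist of the value at the single time 0, where they agree.\<close>
  case True
  have "skorokhod_dist c (\<lambda>t\<in>{0..c}. F t)
           (step_path c (real (Suc k) / c) (\<lambda>j. F (min c (real j * c / real (Suc k))))) \<le> 0" for k
    by (rule skorokhod_dist_le_uniform) (auto simp: step_path_def True)
  moreover have "0 \<le> skorokhod_dist c f g" for f g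
    using Metric_space.nonneg[OF Metric_space_skorokhod[OF c]] .
  ultimately have "skorokhod_dist c (\<lambda>t\<in>{0..c}. F t)
           (step_path c (real (Suc k) / c) (\<lambda>j. F (min c (real j * c / real (Suc k))))) = 0" for k
    by (rule antisym)
  then show ?thesis by simp
next
  case False
  then have c0: "0 < c" using c by simp
  \<comment> \<open>The end points are added so that the time change fixes them; both already lie on
    the grid. Points of \<open>S\<close> outside \<open>{0..c}\<close> are never crossed.\<close>
  define T where "T = (S \<inter> {0..c}) \<union> {0, c}"
  have fin: "finite T" using f by (auto simp: steps_at_def T_def)
  have feq: "f t = f u" if "t \<in> {0..c}" "u \<in> {0..c}" "\<And>s. s \<in> T \<Longrightarrow> s \<le> t \<longleftrightarrow> s \<le> u" for t u
  proof -
    have "s \<le> t \<longleftrightarrow> s \<le> u" if "s \<in> S" for s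
      using that \<open>t \<in> {0..c}\<close> \<open>u \<in> {0..c}\<close> \<open>\<And>s. s \<in> T \<Longrightarrow> s \<le> t \<longleftrightarrow> s \<le> u\<close>[of s]
      by (cases "s \<in> {0..c}") (auto simp: T_def)
    then have "{s\<in>S. s \<le> t} = {s\<in>S. s \<le> u}" by auto
    then show ?thesis using f that(1,2) unfolding steps_at_def by blast
  qed
  obtain \<delta> where \<delta>: "0 < \<delta>" "\<And>s t. s \<in> T \<Longrightarrow> t \<in> T \<Longrightarrow> s \<noteq> t \<Longrightarrow> \<delta> \<le> \<bar>s - t\<bar>"
    using finite_separated[OF fin] by auto
  define m where "m = real (card T)"
  have m: "0 \<le> m" by (simp add: m_def)
  show ?thesis
  proof (rule LIMSEQ_I)
    fix r :: real assume r: "0 < r"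
    have uc: "uniformly_continuous_on {0..c} g"
      by (rule compact_uniformly_continuous[OF g compact_Icc])
    obtain \<rho> where \<rho>: "\<rho> > 0"
      "\<And>x y. x \<in> {0..c} \<Longrightarrow> y \<in> {0..c} \<Longrightarrow> dist y x < \<rho> \<Longrightarrow> dist (g y) (g x) < r/2"
      using uc[unfolded uniformly_continuous_on_def, rule_format, OF half_gt_zero[OF r]] by auto
    \<comment> \<open>In this order: \<open>m / a < \<delta> / 2\<close> makes the time change
      increasing, \<open>(m + 1) / a < \<rho> / 2\<close> keeps its displacement plus one grid cell
      within the modulus of continuity of \<open>g\<close>, and \<open>m / a < r / 2\<close> bounds
      the displacement itself.\<close>
    define B where "B = max (max (2 * m * c / \<delta>) (2 * (m + 1) * c / \<rho>)) (2 * m * c / r)"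
    obtain k0 where k0: "B \<le> real k0" using real_arch_simple by blast
    show "\<exists>k0. \<forall>k\<ge>k0. norm (skorokhod_dist c (\<lambda>t\<in>{0..c}. F t)
           (step_path c (real (Suc k) / c) (\<lambda>j. F (min c (real j * c / real (Suc k))))) - 0) < r"
    proof (intro exI[of _ k0] allI impI)
      fix k assume "k0 \<le> k"
      then have kB: "B < real (Suc k)" using k0 by simp
      define a where "a = real (Suc k) / c"
      have a0: "0 < a" using c0 by (simp add: a_def)
      have ac: "a * c = real (Suc k)" using c0 by (simp add: a_def)
      have small: "x / a < y / 2" if "2 * x * c / y \<le> B" "0 < y" for x y
      proof -
        have "2 * x * c / y < real (Suc k)" using that kB by linarith
        then have "2 * x * c < real (Suc k) * y" using that(2) by (simp add: pos_divide_less_eq)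
        then have "2 * x < a * y" using c0 by (simp add: a_def pos_less_divide_eq)
        then show ?thesis using a0 by (simp add: pos_divide_less_eq mult.commute)
      qed
      have K: "m / a < \<delta> / 2" "(m + 1) / a < \<rho> / 2" "m / a < r / 2"
        by (rule small; use \<delta>(1) \<rho>(1) r in \<open>simp add: B_def\<close>)+
      define cl where "cl s = real_of_int \<lceil>a * s\<rceil> / a" for s
      have cl: "s \<le> cl s" "cl s < s + 1 / a" for s
      proof -
        have "real_of_int \<lceil>a * s\<rceil> < a * s + 1" by linarith
        then show "s \<le> cl s" "cl s < s + 1 / a"
          using a0 by (simp_all add: cl_def field_simps)
      qed
      have cl0: "cl 0 = 0" by (simp add: cl_def)
      have clc: "cl c = c"
      proof -
        have "\<lceil>a * c\<rceil> = int (Suc k)" unfolding ac by (rule ceiling_of_nat)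
        then show ?thesis using c0 by (simp add: cl_def a_def)
      qed
      define tent :: "real \<Rightarrow> real" where "tent x = max 0 (1 - \<bar>x\<bar>)" for x
      have tent_lip: "\<bar>tent x - tent y\<bar> \<le> \<bar>x - y\<bar>" for x y unfolding tent_def by linarith
      have tent_le: "0 \<le> tent x" "tent x \<le> 1" for x unfolding tent_def by auto
      \<comment> \<open>The displacement \<open>cl s - s\<close> is applied around \<open>s\<close>
        with a triangular weight of half-width \<open>\<delta>\<close>. By the separation of
        \<open>T\<close> this weight vanishes at all other points of \<open>T\<close>, so that
        \<open>h s = cl s\<close> holds exactly.\<close>
      define p where "p t = (\<Sum>s\<in>T. (cl s - s) * tent ((t - s) / \<delta>))" for t
      define h where "h t = t + p t" for t
      have p_bound: "\<bar>p t\<bar> \<le> m / a" for t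
      proof -
        have "\<bar>p t\<bar> \<le> (\<Sum>s\<in>T. \<bar>(cl s - s) * tent ((t - s) / \<delta>)\<bar>)"
          unfolding p_def by (rule sum_abs)
        also have "\<dots> \<le> (\<Sum>s\<in>T. 1 / a * 1)"
          unfolding abs_mult using cl tent_le a0
          by (intro sum_mono mult_mono) (auto simp: abs_le_iff algebra_simps order.strict_implies_order)
        finally show ?thesis by (simp add: m_def)
      qed
      \<comment> \<open>A perturbation of slope at most 1/2 leaves \<open>h t = t + p t\<close>
        strictly increasing.\<close>
      have p_lip: "\<bar>p t - p u\<bar> \<le> \<bar>t - u\<bar> / 2" for t u
      proof -
        have "p t - p u = (\<Sum>s\<in>T. (cl s - s) * (tent ((t - s) / \<delta>) - tent ((u - s) / \<delta>)))"
          unfolding p_def by (simp add: sum_subtractf right_diff_distrib)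
        then have "\<bar>p t - p u\<bar> \<le> (\<Sum>s\<in>T. \<bar>(cl s - s) * (tent ((t - s) / \<delta>) - tent ((u - s) / \<delta>))\<bar>)"
          by (simp only: sum_abs)
        also have "\<dots> \<le> (\<Sum>s\<in>T. 1 / a * (\<bar>t - u\<bar> / \<delta>))"
          unfolding abs_mult
        proof (intro sum_mono mult_mono)
          fix s
          show "\<bar>cl s - s\<bar> \<le> 1 / a" using cl[of s] by linarith
          have "\<bar>tent ((t - s) / \<delta>) - tent ((u - s) / \<delta>)\<bar> \<le> \<bar>(t - s) / \<delta> - (u - s) / \<delta>\<bar>"
            by (rule tent_lip)
          also have "\<bar>(t - s) / \<delta> - (u - s) / \<delta>\<bar> = \<bar>t - u\<bar> / \<delta>"
            using \<delta>(1) by (simp add: diff_divide_distrib[symmetric])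
          finally show "\<bar>tent ((t - s) / \<delta>) - tent ((u - s) / \<delta>)\<bar> \<le> \<bar>t - u\<bar> / \<delta>" .
        qed (use a0 in auto)
        also have "\<dots> = (m / a / \<delta>) * \<bar>t - u\<bar>" by (simp add: m_def)
        also have "\<dots> \<le> (1 / 2) * \<bar>t - u\<bar>"
          using K(1) \<delta>(1) a0 by (intro mult_right_mono) (auto simp: field_simps)
        finally show ?thesis by simp
      qed
      have h_mono: "h t < h u" if "t < u" for t u
      proof -
        have "p t - p u \<le> \<bar>t - u\<bar> / 2" using p_lip[of t u] by (rule order_trans[OF abs_ge_self])
        then show ?thesis using that unfolding h_def by simp
      qed
      have h_iff: "h t \<le> h u \<longleftrightarrow> t \<le> u" for t u
        using h_mono by (metis le_less linorder_not_less)
      have hT: "h s = cl s" if s: "s \<in> T" for s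
      proof -
        have "tent ((s - s') / \<delta>) = (if s' = s then 1 else 0)" if s': "s' \<in> T" for s'
        proof (cases "s' = s")
          case False
          then have "\<delta> \<le> \<bar>s - s'\<bar>" using \<delta>(2) s s' by auto
          then have "1 \<le> \<bar>(s - s') / \<delta>\<bar>" using \<delta>(1) by simp
          then show ?thesis using False by (simp add: tent_def)
        qed (simp add: tent_def)
        then have "p s = (\<Sum>s'\<in>T. (cl s' - s') * (if s' = s then 1 else 0))"
          unfolding p_def by (intro sum.cong) auto
        also have "\<dots> = cl s - s" using fin s by (simp add: if_distrib[of "\<lambda>x. _ * x"] cong: if_cong)
        finally show ?thesis by (simp add: h_def)
      qed
      have h0: "h 0 = 0" "h c = c" using hT[of 0] hT[of c] cl0 clc by (auto simp: T_def)
      have h_cont: "continuous_on A h" for A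
        unfolding h_def p_def tent_def using \<delta>(1) by (intro continuous_intros) auto
      have h_in: "h t \<in> {0..c}" if "t \<in> {0..c}" for t
        using that h_iff[of 0 t] h_iff[of t c] h0 by auto
      have "h \<in> time_changes c"
        unfolding time_changes_def
      proof (intro CollectI conjI h_cont)
        show "strict_mono_on {0..c} h" using h_mono by (auto simp: strict_mono_on_def)
        have "y \<in> h ` {0..c}" if "y \<in> {0..c}" for y
          using IVT'[of h 0 y c] h0 that c h_cont by force
        then show "h ` {0..c} = {0..c}" using h_in by auto
      qed
      have "skorokhod_close c (r/2) (\<lambda>t\<in>{0..c}. F t) (step_path c a (\<lambda>j. F (min c (real j * c / real (Suc k)))))"
        unfolding skorokhod_close_def
      proof (intro bexI[OF _ \<open>h \<in> time_changes c\<close>] ballI conjI)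
        fix t assume t: "t \<in> {0..c}"
        show "\<bar>h t - t\<bar> \<le> r/2" using p_bound[of t] K(3) unfolding h_def by linarith
        define j where "j = nat \<lfloor>a * h t\<rfloor>"
        define u where "u = real j / a"
        have ht: "0 \<le> a * h t" using h_in[OF t] a0 by auto
        have rj: "real j = real_of_int \<lfloor>a * h t\<rfloor>" using ht by (simp add: j_def)
        have u: "u \<le> h t" "h t < u + 1 / a"
        proof -
          have "real_of_int \<lfloor>a * h t\<rfloor> \<le> a * h t" "a * h t < real_of_int \<lfloor>a * h t\<rfloor> + 1" by linarith+
          then show "u \<le> h t" "h t < u + 1 / a"
            using a0 unfolding u_def rj by (auto simp: field_simps)
        qed
        have u_in: "u \<in> {0..c}" using u h_in[OF t] a0 by (auto simp: u_def)
        have uj: "min c (real j * c / real (Suc k)) = u"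
          using u_in c0 by (simp add: u_def a_def)
        have "f u = f t"
        proof (rule feq[OF u_in t])
          fix s assume s: "s \<in> T"
          have "s \<le> t \<longleftrightarrow> cl s \<le> h t" using h_iff[of s t] hT[OF s] by simp
          also have "\<dots> \<longleftrightarrow> real_of_int \<lceil>a * s\<rceil> \<le> a * h t" using a0 by (simp add: cl_def field_simps)
          also have "\<dots> \<longleftrightarrow> \<lceil>a * s\<rceil> \<le> \<lfloor>a * h t\<rfloor>" by (simp add: le_floor_iff)
          also have "\<dots> \<longleftrightarrow> a * s \<le> real_of_int \<lfloor>a * h t\<rfloor>" by (simp add: ceiling_le_iff)
          also have "\<dots> \<longleftrightarrow> s \<le> u" using a0 by (simp add: u_def rj field_simps)
          finally show "s \<le> u \<longleftrightarrow> s \<le> t" by simp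
        qed
        moreover have "dist (g u) (g t) < r / 2"
        proof (rule \<rho>(2)[OF t u_in])
          have "1 / a + m / a < \<rho>" using K(2) \<rho>(1) unfolding add_divide_distrib by linarith
          then show "dist u t < \<rho>"
            using u p_bound[of t] unfolding dist_real_def h_def by linarith
        qed
        moreover have "(step_path c a (\<lambda>j. F (min c (real j * c / real (Suc k))))) (h t) = F u"
          using h_in[OF t] uj by (simp add: step_path_def j_def)
        ultimately show "\<bar>(\<lambda>t\<in>{0..c}. F t) t -
            (step_path c a (\<lambda>j. F (min c (real j * c / real (Suc k))))) (h t)\<bar> \<le> r/2"
          using t F[OF t] F[OF u_in] by (simp add: dist_real_def abs_minus_commute)
      qed
      from skorokhod_dist_le[OF _ this] r
      have "skorokhod_dist c (\<lambda>t\<in>{0..c}. F t) (step_path c a (\<lambda>j. F (min c (real j * c / real (Suc k))))) < r"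
        by simp
      moreover have "0 \<le> skorokhod_dist c f g" for f g
        using Metric_space.nonneg[OF Metric_space_skorokhod[OF c]] .
      ultimately show "norm (skorokhod_dist c (\<lambda>t\<in>{0..c}. F t)
           (step_path c (real (Suc k) / c) (\<lambda>j. F (min c (real j * c / real (Suc k))))) - 0) < r"
        by (simp add: a_def)
    qed
  qed
qed

section \<open>Measurability of random paths and reduction of convergence to dyadic grids\<close>

lemma coord_lipschitz_step_path:
  assumes c: "0 \<le> c" "0 \<le> a" and L: "0 \<le> L"
    and \<phi>: "Metric_space.lipschitz_test (cadlag c) (skorokhod_dist c) C L \<phi>"
    and k: "nat \<lfloor>a * c\<rfloor> \<le> k"
  shows "coord_lipschitz k L (\<lambda>v. \<phi> (step_path c a v))"
  unfolding coord_lipschitz_def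
proof (intro allI impI)
  interpret Metric_space "cadlag c" "skorokhod_dist c" by (rule Metric_space_skorokhod[OF c(1)])
  fix v w :: "nat \<Rightarrow> real" and e assume vw: "\<forall>j\<le>k. \<bar>v j - w j\<bar> \<le> e"
  then have e: "0 \<le> e" using abs_ge_zero order_trans by blast
  have "skorokhod_dist c (step_path c a v) (step_path c a w) \<le> e"
  proof (rule skorokhod_dist_le_uniform[OF e])
    fix t assume t: "t \<in> {0..c}"
    then have "a * t \<le> a * c" using c by (intro mult_left_mono) auto
    then have "nat \<lfloor>a * t\<rfloor> \<le> k" using k by (meson floor_mono nat_mono order_trans)
    then show "\<bar>step_path c a v t - step_path c a w t\<bar> \<le> e" using vw t by (simp add: step_path_def)
  qed
  then have "L * skorokhod_dist c (step_path c a v) (step_path c a w) \<le> L * e"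
    using L by (rule mult_left_mono)
  then show "\<bar>\<phi> (step_path c a v) - \<phi> (step_path c a w)\<bar> \<le> L * e"
    using lipschitz_testD(2)[OF \<phi> cadlag_step_path[OF c(2,1)] cadlag_step_path[OF c(2,1)]]
    by (rule order_trans[rotated])
qed

text \<open>A Lipschitz functional of the path is the limit of its values at the step paths sampled
  on finer and finer grids, and each of those is a function of finitely many coordinates. The jump
  times depend on \<open>\<omega>\<close>, but only pointwise convergence is asked for.\<close>

lemma measurable_skorokhod:
  assumes c: "0 \<le> c"
    and meas: "\<And>t. t \<in> {0..c} \<Longrightarrow> X t \<in> borel_measurable N"
    and path: "\<And>\<omega>. \<omega> \<in> space N \<Longrightarrow> \<exists>S f g. steps_at c S f \<and> continuous_on {0..c} g \<and>
        (\<forall>t\<in>{0..c}. X t \<omega> = f t + g t)"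
  shows "(\<lambda>\<omega>. \<lambda>t\<in>{0..c}. X t \<omega>) \<in> N \<rightarrow>\<^sub>M borel_sigma (skorokhod_topology c)"
proof -
  interpret Metric_space "cadlag c" "skorokhod_dist c" by (rule Metric_space_skorokhod[OF c])
  have X: "(\<lambda>t\<in>{0..c}. X t \<omega>) \<in> cadlag c" if \<omega>: "\<omega> \<in> space N" for \<omega>
  proof -
    obtain S f g where "steps_at c S f" "continuous_on {0..c} g" "\<forall>t\<in>{0..c}. X t \<omega> = f t + g t"
      using path[OF \<omega>] by blast
    moreover from this(3) have "(\<lambda>t\<in>{0..c}. X t \<omega>) = (\<lambda>t\<in>{0..c}. f t + g t)" by auto
    ultimately show ?thesis using cadlag_steps_plus_continuous by simp
  qed
  show ?thesis unfolding skorokhod_topology_def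
  proof (rule measurable_borel_sigma_lipschitz)
    fix C L \<phi> assume L: "0 \<le> L" and \<phi>: "lipschitz_test C L \<phi>"
    define V where "V k \<omega> = step_path c (real (Suc k) / c) (\<lambda>j. X (min c (real j * c / real (Suc k))) \<omega>)"
      for k \<omega>
    have ac: "0 \<le> real (Suc k) / c" for k using c by simp
    have V: "V k \<omega> \<in> cadlag c" for k \<omega>
      unfolding V_def by (rule cadlag_step_path[OF ac c])
    show "(\<lambda>\<omega>. \<phi> (\<lambda>t\<in>{0..c}. X t \<omega>)) \<in> borel_measurable N"
    proof (rule borel_measurable_LIMSEQ_real)
      show "(\<lambda>\<omega>. \<phi> (V k \<omega>)) \<in> borel_measurable N" for k
        unfolding V_def
        by (rule measurable_coord_lipschitz[OF coord_lipschitz_step_path[OF c ac L \<phi> order_refl] L])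
          (use c in \<open>auto intro!: meas\<close>)
      fix \<omega> assume \<omega>: "\<omega> \<in> space N"
      obtain S f g where fg: "steps_at c S f" "continuous_on {0..c} g"
        "\<And>t. t \<in> {0..c} \<Longrightarrow> X t \<omega> = f t + g t"
        using path[OF \<omega>] by blast
      have "(\<lambda>k. L * skorokhod_dist c (\<lambda>t\<in>{0..c}. X t \<omega>) (V k \<omega>)) \<longlonglongrightarrow> L * 0"
        unfolding V_def
        by (intro tendsto_intros skorokhod_dist_step_path_tendsto[OF c fg])
      then have lim: "(\<lambda>k. L * skorokhod_dist c (\<lambda>t\<in>{0..c}. X t \<omega>) (V k \<omega>)) \<longlonglongrightarrow> 0" by simp
      have "(\<lambda>k. \<phi> (V k \<omega>) - \<phi> (\<lambda>t\<in>{0..c}. X t \<omega>)) \<longlonglongrightarrow> 0"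
      proof (rule Lim_null_comparison[OF always_eventually lim], rule allI)
        fix k
        have "\<bar>\<phi> (\<lambda>t\<in>{0..c}. X t \<omega>) - \<phi> (V k \<omega>)\<bar> \<le> L * skorokhod_dist c (\<lambda>t\<in>{0..c}. X t \<omega>) (V k \<omega>)"
          by (rule lipschitz_testD(2)[OF \<phi> X[OF \<omega>] V])
        then show "norm (\<phi> (V k \<omega>) - \<phi> (\<lambda>t\<in>{0..c}. X t \<omega>)) \<le>
            L * skorokhod_dist c (\<lambda>t\<in>{0..c}. X t \<omega>) (V k \<omega>)"
          by (simp only: real_norm_def abs_minus_commute)
      qed
      then show "(\<lambda>k. \<phi> (V k \<omega>)) \<longlonglongrightarrow> \<phi> (\<lambda>t\<in>{0..c}. X t \<omega>)"
        by (simp add: LIM_zero_iff)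
    qed
  qed (use X in auto)
qed

text \<open>A three-term comparison: \<open>X n\<close> against the step path through
  \<open>U n q\<close> (assumption \<open>close\<close>), that step path against the sampled limit
  (assumption \<open>grid\<close>), and the sampled limit against \<open>Y\<close> (uniform
  continuity of the paths). The minimum with 1 keeps the sampling times in \<open>{0..1}\<close>,
  where \<open>Y\<close> is controlled.\<close>

theorem skorokhod_convergence_from_grid:
  assumes c: "0 \<le> c" "c \<le> 1"
    and M: "\<And>n. 1 \<le> n \<Longrightarrow> prob_space (M n)"
    and X: "\<And>n. 1 \<le> n \<Longrightarrow> (\<lambda>\<omega>. \<lambda>t\<in>{0..c}. X n t \<omega>) \<in> M n \<rightarrow>\<^sub>M borel_sigma (skorokhod_topology c)"
    and N: "prob_space N"
    and Y: "\<And>t. t \<in> {0..1} \<Longrightarrow> Y t \<in> borel_measurable N"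
    and Yc: "\<And>\<omega>. \<omega> \<in> space N \<Longrightarrow> continuous_on {0..1} (\<lambda>t. Y t \<omega>)"
    and U: "\<And>n q j. 1 \<le> n \<Longrightarrow> U n q j \<in> borel_measurable (M n)"
    and grid: "\<And>q C L g. (\<And>v. \<bar>g v\<bar> \<le> C) \<Longrightarrow> 0 \<le> L \<Longrightarrow> coord_lipschitz (2 ^ q) L g \<Longrightarrow>
        (\<lambda>n. \<integral>\<omega>. g (\<lambda>j. U n q j \<omega>) \<partial>M n) \<longlonglongrightarrow> (\<integral>\<omega>. g (\<lambda>j. Y (min 1 (real j / 2 ^ q)) \<omega>) \<partial>N)"
    and close: "\<And>e. 0 < e \<Longrightarrow> \<exists>q0. \<forall>q\<ge>q0. \<exists>n0. \<forall>n\<ge>n0. \<exists>A\<in>sets (M n). 1 - e \<le> measure (M n) A \<and>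
        (\<forall>\<omega>\<in>A. \<forall>t\<in>{0..c}. \<bar>X n t \<omega> - U n q (nat \<lfloor>2 ^ q * t\<rfloor>) \<omega>\<bar> \<le> e)"
  shows "converges_in_distribution (skorokhod_topology c)
     M (\<lambda>n \<omega>. \<lambda>t\<in>{0..c}. X n t \<omega>) N (\<lambda>\<omega>. \<lambda>t\<in>{0..c}. Y t \<omega>)"
proof -
  interpret D: Metric_space "cadlag c" "skorokhod_dist c" by (rule Metric_space_skorokhod[OF c(1)])
  interpret N: prob_space N by (rule N)
  have Yc': "continuous_on {0..c} (\<lambda>t. Y t \<omega>)" if "\<omega> \<in> space N" for \<omega>
    by (rule continuous_on_subset[OF Yc[OF that]]) (use c in auto)
  have Y_meas: "(\<lambda>\<omega>. \<lambda>t\<in>{0..c}. Y t \<omega>) \<in> N \<rightarrow>\<^sub>M borel_sigma (skorokhod_topology c)"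
  proof (rule measurable_skorokhod[OF c(1)])
    show "Y t \<in> borel_measurable N" if "t \<in> {0..c}" for t using that c by (intro Y) auto
    fix \<omega> assume "\<omega> \<in> space N"
    then have "steps_at c {} (\<lambda>_. 0) \<and> continuous_on {0..c} (\<lambda>t. Y t \<omega>) \<and> (\<forall>t\<in>{0..c}. Y t \<omega> = 0 + Y t \<omega>)"
      using Yc' by (simp add: steps_at_def)
    then show "\<exists>S f g. steps_at c S f \<and> continuous_on {0..c} g \<and> (\<forall>t\<in>{0..c}. Y t \<omega> = f t + g t)"
      by blast
  qed
  have top: "skorokhod_topology c = D.mtopology" by (simp add: skorokhod_topology_def)
  have Y_in: "(\<lambda>t\<in>{0..c}. Y t \<omega>) \<in> cadlag c" if "\<omega> \<in> space N" for \<omega>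
    using measurable_space[OF Y_meas that] by (simp add: space_borel_sigma top)
  have X_in: "(\<lambda>t\<in>{0..c}. X n t \<omega>) \<in> cadlag c" if "\<omega> \<in> space (M n)" "1 \<le> n" for \<omega> n
    using measurable_space[OF X[OF that(2)] that(1)] by (simp add: space_borel_sigma top)
  have step_in: "step_path c (2 ^ q) v \<in> cadlag c" for q v
    by (rule cadlag_step_path) (use c in auto)
  define Yq where "Yq q \<omega> = step_path c (2 ^ q) (\<lambda>j. Y (min 1 (real j / 2 ^ q)) \<omega>)" for q \<omega>
  have Yq_in: "Yq q \<omega> \<in> cadlag c" for q \<omega> unfolding Yq_def by (rule step_in)
  have Yq_lim: "(\<lambda>q. skorokhod_dist c (Yq q \<omega>) (\<lambda>t\<in>{0..c}. Y t \<omega>)) \<longlonglongrightarrow> 0" if \<omega>: "\<omega> \<in> space N" for \<omega>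
  proof (rule LIMSEQ_I)
    fix r :: real assume r: "0 < r"
    have "uniformly_continuous_on {0..1} (\<lambda>t. Y t \<omega>)"
      by (rule compact_uniformly_continuous[OF Yc[OF \<omega>] compact_Icc])
    from this[unfolded uniformly_continuous_on_def, rule_format, OF half_gt_zero[OF r]]
    obtain \<rho> where \<rho>: "\<rho> > 0"
      "\<And>x y. x \<in> {0..1} \<Longrightarrow> y \<in> {0..1} \<Longrightarrow> dist y x < \<rho> \<Longrightarrow> dist (Y y \<omega>) (Y x \<omega>) < r/2" by auto
    have "eventually (\<lambda>q. (1/2::real) ^ q < \<rho>) sequentially"
      by (rule order_tendstoD(2)[OF LIMSEQ_realpow_zero]) (use \<rho>(1) in auto)
    then obtain q0 where q0: "\<And>q. q \<ge> q0 \<Longrightarrow> (1/2::real) ^ q < \<rho>" by (auto simp: eventually_sequentially)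
    have "norm (skorokhod_dist c (Yq q \<omega>) (\<lambda>t\<in>{0..c}. Y t \<omega>) - 0) < r" if q: "q \<ge> q0" for q
    proof -
      have "skorokhod_dist c (Yq q \<omega>) (\<lambda>t\<in>{0..c}. Y t \<omega>) \<le> r/2"
      proof (rule skorokhod_dist_le_uniform)
        fix t assume t: "t \<in> {0..c}"
        define j where "j = nat \<lfloor>2 ^ q * t\<rfloor>"
        have rj: "real j = real_of_int \<lfloor>2 ^ q * t\<rfloor>" using t by (simp add: j_def)
        have "real_of_int \<lfloor>2 ^ q * t\<rfloor> \<le> 2 ^ q * t" "2 ^ q * t < real_of_int \<lfloor>2 ^ q * t\<rfloor> + 1" by linarith+
        then have j: "real j / 2 ^ q \<le> t" "t < real j / 2 ^ q + (1/2) ^ q"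
          unfolding rj by (auto simp: field_simps power_divide)
        then have "dist (real j / 2 ^ q) t < \<rho>" using q0[OF q] by (simp add: dist_real_def)
        moreover have j1: "real j / 2 ^ q \<le> 1" using j(1) t c unfolding atLeastAtMost_iff by linarith
        moreover have "t \<in> {0..1}" using t c by simp
        ultimately have "dist (Y (real j / 2 ^ q) \<omega>) (Y t \<omega>) < r/2"
          by (intro \<rho>(2)) auto
        moreover have "min 1 (real j / 2 ^ q) = real j / 2 ^ q" using j1 by (rule min.absorb2)
        ultimately show "\<bar>Yq q \<omega> t - (\<lambda>t\<in>{0..c}. Y t \<omega>) t\<bar> \<le> r/2"
          using t by (simp add: Yq_def step_path_def j_def dist_real_def)
      qed (use r in simp)
      then show ?thesis using r D.nonneg[of "Yq q \<omega>" "\<lambda>t\<in>{0..c}. Y t \<omega>"] by simp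
    qed
    then show "\<exists>q0. \<forall>q\<ge>q0. norm (skorokhod_dist c (Yq q \<omega>) (\<lambda>t\<in>{0..c}. Y t \<omega>) - 0) < r" by blast
  qed
  have lip: "(\<lambda>n. \<integral>\<omega>. \<phi> (\<lambda>t\<in>{0..c}. X n t \<omega>) \<partial>M n) \<longlonglongrightarrow> (\<integral>\<omega>. \<phi> (\<lambda>t\<in>{0..c}. Y t \<omega>) \<partial>N)"
    if L: "0 \<le> L" and \<phi>: "D.lipschitz_test C L \<phi>" for C L \<phi>
  proof -
    have cont: "continuous_map D.mtopology euclideanreal \<phi>"
      by (rule D.continuous_map_lipschitz_test[OF L \<phi>])
    have C0: "0 \<le> C" using D.lipschitz_testD(1)[OF \<phi> step_in] abs_ge_zero order_trans by blast
    define g where "g q v = \<phi> (step_path c (2 ^ q) v)" for q v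
    have nf: "nat \<lfloor>2 ^ q * c\<rfloor> \<le> 2 ^ q" for q
    proof -
      have "2 ^ q * c \<le> real (2 ^ q)" using c by simp
      then have "\<lfloor>2 ^ q * c\<rfloor> \<le> int (2 ^ q)" by linarith
      then show ?thesis by (simp add: nat_le_iff)
    qed
    have g_lip: "coord_lipschitz (2 ^ q) L (g q)" for q
      unfolding g_def by (rule coord_lipschitz_step_path[OF c(1) _ L \<phi> nf]) simp
    have g_bound: "\<bar>g q v\<bar> \<le> C" for q v
      unfolding g_def by (rule D.lipschitz_testD(1)[OF \<phi> step_in])
    have Yq_meas: "(\<lambda>\<omega>. \<phi> (Yq q \<omega>)) \<in> borel_measurable N" for q
      using measurable_coord_lipschitz[OF g_lip L, where V="\<lambda>j. Y (min 1 (real j / 2 ^ q))" and N=N] Y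
      by (simp add: g_def Yq_def)
    have limq: "(\<lambda>q. \<integral>\<omega>. \<phi> (Yq q \<omega>) \<partial>N) \<longlonglongrightarrow> (\<integral>\<omega>. \<phi> (\<lambda>t\<in>{0..c}. Y t \<omega>) \<partial>N)"
    proof (rule integral_dominated_convergence[where w="\<lambda>_. C"])
      show "(\<lambda>\<omega>. \<phi> (\<lambda>t\<in>{0..c}. Y t \<omega>)) \<in> borel_measurable N"
        by (rule D.measurable_continuous_map[OF Y_meas[unfolded top] cont])
      have "(\<lambda>q. \<phi> (Yq q \<omega>)) \<longlonglongrightarrow> \<phi> (\<lambda>t\<in>{0..c}. Y t \<omega>)" if \<omega>: "\<omega> \<in> space N" for \<omega>
      proof -
        have "(\<lambda>q. L * skorokhod_dist c (Yq q \<omega>) (\<lambda>t\<in>{0..c}. Y t \<omega>)) \<longlonglongrightarrow> L * 0"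
          by (intro tendsto_intros Yq_lim[OF \<omega>])
        then have lim: "(\<lambda>q. L * skorokhod_dist c (Yq q \<omega>) (\<lambda>t\<in>{0..c}. Y t \<omega>)) \<longlonglongrightarrow> 0" by simp
        have "(\<lambda>q. \<phi> (Yq q \<omega>) - \<phi> (\<lambda>t\<in>{0..c}. Y t \<omega>)) \<longlonglongrightarrow> 0"
        proof (rule Lim_null_comparison[OF always_eventually lim], rule allI)
          fix q
          show "norm (\<phi> (Yq q \<omega>) - \<phi> (\<lambda>t\<in>{0..c}. Y t \<omega>)) \<le>
              L * skorokhod_dist c (Yq q \<omega>) (\<lambda>t\<in>{0..c}. Y t \<omega>)"
            unfolding real_norm_def
            by (rule D.lipschitz_testD(2)[OF \<phi> Yq_in Y_in[OF \<omega>]])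
        qed
        then show ?thesis by (simp add: LIM_zero_iff)
      qed
      then show "AE \<omega> in N. (\<lambda>q. \<phi> (Yq q \<omega>)) \<longlonglongrightarrow> \<phi> (\<lambda>t\<in>{0..c}. Y t \<omega>)" by auto
      show "AE \<omega> in N. norm (\<phi> (Yq q \<omega>)) \<le> C" for q
        using g_bound by (auto simp: g_def Yq_def)
    qed (use Yq_meas in auto)
    show ?thesis
    proof (rule LIMSEQ_I)
      fix r :: real assume r: "0 < r"
      \<comment> \<open>Chosen so that the error \<open>L * e\<close> on the good event and the
        error \<open>2 * C * e\<close> from its complement together stay below
        \<open>r / 4\<close>.\<close>
      define e where "e = r / (4 * (L + 2 * C + 1))"
      have e: "0 < e" "L * e + 2 * C * e \<le> r / 4"
      proof -
        have p: "0 < L + 2 * C + 1" using L C0 by simp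
        then show "0 < e" using r by (simp add: e_def)
        then have "L * e + 2 * C * e \<le> (L + 2 * C + 1) * e" by (simp add: algebra_simps)
        also have "\<dots> = r / 4" using p unfolding e_def by (metis less_irrefl mult.commute nonzero_mult_divide_mult_cancel_left times_divide_eq_right)
        finally show "L * e + 2 * C * e \<le> r / 4" .
      qed
      obtain q0 where q0: "\<And>q. q \<ge> q0 \<Longrightarrow> \<exists>n0. \<forall>n\<ge>n0. \<exists>A\<in>sets (M n). 1 - e \<le> measure (M n) A \<and>
        (\<forall>\<omega>\<in>A. \<forall>t\<in>{0..c}. \<bar>X n t \<omega> - U n q (nat \<lfloor>2 ^ q * t\<rfloor>) \<omega>\<bar> \<le> e)"
        using close[OF e(1)] by blast
      have "0 < r / 4" using r by simp
      from LIMSEQ_D[OF limq this]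
      obtain q1 where q1: "\<And>q. q \<ge> q1 \<Longrightarrow> \<bar>(\<integral>\<omega>. \<phi> (Yq q \<omega>) \<partial>N) - (\<integral>\<omega>. \<phi> (\<lambda>t\<in>{0..c}. Y t \<omega>) \<partial>N)\<bar> < r / 4"
        by auto
      \<comment> \<open>The level \<open>q\<close> is fixed before \<open>n\<close> grows: it makes
        both discretisation errors small, and only then is the convergence on the grid of level
        \<open>q\<close> used.\<close>
      define q where "q = max q0 q1"
      have "q \<ge> q0" by (simp add: q_def)
      from q0[OF this] obtain n0 where n0: "\<And>n. n \<ge> n0 \<Longrightarrow> \<exists>A\<in>sets (M n). 1 - e \<le> measure (M n) A \<and>
        (\<forall>\<omega>\<in>A. \<forall>t\<in>{0..c}. \<bar>X n t \<omega> - U n q (nat \<lfloor>2 ^ q * t\<rfloor>) \<omega>\<bar> \<le> e)" by blast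
      have "(\<lambda>n. \<integral>\<omega>. g q (\<lambda>j. U n q j \<omega>) \<partial>M n) \<longlonglongrightarrow> (\<integral>\<omega>. g q (\<lambda>j. Y (min 1 (real j / 2 ^ q)) \<omega>) \<partial>N)"
        by (rule grid[OF g_bound L g_lip])
      from LIMSEQ_D[OF this \<open>0 < r / 4\<close>] obtain n1 where n1: "\<And>n. n \<ge> n1 \<Longrightarrow>
          \<bar>(\<integral>\<omega>. g q (\<lambda>j. U n q j \<omega>) \<partial>M n) - (\<integral>\<omega>. \<phi> (Yq q \<omega>) \<partial>N)\<bar> < r / 4"
        by (auto simp: g_def Yq_def)
      show "\<exists>no. \<forall>n\<ge>no. norm ((\<integral>\<omega>. \<phi> (\<lambda>t\<in>{0..c}. X n t \<omega>) \<partial>M n) - (\<integral>\<omega>. \<phi> (\<lambda>t\<in>{0..c}. Y t \<omega>) \<partial>N)) < r"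
      proof (intro exI[of _ "max 1 (max n0 n1)"] allI impI)
        fix n assume "max 1 (max n0 n1) \<le> n"
        then have n: "1 \<le> n" "n0 \<le> n" "n1 \<le> n" by auto
        interpret Mn: prob_space "M n" by (rule M[OF n(1)])
        obtain A where A: "A \<in> sets (M n)" "1 - e \<le> measure (M n) A"
          "\<And>\<omega> t. \<omega> \<in> A \<Longrightarrow> t \<in> {0..c} \<Longrightarrow> \<bar>X n t \<omega> - U n q (nat \<lfloor>2 ^ q * t\<rfloor>) \<omega>\<bar> \<le> e"
          using n0[OF n(2)] by blast
        let ?f1 = "\<lambda>\<omega>. \<phi> (\<lambda>t\<in>{0..c}. X n t \<omega>)" and ?f2 = "\<lambda>\<omega>. g q (\<lambda>j. U n q j \<omega>)"
        have m1: "?f1 \<in> borel_measurable (M n)"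
          by (rule D.measurable_continuous_map[OF X[OF n(1), unfolded top] cont])
        have m2: "?f2 \<in> borel_measurable (M n)"
          by (rule measurable_coord_lipschitz[OF g_lip L U[OF n(1)]])
        have b1: "\<bar>?f1 \<omega>\<bar> \<le> C" if "\<omega> \<in> space (M n)" for \<omega>
          by (rule D.lipschitz_testD(1)[OF \<phi> X_in[OF that n(1)]])
        have i1: "integrable (M n) ?f1"
          by (rule Mn.integrable_const_bound[where B=C]) (use m1 b1 in auto)
        have i2: "integrable (M n) ?f2"
          by (rule Mn.integrable_const_bound[where B=C]) (use m2 g_bound in auto)
        have pt: "\<bar>?f1 \<omega> - ?f2 \<omega>\<bar> \<le> L * e + 2 * C * indicator (space (M n) - A) \<omega>" if \<omega>: "\<omega> \<in> space (M n)" for \<omega>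
        proof (cases "\<omega> \<in> A")
          case True
          have "skorokhod_dist c (\<lambda>t\<in>{0..c}. X n t \<omega>) (step_path c (2 ^ q) (\<lambda>j. U n q j \<omega>)) \<le> e"
            by (rule skorokhod_dist_le_uniform) (use e A(3)[OF True] in \<open>auto simp: step_path_def\<close>)
          then have "L * skorokhod_dist c (\<lambda>t\<in>{0..c}. X n t \<omega>) (step_path c (2 ^ q) (\<lambda>j. U n q j \<omega>)) \<le> L * e"
            using L by (rule mult_left_mono)
          with D.lipschitz_testD(2)[OF \<phi> X_in[OF \<omega> n(1)] step_in]
          have "\<bar>?f1 \<omega> - ?f2 \<omega>\<bar> \<le> L * e" unfolding g_def by (rule order_trans)
          then show ?thesis using True by simp
        next
          case False
          then show ?thesis
            using b1[OF \<omega>] g_bound[of q "\<lambda>j. U n q j \<omega>"] \<omega> mult_nonneg_nonneg[OF L less_imp_le[OF e(1)]]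
            by simp
        qed
        have ind: "integrable (M n) (\<lambda>\<omega>. L * e + 2 * C * indicator (space (M n) - A) \<omega>)"
          by (rule Mn.integrable_const_bound[where B="L * e + 2 * C"])
            (use A(1) L e C0 in \<open>auto simp: indicator_def\<close>)
        have "\<bar>(\<integral>\<omega>. ?f1 \<omega> \<partial>M n) - (\<integral>\<omega>. ?f2 \<omega> \<partial>M n)\<bar> = \<bar>\<integral>\<omega>. ?f1 \<omega> - ?f2 \<omega> \<partial>M n\<bar>"
          using i1 i2 by simp
        also have "\<dots> \<le> (\<integral>\<omega>. \<bar>?f1 \<omega> - ?f2 \<omega>\<bar> \<partial>M n)" by (rule integral_abs_bound)
        also have "\<dots> \<le> (\<integral>\<omega>. L * e + 2 * C * indicator (space (M n) - A) \<omega> \<partial>M n)"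
          by (rule integral_mono[OF _ ind pt]) (use i1 i2 in auto)
        also have "\<dots> = L * e + 2 * C * measure (M n) (space (M n) - A)"
          using A(1) by (subst Bochner_Integration.integral_add) (auto simp: Mn.prob_space Mn.emeasure_eq_measure)
        also have "\<dots> \<le> L * e + 2 * C * e"
          using A C0 by (intro add_left_mono mult_left_mono) (auto simp: Mn.prob_compl)
        also have "\<dots> \<le> r / 4" by (rule e(2))
        finally have "\<bar>(\<integral>\<omega>. ?f1 \<omega> \<partial>M n) - (\<integral>\<omega>. ?f2 \<omega> \<partial>M n)\<bar> \<le> r / 4" .
        then show "norm ((\<integral>\<omega>. \<phi> (\<lambda>t\<in>{0..c}. X n t \<omega>) \<partial>M n) - (\<integral>\<omega>. \<phi> (\<lambda>t\<in>{0..c}. Y t \<omega>) \<partial>N)) < r"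
          using n1[OF n(3)] q1[of q] r unfolding q_def real_norm_def by linarith
      qed
    qed
  qed
  show ?thesis
    unfolding converges_in_distribution_def
  proof (intro conjI allI impI)
    fix \<phi> :: "(real \<Rightarrow> real) \<Rightarrow> real"
    assume "continuous_map (skorokhod_topology c) euclideanreal \<phi> \<and> bounded (\<phi> ` topspace (skorokhod_topology c))"
    then have \<phi>: "continuous_map D.mtopology euclideanreal \<phi>" "bounded (\<phi> ` cadlag c)" by (auto simp: top)
    show "(\<lambda>n. \<integral>\<omega>. \<phi> (\<lambda>t\<in>{0..c}. X n t \<omega>) \<partial>M n) \<longlonglongrightarrow> (\<integral>\<omega>. \<phi> (\<lambda>t\<in>{0..c}. Y t \<omega>) \<partial>N)"
      by (rule D.tendsto_expectation_of_lipschitz[where \<phi>=\<phi>, OF M X[unfolded top] N Y_meas[unfolded top] lip])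
        (assumption | rule \<phi>)+
  qed (use M X N Y_meas in auto)
qed

section \<open>Weak convergence of random vectors from characteristic functions\<close>

lemma char_minus_cnj: "char \<mu> (- t) = cnj (char \<mu> t)"
proof -
  have "cnj (char \<mu> t) = (\<integral>x. cnj (iexp (t * x)) \<partial>\<mu>)"
    unfolding char_def by (rule Bochner_Integration.integral_cnj[symmetric])
  then show ?thesis by (simp add: char_def exp_cnj)
qed

text \<open>
  Levy's continuity theorem is applied to the laws of \<open>X n\<close> under the probability measures with
  density proportional to \<open>W n + C + 1\<close>.
\<close>

lemma weighted_levy_continuity:
  fixes W X :: "nat \<Rightarrow> 'w \<Rightarrow> real"
  assumes M: "\<And>n. prob_space (M n)"
    and X: "\<And>n. X n \<in> borel_measurable (M n)" and W: "\<And>n. W n \<in> borel_measurable (M n)"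
    and WC: "\<And>n \<omega>. \<omega> \<in> space (M n) \<Longrightarrow> \<bar>W n \<omega>\<bar> \<le> C" and \<mu>: "real_distribution \<mu>"
    and ch: "\<And>u. (\<lambda>n. \<integral>\<omega>. iexp (u * X n \<omega>) \<partial>M n) \<longlonglongrightarrow> char \<mu> u"
    and wch: "\<And>u. (\<lambda>n. \<integral>\<omega>. W n \<omega> *\<^sub>R iexp (u * X n \<omega>) \<partial>M n) \<longlonglongrightarrow> w *\<^sub>R char \<mu> u"
    and \<psi>: "\<And>x. isCont \<psi> x" "\<And>x. \<bar>\<psi> x\<bar> \<le> B"
  shows "(\<lambda>n. \<integral>\<omega>. W n \<omega> * \<psi> (X n \<omega>) \<partial>M n) \<longlonglongrightarrow> w * (\<integral>x. \<psi> x \<partial>\<mu>)"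
proof -
  interpret \<mu>: real_distribution \<mu> by (rule \<mu>)
  have \<psi>m[measurable]: "\<psi> \<in> borel_measurable borel"
    using \<psi>(1) by (intro borel_measurable_continuous_onI continuous_at_imp_continuous_on) auto
  note X[measurable] W[measurable]
  have C0: "0 \<le> C" using WC prob_space.not_empty[OF M] by (metis abs_ge_zero ex_in_conv order_trans)
  \<comment> \<open>Weights that are at least 1 can be normalised to densities. Frequency 0 shows
    that the normalising constants \<open>vn\<close> tend to \<open>v\<close>, and the lower bound 1
    survives in the limit, so dividing by them does no harm.\<close>
  have gen: "(\<lambda>n. \<integral>\<omega>. V n \<omega> * \<psi> (X n \<omega>) \<partial>M n) \<longlonglongrightarrow> v * (\<integral>x. \<psi> x \<partial>\<mu>)"
    if V[measurable]: "\<And>n. V n \<in> borel_measurable (M n)"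
      and VD: "\<And>n \<omega>. \<omega> \<in> space (M n) \<Longrightarrow> 1 \<le> V n \<omega> \<and> V n \<omega> \<le> D"
      and vch: "\<And>u. (\<lambda>n. \<integral>\<omega>. V n \<omega> *\<^sub>R iexp (u * X n \<omega>) \<partial>M n) \<longlonglongrightarrow> v *\<^sub>R char \<mu> u"
    for V :: "nat \<Rightarrow> 'w \<Rightarrow> real" and v D
  proof -
    define vn where "vn n = (\<integral>\<omega>. V n \<omega> \<partial>M n)" for n
    have int_V: "integrable (M n) (V n)" for n
      by (rule finite_measure.integrable_const_bound[where B=D])
        (use VD M in \<open>auto simp: prob_space.finite_measure intro!: AE_I2\<close>, fastforce)
    have vn1: "1 \<le> vn n" for n
    proof -
      interpret Mn: prob_space "M n" by (rule M)
      have "(\<integral>\<omega>. 1 \<partial>M n) \<le> vn n" unfolding vn_def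
        by (rule integral_mono) (use int_V VD in auto)
      then show ?thesis by (simp add: Mn.prob_space)
    qed
    have "(\<lambda>n. \<integral>\<omega>. V n \<omega> *\<^sub>R iexp (0 * X n \<omega>) \<partial>M n) \<longlonglongrightarrow> v *\<^sub>R char \<mu> 0" by (rule vch)
    then have "(\<lambda>n. complex_of_real (vn n)) \<longlonglongrightarrow> complex_of_real v"
      by (simp add: \<mu>.char_zero vn_def scaleR_conv_of_real)
    then have vlim: "vn \<longlonglongrightarrow> v" by (simp only: tendsto_of_real_iff)
    have v1: "1 \<le> v" by (rule LIMSEQ_le_const[OF vlim]) (use vn1 in auto)
    define \<nu> where "\<nu> n = distr (density (M n) (\<lambda>\<omega>. ennreal (V n \<omega> / vn n))) borel (X n)" for n
    have pos: "0 \<le> V n \<omega> / vn n" if "\<omega> \<in> space (M n)" for n \<omega>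
      using VD[OF that] vn1[of n] by auto
    have \<nu>: "real_distribution (\<nu> n)" for n
    proof -
      have "(\<integral>\<^sup>+\<omega>. ennreal (V n \<omega> / vn n) \<partial>M n) = ennreal (\<integral>\<omega>. V n \<omega> / vn n \<partial>M n)"
        by (rule nn_integral_eq_integral) (use int_V pos in auto)
      also have "(\<integral>\<omega>. V n \<omega> / vn n \<partial>M n) = 1" using vn1[of n] by (simp add: vn_def)
      finally have "prob_space (density (M n) (\<lambda>\<omega>. ennreal (V n \<omega> / vn n)))"
        by (intro prob_spaceI) (simp add: emeasure_density cong: nn_integral_cong)
      then show ?thesis unfolding \<nu>_def
        by (intro prob_space.real_distribution_distr) auto
    qed
    have \<nu>int: "(\<integral>x. f x \<partial>\<nu> n) = (1 / vn n) *\<^sub>R (\<integral>\<omega>. V n \<omega> *\<^sub>R f (X n \<omega>) \<partial>M n)"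
      if [measurable]: "f \<in> borel_measurable borel" for f :: "real \<Rightarrow> 'z::{banach, second_countable_topology}" and n
    proof -
      have "(\<integral>x. f x \<partial>\<nu> n) = (\<integral>\<omega>. f (X n \<omega>) \<partial>density (M n) (\<lambda>\<omega>. ennreal (V n \<omega> / vn n)))"
        unfolding \<nu>_def by (rule integral_distr) auto
      also have "\<dots> = (\<integral>\<omega>. (V n \<omega> / vn n) *\<^sub>R f (X n \<omega>) \<partial>M n)"
        by (rule integral_density) (use pos in auto)
      also have "\<dots> = (\<integral>\<omega>. (1 / vn n) *\<^sub>R (V n \<omega> *\<^sub>R f (X n \<omega>)) \<partial>M n)" by simp
      finally show ?thesis by (simp only: integral_scaleR_right)
    qed
    have "weak_conv_m \<nu> \<mu>"
    proof (rule levy_continuity[OF \<nu> \<mu>])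
      fix u
      have "(\<lambda>n. (1 / vn n) *\<^sub>R (\<integral>\<omega>. V n \<omega> *\<^sub>R iexp (u * X n \<omega>) \<partial>M n)) \<longlonglongrightarrow> (1 / v) *\<^sub>R (v *\<^sub>R char \<mu> u)"
        using v1 by (intro tendsto_intros vlim vch) auto
      then show "(\<lambda>n. char (\<nu> n) u) \<longlonglongrightarrow> char \<mu> u"
        using v1 by (simp add: char_def \<nu>int)
    qed
    then have "(\<lambda>n. \<integral>x. \<psi> x \<partial>\<nu> n) \<longlonglongrightarrow> (\<integral>x. \<psi> x \<partial>\<mu>)"
      by (rule weak_conv_imp_integral_bdd_continuous_conv[OF \<nu> \<mu>, where B=B]) (use \<psi> in auto)
    then have "(\<lambda>n. vn n * (\<integral>x. \<psi> x \<partial>\<nu> n)) \<longlonglongrightarrow> v * (\<integral>x. \<psi> x \<partial>\<mu>)"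
      by (intro tendsto_intros vlim)
    moreover have "vn n * (\<integral>x. \<psi> x \<partial>\<nu> n) = (\<integral>\<omega>. V n \<omega> * \<psi> (X n \<omega>) \<partial>M n)" for n
      using vn1[of n] by (simp add: \<nu>int)
    ultimately show ?thesis by simp
  qed
  have int_iexp: "integrable (M n) (\<lambda>\<omega>. iexp (u * X n \<omega>))" for n u
    by (rule prob_space.integrable_iexp[OF M]) auto
  have int_W: "integrable (M n) (\<lambda>\<omega>. W n \<omega> *\<^sub>R iexp (u * X n \<omega>))" for n u
    by (rule finite_measure.integrable_const_bound[where B=C])
      (use WC M in \<open>auto simp: prob_space.finite_measure intro!: AE_I2\<close>)
  have 1: "(\<lambda>n. \<integral>\<omega>. 1 * \<psi> (X n \<omega>) \<partial>M n) \<longlonglongrightarrow> 1 * (\<integral>x. \<psi> x \<partial>\<mu>)"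
    by (rule gen[of "\<lambda>_ _. 1" 1 1]) (use ch in auto)
  \<comment> \<open>The shift by \<open>C + 1\<close> makes the weight positive; its contribution is
    \<open>C + 1\<close> times the unweighted case and is subtracted again at the end.\<close>
  have 2: "(\<lambda>n. \<integral>\<omega>. (W n \<omega> + (C + 1)) * \<psi> (X n \<omega>) \<partial>M n) \<longlonglongrightarrow> (w + (C + 1)) * (\<integral>x. \<psi> x \<partial>\<mu>)"
  proof (rule gen)
    show "1 \<le> W n \<omega> + (C + 1) \<and> W n \<omega> + (C + 1) \<le> 2 * C + 1" if "\<omega> \<in> space (M n)" for n \<omega>
      using WC[OF that] by (auto simp: abs_le_iff)
    fix u
    have "(\<lambda>n. (\<integral>\<omega>. W n \<omega> *\<^sub>R iexp (u * X n \<omega>) \<partial>M n) + (C + 1) *\<^sub>R (\<integral>\<omega>. iexp (u * X n \<omega>) \<partial>M n))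
        \<longlonglongrightarrow> w *\<^sub>R char \<mu> u + (C + 1) *\<^sub>R char \<mu> u"
      by (intro tendsto_intros wch ch)
    moreover have "(\<integral>\<omega>. (W n \<omega> + (C + 1)) *\<^sub>R iexp (u * X n \<omega>) \<partial>M n) =
        (\<integral>\<omega>. W n \<omega> *\<^sub>R iexp (u * X n \<omega>) \<partial>M n) + (C + 1) *\<^sub>R (\<integral>\<omega>. iexp (u * X n \<omega>) \<partial>M n)" for n
    proof -
      have "(\<integral>\<omega>. (W n \<omega> + (C + 1)) *\<^sub>R iexp (u * X n \<omega>) \<partial>M n) =
          (\<integral>\<omega>. W n \<omega> *\<^sub>R iexp (u * X n \<omega>) + (C + 1) *\<^sub>R iexp (u * X n \<omega>) \<partial>M n)"
        by (subst scaleR_add_left) (rule refl)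
      also have "\<dots> = (\<integral>\<omega>. W n \<omega> *\<^sub>R iexp (u * X n \<omega>) \<partial>M n) + (\<integral>\<omega>. (C + 1) *\<^sub>R iexp (u * X n \<omega>) \<partial>M n)"
        by (rule Bochner_Integration.integral_add[OF int_W integrable_scaleR_right]) (rule int_iexp)
      finally show ?thesis by (simp only: integral_scaleR_right)
    qed
    ultimately show "(\<lambda>n. \<integral>\<omega>. (W n \<omega> + (C + 1)) *\<^sub>R iexp (u * X n \<omega>) \<partial>M n) \<longlonglongrightarrow> (w + (C + 1)) *\<^sub>R char \<mu> u"
      by (simp only: scaleR_add_left[of w "C + 1"])
  qed auto
  have i\<psi>: "integrable (M n) (\<lambda>\<omega>. \<psi> (X n \<omega>))" for n
    by (rule finite_measure.integrable_const_bound[where B=B])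
      (use \<psi> M in \<open>auto simp: prob_space.finite_measure intro!: AE_I2\<close>)
  have iW\<psi>: "integrable (M n) (\<lambda>\<omega>. W n \<omega> * \<psi> (X n \<omega>))" for n
    by (rule finite_measure.integrable_const_bound[where B="C * B"])
      (use \<psi> WC C0 M in \<open>auto simp: prob_space.finite_measure abs_mult intro!: AE_I2 mult_mono\<close>)
  have eq: "(\<integral>\<omega>. (W n \<omega> + (C + 1)) * \<psi> (X n \<omega>) \<partial>M n) - (C + 1) * (\<integral>\<omega>. 1 * \<psi> (X n \<omega>) \<partial>M n)
      = (\<integral>\<omega>. W n \<omega> * \<psi> (X n \<omega>) \<partial>M n)" for n
    using i\<psi>[of n] iW\<psi>[of n] by (simp add: distrib_right)
  have "(\<lambda>n. (\<integral>\<omega>. (W n \<omega> + (C + 1)) * \<psi> (X n \<omega>) \<partial>M n) - (C + 1) * (\<integral>\<omega>. 1 * \<psi> (X n \<omega>) \<partial>M n))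
      \<longlonglongrightarrow> (w + (C + 1)) * (\<integral>x. \<psi> x \<partial>\<mu>) - (C + 1) * (1 * (\<integral>x. \<psi> x \<partial>\<mu>))"
    by (intro tendsto_intros 1 2)
  then show ?thesis unfolding eq by (simp add: algebra_simps)
qed

text \<open>The exponential factors are traded for test functions one coordinate at a time: in
  \<open>T J\<close> the first \<open>J\<close> factors have been replaced. Each replacement is an
  instance of the weighted one-dimensional theorem, the weight being the test functions already in
  place times the phase of the remaining coordinates.\<close>

lemma product_convergence_from_char:
  fixes X :: "nat \<Rightarrow> nat \<Rightarrow> 'w \<Rightarrow> real" and \<mu> :: "nat \<Rightarrow> real measure" and \<psi> :: "nat \<Rightarrow> real \<Rightarrow> real"
  assumes M: "\<And>n. prob_space (M n)"
    and X: "\<And>n j. X n j \<in> borel_measurable (M n)" and \<mu>: "\<And>j. real_distribution (\<mu> j)"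
    and ch: "\<And>u. (\<lambda>n. \<integral>\<omega>. iexp (\<Sum>j<k. u j * X n j \<omega>) \<partial>M n) \<longlonglongrightarrow> (\<Prod>j<k. char (\<mu> j) (u j))"
    and \<psi>: "\<And>j x. isCont (\<psi> j) x" "\<And>j x. \<bar>\<psi> j x\<bar> \<le> 1"
  shows "(\<lambda>n. \<integral>\<omega>. (\<Prod>j<k. \<psi> j (X n j \<omega>)) \<partial>M n) \<longlonglongrightarrow> (\<Prod>j<k. \<integral>x. \<psi> j x \<partial>\<mu> j)"
proof -
  note X[measurable]
  have \<psi>m[measurable]: "\<psi> j \<in> borel_measurable borel" for j
    using \<psi>(1) by (intro borel_measurable_continuous_onI continuous_at_imp_continuous_on) auto
  have b: "\<bar>\<Prod>j<J. \<psi> j (X n j \<omega>)\<bar> \<le> 1" for J n \<omega>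
    unfolding abs_prod by (intro prod_le_1) (use \<psi>(2) in auto)
  have single: "(\<lambda>n. \<integral>\<omega>. iexp (v * X n J \<omega>) \<partial>M n) \<longlonglongrightarrow> char (\<mu> J) v" if J: "J < k" for J v
  proof -
    have "(\<Sum>j<k. (if j = J then v else 0) * X n j \<omega>) = v * X n J \<omega>" for n \<omega>
      using J by (simp add: if_distrib[of "\<lambda>x. x * _"] cong: if_cong)
    moreover have "(\<Prod>j<k. char (\<mu> j) (if j = J then v else 0)) = char (\<mu> J) v"
    proof -
      have "(\<Prod>j<k. char (\<mu> j) (if j = J then v else 0)) = (\<Prod>j<k. if j = J then char (\<mu> J) v else 1)"
        using \<mu> by (intro prod.cong) (auto simp: real_distribution.char_zero)
      then show ?thesis using J by simp
    qed
    ultimately show ?thesis using ch[of "\<lambda>j. if j = J then v else 0"] by simp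
  qed
  define T where "T J u n = (\<integral>\<omega>. (\<Prod>j<J. \<psi> j (X n j \<omega>)) *\<^sub>R iexp (\<Sum>j\<in>{J..<k}. u j * X n j \<omega>) \<partial>M n)" for J u n
  define l where "l J u = (\<Prod>j<J. \<integral>x. \<psi> j x \<partial>\<mu> j) *\<^sub>R (\<Prod>j\<in>{J..<k}. char (\<mu> j) (u j))" for J u
  have "T J u \<longlonglongrightarrow> l J u" if "J \<le> k" for J u
    using that
  proof (induction J arbitrary: u)
    case 0
    then show ?case using ch[of u] by (simp add: T_def l_def lessThan_atLeast0)
  next
    case (Suc J)
    then have J: "J < k" by simp
    define P where "P n \<omega> = (\<Prod>j<J. \<psi> j (X n j \<omega>))" for n \<omega>
    define R where "R n \<omega> = (\<Sum>j\<in>{Suc J..<k}. u j * X n j \<omega>)" for n \<omega>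
    define z where "z = (\<Prod>j<J. \<integral>x. \<psi> j x \<partial>\<mu> j) *\<^sub>R (\<Prod>j\<in>{Suc J..<k}. char (\<mu> j) (u j))"
    have [measurable]: "P n \<in> borel_measurable (M n)" "R n \<in> borel_measurable (M n)" for n
      unfolding P_def R_def by measurable
    have Pb: "\<bar>P n \<omega>\<bar> \<le> 1" for n \<omega> unfolding P_def by (rule b)
    have spl: "{J..<k} = insert J {Suc J..<k}" using J by auto
    \<comment> \<open>Both signs of the remaining phase are needed to build its cosine and sine.
      Reversing the sign conjugates the limit, because the characteristic functions are conjugated
      and the integrals of the test functions are real.\<close>
    have IH: "(\<lambda>n. \<integral>\<omega>. P n \<omega> *\<^sub>R iexp (v * X n J \<omega> + s * R n \<omega>) \<partial>M n) \<longlonglongrightarrow>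
        (if s = 1 then z else cnj z) * char (\<mu> J) v" if s: "s = 1 \<or> s = -1" for s v
    proof -
      let ?u = "\<lambda>j. if j = J then v else s * u j"
      have "(\<Sum>j\<in>{J..<k}. ?u j * X n j \<omega>) = v * X n J \<omega> + s * R n \<omega>" for n \<omega>
        unfolding spl R_def sum_distrib_left by (subst sum.insert) (auto simp: mult.assoc intro!: sum.cong)
      then have "T J ?u = (\<lambda>n. \<integral>\<omega>. P n \<omega> *\<^sub>R iexp (v * X n J \<omega> + s * R n \<omega>) \<partial>M n)"
        unfolding T_def P_def by simp
      moreover have "(\<Prod>j\<in>{J..<k}. char (\<mu> j) (?u j)) = char (\<mu> J) v * (\<Prod>j\<in>{Suc J..<k}. char (\<mu> j) (s * u j))"
        unfolding spl by (subst prod.insert) (auto intro!: prod.cong)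
      then have "l J ?u = (if s = 1 then z else cnj z) * char (\<mu> J) v"
        using s unfolding l_def z_def by (auto simp: char_minus_cnj scaleR_conv_of_real)
      ultimately show ?thesis using Suc.IH[of ?u] Suc.prems by simp
    qed
    have int: "integrable (M n) (\<lambda>\<omega>. P n \<omega> *\<^sub>R iexp (f \<omega>))" if [measurable]: "f \<in> borel_measurable (M n)" for f n
      by (rule finite_measure.integrable_const_bound[where B=1])
        (use Pb M in \<open>auto simp: prob_space.finite_measure intro!: AE_I2\<close>)
    \<comment> \<open>The weights in \<open>weighted_levy_continuity\<close> are real, so the phase
      \<open>R n \<omega>\<close> enters through its cosine and its sine separately.\<close>
    have cos_eq: "(P n \<omega> * cos (R n \<omega>)) *\<^sub>R iexp (v * X n J \<omega>) =
        (1/2) *\<^sub>R (P n \<omega> *\<^sub>R iexp (v * X n J \<omega> + 1 * R n \<omega>) + P n \<omega> *\<^sub>R iexp (v * X n J \<omega> + (-1) * R n \<omega>))"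
      and sin_eq: "(P n \<omega> * sin (R n \<omega>)) *\<^sub>R iexp (v * X n J \<omega>) =
        Complex 0 (- 1 / 2) * (P n \<omega> *\<^sub>R iexp (v * X n J \<omega> + 1 * R n \<omega>) - P n \<omega> *\<^sub>R iexp (v * X n J \<omega> + (-1) * R n \<omega>))" for n \<omega> v
      by (auto simp: complex_eq_iff Re_exp Im_exp cos_add sin_add cos_diff sin_diff algebra_simps)
    have cosl: "(\<lambda>n. \<integral>\<omega>. (P n \<omega> * cos (R n \<omega>)) *\<^sub>R iexp (v * X n J \<omega>) \<partial>M n) \<longlonglongrightarrow> Re z *\<^sub>R char (\<mu> J) v" for v
    proof -
      have "(\<lambda>n. (1/2) *\<^sub>R ((\<integral>\<omega>. P n \<omega> *\<^sub>R iexp (v * X n J \<omega> + 1 * R n \<omega>) \<partial>M n) +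
          (\<integral>\<omega>. P n \<omega> *\<^sub>R iexp (v * X n J \<omega> + (-1) * R n \<omega>) \<partial>M n))) \<longlonglongrightarrow>
          (1/2) *\<^sub>R ((if (1::real) = 1 then z else cnj z) * char (\<mu> J) v + (if (-1::real) = 1 then z else cnj z) * char (\<mu> J) v)"
        by (intro tendsto_intros IH) auto
      also have "(1/2) *\<^sub>R ((if (1::real) = 1 then z else cnj z) * char (\<mu> J) v + (if (-1::real) = 1 then z else cnj z) * char (\<mu> J) v)
          = Re z *\<^sub>R char (\<mu> J) v"
        by (simp add: complex_eq_iff algebra_simps)
      finally show ?thesis unfolding cos_eq integral_scaleR_right
        by (subst Bochner_Integration.integral_add[OF int int]) measurable
    qed
    have sinl: "(\<lambda>n. \<integral>\<omega>. (P n \<omega> * sin (R n \<omega>)) *\<^sub>R iexp (v * X n J \<omega>) \<partial>M n) \<longlonglongrightarrow> Im z *\<^sub>R char (\<mu> J) v" for v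
    proof -
      have "(\<lambda>n. Complex 0 (- 1 / 2) * ((\<integral>\<omega>. P n \<omega> *\<^sub>R iexp (v * X n J \<omega> + 1 * R n \<omega>) \<partial>M n) -
          (\<integral>\<omega>. P n \<omega> *\<^sub>R iexp (v * X n J \<omega> + (-1) * R n \<omega>) \<partial>M n))) \<longlonglongrightarrow>
          Complex 0 (- 1 / 2) * ((if (1::real) = 1 then z else cnj z) * char (\<mu> J) v - (if (-1::real) = 1 then z else cnj z) * char (\<mu> J) v)"
        by (intro tendsto_intros IH) auto
      also have "Complex 0 (- 1 / 2) * ((if (1::real) = 1 then z else cnj z) * char (\<mu> J) v - (if (-1::real) = 1 then z else cnj z) * char (\<mu> J) v)
          = Im z *\<^sub>R char (\<mu> J) v"
        by (simp add: complex_eq_iff algebra_simps)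
      finally show ?thesis unfolding sin_eq integral_mult_right_zero
        by (subst Bochner_Integration.integral_diff[OF int int]) measurable
    qed
    have bc: "\<bar>P n \<omega> * cos (R n \<omega>)\<bar> \<le> 1" "\<bar>P n \<omega> * sin (R n \<omega>)\<bar> \<le> 1" for n \<omega>
      using Pb[of n \<omega>] by (auto simp: abs_mult intro!: mult_le_one)
    have c: "(\<lambda>n. \<integral>\<omega>. (P n \<omega> * cos (R n \<omega>)) * \<psi> J (X n J \<omega>) \<partial>M n) \<longlonglongrightarrow> Re z * (\<integral>x. \<psi> J x \<partial>\<mu> J)"
      by (rule weighted_levy_continuity[OF M X _ bc(1) \<mu> single[OF J] cosl \<psi>]) auto
    have s: "(\<lambda>n. \<integral>\<omega>. (P n \<omega> * sin (R n \<omega>)) * \<psi> J (X n J \<omega>) \<partial>M n) \<longlonglongrightarrow> Im z * (\<integral>x. \<psi> J x \<partial>\<mu> J)"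
      by (rule weighted_levy_continuity[OF M X _ bc(2) \<mu> single[OF J] sinl \<psi>]) auto
    have bc': "\<bar>(P n \<omega> * cos (R n \<omega>)) * \<psi> J (X n J \<omega>)\<bar> \<le> 1" "\<bar>(P n \<omega> * sin (R n \<omega>)) * \<psi> J (X n J \<omega>)\<bar> \<le> 1" for n \<omega>
      using bc[of n \<omega>] \<psi>(2)[of J] by (auto simp: abs_mult[of _ "\<psi> _ _"] intro!: mult_le_one)
    have ib: "integrable (M n) (\<lambda>\<omega>. (P n \<omega> * cos (R n \<omega>)) * \<psi> J (X n J \<omega>))"
      "integrable (M n) (\<lambda>\<omega>. (P n \<omega> * sin (R n \<omega>)) * \<psi> J (X n J \<omega>))" for n
      by (rule finite_measure.integrable_const_bound[where B=1];
        use bc' M in \<open>auto simp: prob_space.finite_measure intro!: AE_I2\<close>)+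
    have eq: "T (Suc J) u n = complex_of_real (\<integral>\<omega>. (P n \<omega> * cos (R n \<omega>)) * \<psi> J (X n J \<omega>) \<partial>M n) +
        \<i> * complex_of_real (\<integral>\<omega>. (P n \<omega> * sin (R n \<omega>)) * \<psi> J (X n J \<omega>) \<partial>M n)" for n
    proof -
      have "T (Suc J) u n = (\<integral>\<omega>. complex_of_real ((P n \<omega> * cos (R n \<omega>)) * \<psi> J (X n J \<omega>)) +
          \<i> * complex_of_real ((P n \<omega> * sin (R n \<omega>)) * \<psi> J (X n J \<omega>)) \<partial>M n)"
        unfolding T_def P_def[symmetric] R_def[symmetric] prod.lessThan_Suc
        by (rule Bochner_Integration.integral_cong) (auto simp: complex_eq_iff Re_exp Im_exp)
      also have "\<dots> = (\<integral>\<omega>. complex_of_real ((P n \<omega> * cos (R n \<omega>)) * \<psi> J (X n J \<omega>)) \<partial>M n) +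
          (\<integral>\<omega>. \<i> * complex_of_real ((P n \<omega> * sin (R n \<omega>)) * \<psi> J (X n J \<omega>)) \<partial>M n)"
        by (intro Bochner_Integration.integral_add integrable_of_real integrable_mult_right ib)
      finally show ?thesis by (simp only: integral_complex_of_real integral_mult_right_zero)
    qed
    have "(\<lambda>n. complex_of_real (\<integral>\<omega>. (P n \<omega> * cos (R n \<omega>)) * \<psi> J (X n J \<omega>) \<partial>M n) +
        \<i> * complex_of_real (\<integral>\<omega>. (P n \<omega> * sin (R n \<omega>)) * \<psi> J (X n J \<omega>) \<partial>M n)) \<longlonglongrightarrow>
        complex_of_real (Re z * (\<integral>x. \<psi> J x \<partial>\<mu> J)) + \<i> * complex_of_real (Im z * (\<integral>x. \<psi> J x \<partial>\<mu> J))"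
      by (intro tendsto_intros c s)
    also have "complex_of_real (Re z * (\<integral>x. \<psi> J x \<partial>\<mu> J)) + \<i> * complex_of_real (Im z * (\<integral>x. \<psi> J x \<partial>\<mu> J)) = (\<integral>x. \<psi> J x \<partial>\<mu> J) *\<^sub>R z"
      by (simp add: complex_eq_iff)
    also have "\<dots> = l (Suc J) u" unfolding l_def z_def by simp
    finally show ?case unfolding eq[abs_def] .
  qed
  from this[of k "\<lambda>_. 0"]
  have "(\<lambda>n. complex_of_real (\<integral>\<omega>. (\<Prod>j<k. \<psi> j (X n j \<omega>)) \<partial>M n)) \<longlonglongrightarrow> complex_of_real (\<Prod>j<k. \<integral>x. \<psi> j x \<partial>\<mu> j)"
    by (simp add: T_def[abs_def] l_def scaleR_conv_of_real del: of_real_prod)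
  then show ?thesis by (simp only: tendsto_of_real_iff)
qed

section \<open>A piecewise linear partition of unity and the limit theorem for random
  vectors\<close>

definition clamp01 :: "real \<Rightarrow> real" where
  "clamp01 x = min 1 (max 0 x)"

lemma clamp01_window: "\<bar>z\<bar> \<le> R \<Longrightarrow> clamp01 (z + R + 1) - clamp01 (z - R) = 1"
  unfolding clamp01_def by (auto simp: min_def max_def)

text \<open>The triangular bump of height 1 and half-width 1 centred at \<open>i - R\<close>.
  Written as a difference of two shifted ramps, so that sums over \<open>i\<close>
  telescope.\<close>

definition hat :: "nat \<Rightarrow> nat \<Rightarrow> real \<Rightarrow> real" where
  "hat R i y = clamp01 (y + real R + 1 - real i) - clamp01 (y + real R - real i)"

lemma hat_bounds: "0 \<le> hat R i y" "hat R i y \<le> 1"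
  unfolding hat_def clamp01_def by (auto simp: min_def max_def)

lemma hat_support: "hat R i y \<noteq> 0 \<Longrightarrow> \<bar>y - (real i - real R)\<bar> \<le> 1"
  unfolding hat_def clamp01_def by (auto simp: min_def max_def split: if_splits)

lemma isCont_hat: "isCont (hat R i) y"
  unfolding hat_def[abs_def] clamp01_def by (intro continuous_intros)

text \<open>By telescoping. The result is a trapezoid, equal to 1 on \<open>[-R, R]\<close> by
  \<open>clamp01_window\<close>: the bumps with centres \<open>-R, ..., R\<close> form a partition
  of unity there.\<close>

lemma sum_hat:
  "(\<Sum>i<Suc (2 * R). hat R i y) = clamp01 (y + real R + 1) - clamp01 (y - real R)"
proof -
  have "(\<Sum>i<Suc (2 * R). hat R i y) =
      (\<Sum>i<Suc (2 * R). clamp01 (y + real R + 1 - real i) - clamp01 (y + real R + 1 - real (Suc i)))"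
    by (intro sum.cong refl) (simp add: hat_def algebra_simps)
  also have "\<dots> = clamp01 (y + real R + 1 - real 0) - clamp01 (y + real R + 1 - real (Suc (2 * R)))"
    by (rule sum_lessThan_telescope')
  finally show ?thesis by (simp add: algebra_simps)
qed

lemma mult_divide_mult_self:
  "p \<noteq> 0 \<Longrightarrow> p * (r / (q * p)) = r / q" for p q r :: real
  by (simp add: field_simps)

text \<open>On a mesh of width \<open>h\<close> the function \<open>g\<close> is replaced by
  \<open>G\<close>, the combination of products of bumps with the values of \<open>g\<close> at the
  mesh points. The error is \<open>L * h\<close> from the mesh and \<open>C\<close> times the mass
  \<open>1 - S R\<close> that the bumps miss. Both \<open>G\<close> and \<open>S R\<close> are built
  from products of one-variable functions, so their expectations converge.\<close>

theorem lipschitz_convergence_from_char: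
  fixes X :: "nat \<Rightarrow> nat \<Rightarrow> 'w \<Rightarrow> real" and Y :: "nat \<Rightarrow> 'v \<Rightarrow> real"
  assumes M: "\<And>n. prob_space (M n)"
    and X: "\<And>n j. X n j \<in> borel_measurable (M n)"
    and N: "prob_space N" and Y: "\<And>j. Y j \<in> borel_measurable N"
    and indep: "prob_space.indep_vars N (\<lambda>_. borel) Y {..<Suc k}"
    and ch: "\<And>u. (\<lambda>n. \<integral>\<omega>. iexp (\<Sum>j<Suc k. u j * X n j \<omega>) \<partial>M n) \<longlonglongrightarrow>
        (\<Prod>j<Suc k. char (distr N borel (Y j)) (u j))"
    and gC: "\<And>v. \<bar>g v\<bar> \<le> C" and L: "0 \<le> L" and gL: "coord_lipschitz k L g"
  shows "(\<lambda>n. \<integral>\<omega>. g (\<lambda>j. X n j \<omega>) \<partial>M n) \<longlonglongrightarrow> (\<integral>\<omega>. g (\<lambda>j. Y j \<omega>) \<partial>N)"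
proof -
  interpret N: prob_space N by (rule N)
  note X[measurable] Y[measurable]
  have C0: "0 \<le> C" using gC[of undefined] by linarith
  have prod_conv: "(\<lambda>n. \<integral>\<omega>. (\<Prod>j<Suc k. \<psi> j (X n j \<omega>)) \<partial>M n) \<longlonglongrightarrow> (\<integral>\<omega>. (\<Prod>j<Suc k. \<psi> j (Y j \<omega>)) \<partial>N)"
    if \<psi>: "\<And>j x. isCont (\<psi> j) x" "\<And>j x. \<bar>\<psi> j x\<bar> \<le> 1" for \<psi> :: "nat \<Rightarrow> real \<Rightarrow> real"
  proof -
    have \<psi>m[measurable]: "\<psi> j \<in> borel_measurable borel" for j
      using \<psi>(1) by (intro borel_measurable_continuous_onI continuous_at_imp_continuous_on) auto
    have "(\<integral>\<omega>. (\<Prod>j<Suc k. \<psi> j (Y j \<omega>)) \<partial>N) = (\<Prod>j<Suc k. \<integral>\<omega>. \<psi> j (Y j \<omega>) \<partial>N)"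
    proof (rule N.indep_vars_lebesgue_integral)
      show "N.indep_vars (\<lambda>_. borel) (\<lambda>j \<omega>. \<psi> j (Y j \<omega>)) {..<Suc k}"
        by (rule N.indep_vars_compose2[OF indep]) measurable
      show "integrable N (\<lambda>\<omega>. \<psi> j (Y j \<omega>))" for j
        by (rule N.integrable_const_bound[where B=1]) (use \<psi> in auto)
    qed simp
    also have "\<dots> = (\<Prod>j<Suc k. \<integral>x. \<psi> j x \<partial>distr N borel (Y j))"
      by (intro prod.cong refl integral_distr[symmetric]) auto
    finally show ?thesis
      using product_convergence_from_char[OF M X _ ch \<psi>] by simp
  qed
  show ?thesis
  proof (rule LIMSEQ_I)
    fix r :: real assume r: "0 < r"
    \<comment> \<open>The mesh error \<open>L * h\<close> is to be at most
      \<open>r / 8\<close>.\<close>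
    define h where "h = r / (8 * (L + 1))"
    have h: "0 < h" "L * h \<le> r / 8"
    proof -
      show "0 < h" using r L by (simp add: h_def)
      then have "L * h \<le> (L + 1) * h" by simp
      also have "\<dots> = r / 8" using L unfolding h_def by (intro mult_divide_mult_self) auto
      finally show "L * h \<le> r / 8" .
    qed
    define s where "s R y = clamp01 (y / h + real R + 1) - clamp01 (y / h - real R)" for R y
    have s01: "0 \<le> s R y" "s R y \<le> 1" for R y
      unfolding s_def clamp01_def by (auto simp: min_def max_def)
    have s_cont: "isCont (s R) y" for R y
      unfolding s_def[abs_def] clamp01_def using h(1) by (intro continuous_intros) auto
    have sm[measurable]: "s R \<in> borel_measurable borel" for R
      using s_cont by (intro borel_measurable_continuous_onI continuous_at_imp_continuous_on) auto
    have hm[measurable]: "hat R i \<in> borel_measurable borel" for R i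
      using isCont_hat by (intro borel_measurable_continuous_onI continuous_at_imp_continuous_on) auto
    define S where "S R x = (\<Prod>j<Suc k. s R (x j))" for R and x :: "nat \<Rightarrow> real"
    have S01: "0 \<le> S R x" "S R x \<le> 1" for R x
      unfolding S_def by (rule prod_nonneg, simp add: s01, rule prod_le_1, simp add: s01)
    have "(\<lambda>R. \<integral>\<omega>. S R (\<lambda>j. Y j \<omega>) \<partial>N) \<longlonglongrightarrow> (\<integral>\<omega>. 1 \<partial>N)"
    proof (rule integral_dominated_convergence[where w="\<lambda>_. 1"])
      show "AE \<omega> in N. (\<lambda>R. S R (\<lambda>j. Y j \<omega>)) \<longlonglongrightarrow> 1"
      proof (rule AE_I2)
        fix \<omega>
        obtain R0 where R0: "(\<Sum>j<Suc k. \<bar>Y j \<omega> / h\<bar>) \<le> real R0" using real_arch_simple by blast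
        have "S R (\<lambda>j. Y j \<omega>) = 1" if R: "R \<ge> R0" for R
        proof -
          have "s R (Y j \<omega>) = 1" if j: "j < Suc k" for j
          proof -
            have "\<bar>Y j \<omega> / h\<bar> \<le> (\<Sum>j<Suc k. \<bar>Y j \<omega> / h\<bar>)"
              by (rule member_le_sum) (use j in auto)
            then have "\<bar>Y j \<omega> / h\<bar> \<le> real R" using R0 R by (meson of_nat_mono order_trans)
            then show ?thesis unfolding s_def by (rule clamp01_window)
          qed
          then show ?thesis by (simp add: S_def)
        qed
        then have "eventually (\<lambda>R. S R (\<lambda>j. Y j \<omega>) = 1) sequentially"
          by (auto simp: eventually_sequentially)
        then show "(\<lambda>R. S R (\<lambda>j. Y j \<omega>)) \<longlonglongrightarrow> 1" by (rule tendsto_eventually)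
      qed
      show "AE \<omega> in N. norm (S R (\<lambda>j. Y j \<omega>)) \<le> 1" for R using S01 by auto
      show "(\<lambda>\<omega>. S R (\<lambda>j. Y j \<omega>)) \<in> borel_measurable N" for R unfolding S_def by measurable
    qed auto
    then have "(\<lambda>R. \<integral>\<omega>. S R (\<lambda>j. Y j \<omega>) \<partial>N) \<longlonglongrightarrow> 1" by (simp add: N.prob_space)
    \<comment> \<open>The mass missed under the limit law is made smaller than
      \<open>r / (8 * (C + 1))\<close>. Since \<open>S R\<close> is a product of continuous
      one-variable functions, \<open>convS\<close> transfers this bound to \<open>X n\<close>;
      tightness thus comes from the limit.\<close>
    then have "eventually (\<lambda>R. 1 - r / (8 * (C + 1)) < (\<integral>\<omega>. S R (\<lambda>j. Y j \<omega>) \<partial>N)) sequentially"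
      by (rule order_tendstoD) (use r C0 in simp)
    then obtain R where R: "1 - r / (8 * (C + 1)) < (\<integral>\<omega>. S R (\<lambda>j. Y j \<omega>) \<partial>N)"
      by (auto simp: eventually_sequentially)
    define A where "A = Pi\<^sub>E {..<Suc k} (\<lambda>_. {..<Suc (2 * R)})"
    have finA: "finite A" unfolding A_def by (intro finite_PiE) auto
    define w where "w a x = (\<Prod>j<Suc k. hat R (a j) (x j / h))" for a :: "nat \<Rightarrow> nat" and x :: "nat \<Rightarrow> real"
    define p where "p a = (\<lambda>j. h * (real (a j) - real R))" for a :: "nat \<Rightarrow> nat"
    define G where "G x = (\<Sum>a\<in>A. g (p a) * w a x)" for x
    have w0: "0 \<le> w a x" "w a x \<le> 1" for a x
      unfolding w_def by (rule prod_nonneg, simp add: hat_bounds, rule prod_le_1, simp add: hat_bounds)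
    have w_sum: "(\<Sum>a\<in>A. w a x) = S R x" for x
    proof -
      have "(\<Sum>a\<in>A. w a x) = (\<Prod>j<Suc k. \<Sum>i<Suc (2 * R). hat R i (x j / h))"
        unfolding A_def w_def by (rule prod_sum_PiE[symmetric]) auto
      then show ?thesis by (simp only: sum_hat S_def s_def)
    qed
    have close: "\<bar>g x - G x\<bar> \<le> L * h + C * (1 - S R x)" for x
    proof -
      have "g x - G x = (\<Sum>a\<in>A. (g x - g (p a)) * w a x) + g x * (1 - S R x)"
        unfolding G_def w_sum[symmetric]
        by (simp add: left_diff_distrib sum_subtractf sum_distrib_left right_diff_distrib)
      also have "\<bar>\<dots>\<bar> \<le> \<bar>\<Sum>a\<in>A. (g x - g (p a)) * w a x\<bar> + \<bar>g x * (1 - S R x)\<bar>"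
        by (rule abs_triangle_ineq)
      also have "\<bar>\<Sum>a\<in>A. (g x - g (p a)) * w a x\<bar> \<le> (\<Sum>a\<in>A. L * h * w a x)"
      proof (rule order_trans[OF sum_abs], rule sum_mono)
        fix a
        show "\<bar>(g x - g (p a)) * w a x\<bar> \<le> L * h * w a x"
        proof (cases "w a x = 0")
          case False
          \<comment> \<open>A product of bumps that does not vanish at \<open>x\<close> forces every
            coordinate of \<open>x\<close> to lie within \<open>h\<close> of the mesh point
            \<open>p a\<close>.\<close>
          have "\<bar>g x - g (p a)\<bar> \<le> L * h"
          proof (rule coord_lipschitzD[OF gL])
            fix j assume "j \<le> k"
            then have "hat R (a j) (x j / h) \<noteq> 0" using False by (auto simp: w_def simp del: prod.lessThan_Suc)
            from hat_support[OF this] have "\<bar>x j / h - (real (a j) - real R)\<bar> * h \<le> 1 * h"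
              by (rule mult_right_mono) (use h in auto)
            moreover have "\<bar>x j / h - (real (a j) - real R)\<bar> * h = \<bar>x j - p a j\<bar>"
              using h(1) by (simp add: p_def abs_mult_pos' [symmetric] field_simps flip: abs_mult_pos)
            ultimately show "\<bar>x j - p a j\<bar> \<le> h" by simp
          qed
          then show ?thesis using w0[of a x] by (simp add: abs_mult mult_right_mono)
        qed simp
      qed
      also have "(\<Sum>a\<in>A. L * h * w a x) = L * h * S R x"
        by (simp only: w_sum sum_distrib_left[symmetric])
      also have "L * h * S R x \<le> L * h * 1" using S01 L h by (intro mult_left_mono) auto
      also have "\<bar>g x * (1 - S R x)\<bar> \<le> C * (1 - S R x)"
        using S01[of R x] gC[of x] by (simp add: abs_mult mult_right_mono)
      finally show ?thesis by simp
    qed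
    have wm: "(\<lambda>\<omega>. w a (\<lambda>j. Z j \<omega>)) \<in> borel_measurable P" "(\<lambda>\<omega>. S R (\<lambda>j. Z j \<omega>)) \<in> borel_measurable P"
      if [measurable]: "\<And>j. Z j \<in> borel_measurable P" for P :: "'z measure" and Z a
      unfolding w_def S_def by measurable
    have wi: "integrable P (\<lambda>\<omega>. w a (\<lambda>j. Z j \<omega>))" "integrable P (\<lambda>\<omega>. S R (\<lambda>j. Z j \<omega>))"
      if "prob_space P" "\<And>j. Z j \<in> borel_measurable P" for P :: "'z measure" and Z a
    proof -
      interpret P: prob_space P by (rule that)
      show "integrable P (\<lambda>\<omega>. w a (\<lambda>j. Z j \<omega>))"
        by (rule P.integrable_const_bound[where B=1]) (use w0 wm(1)[OF that(2)] in simp_all)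
      show "integrable P (\<lambda>\<omega>. S R (\<lambda>j. Z j \<omega>))"
        by (rule P.integrable_const_bound[where B=1]) (use S01 wm(2)[OF that(2)] in simp_all)
    qed
    have convG: "(\<lambda>n. \<integral>\<omega>. G (\<lambda>j. X n j \<omega>) \<partial>M n) \<longlonglongrightarrow> (\<integral>\<omega>. G (\<lambda>j. Y j \<omega>) \<partial>N)"
    proof -
      have wa: "(\<lambda>n. \<integral>\<omega>. w a (\<lambda>j. X n j \<omega>) \<partial>M n) \<longlonglongrightarrow> (\<integral>\<omega>. w a (\<lambda>j. Y j \<omega>) \<partial>N)" for a
        unfolding w_def
      proof (rule prod_conv)
        fix j x
        have "isCont (\<lambda>x. x / h) x" using h by (intro continuous_intros) auto
        then show "isCont (\<lambda>x. hat R (a j) (x / h)) x" by (rule isCont_o2[OF _ isCont_hat])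
        show "\<bar>hat R (a j) (x / h)\<bar> \<le> 1" using hat_bounds by simp
      qed
      have "(\<lambda>n. \<Sum>a\<in>A. g (p a) * (\<integral>\<omega>. w a (\<lambda>j. X n j \<omega>) \<partial>M n)) \<longlonglongrightarrow>
          (\<Sum>a\<in>A. g (p a) * (\<integral>\<omega>. w a (\<lambda>j. Y j \<omega>) \<partial>N))"
        by (intro tendsto_intros wa)
      moreover have "(\<integral>\<omega>. G (\<lambda>j. X n j \<omega>) \<partial>M n) = (\<Sum>a\<in>A. g (p a) * (\<integral>\<omega>. w a (\<lambda>j. X n j \<omega>) \<partial>M n))" for n
        unfolding G_def using wi(1)[OF M X] by (simp add: Bochner_Integration.integral_sum)
      moreover have "(\<integral>\<omega>. G (\<lambda>j. Y j \<omega>) \<partial>N) = (\<Sum>a\<in>A. g (p a) * (\<integral>\<omega>. w a (\<lambda>j. Y j \<omega>) \<partial>N))"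
        unfolding G_def using wi(1)[OF N Y] by (simp add: Bochner_Integration.integral_sum)
      ultimately show ?thesis by simp
    qed
    have convS: "(\<lambda>n. \<integral>\<omega>. S R (\<lambda>j. X n j \<omega>) \<partial>M n) \<longlonglongrightarrow> (\<integral>\<omega>. S R (\<lambda>j. Y j \<omega>) \<partial>N)"
      unfolding S_def by (rule prod_conv) (use s_cont s01 in auto)
    have est: "\<bar>(\<integral>\<omega>. g (\<lambda>j. Z j \<omega>) \<partial>P) - (\<integral>\<omega>. G (\<lambda>j. Z j \<omega>) \<partial>P)\<bar> \<le> L * h + C * (1 - (\<integral>\<omega>. S R (\<lambda>j. Z j \<omega>) \<partial>P))"
      if P: "prob_space P" and Z[measurable]: "\<And>j. Z j \<in> borel_measurable P" for P :: "'z measure" and Z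
    proof -
      interpret P: prob_space P by (rule P)
      have gm[measurable]: "(\<lambda>\<omega>. g (\<lambda>j. Z j \<omega>)) \<in> borel_measurable P"
        by (rule measurable_coord_lipschitz[OF gL L Z])
      have i1: "integrable P (\<lambda>\<omega>. g (\<lambda>j. Z j \<omega>))"
        by (rule P.integrable_const_bound[where B=C]) (use gC in auto)
      have i2: "integrable P (\<lambda>\<omega>. G (\<lambda>j. Z j \<omega>))" unfolding G_def
        by (intro Bochner_Integration.integrable_sum integrable_mult_right wi P Z)
      have i3: "integrable P (\<lambda>\<omega>. S R (\<lambda>j. Z j \<omega>))" by (intro wi P Z)
      have "\<bar>(\<integral>\<omega>. g (\<lambda>j. Z j \<omega>) \<partial>P) - (\<integral>\<omega>. G (\<lambda>j. Z j \<omega>) \<partial>P)\<bar> = \<bar>\<integral>\<omega>. g (\<lambda>j. Z j \<omega>) - G (\<lambda>j. Z j \<omega>) \<partial>P\<bar>"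
        using i1 i2 by simp
      also have "\<dots> \<le> (\<integral>\<omega>. \<bar>g (\<lambda>j. Z j \<omega>) - G (\<lambda>j. Z j \<omega>)\<bar> \<partial>P)" by (rule integral_abs_bound)
      also have "\<dots> \<le> (\<integral>\<omega>. L * h + C * (1 - S R (\<lambda>j. Z j \<omega>)) \<partial>P)"
        by (rule integral_mono) (use i1 i2 i3 close in auto)
      also have "\<dots> = L * h + C * (1 - (\<integral>\<omega>. S R (\<lambda>j. Z j \<omega>) \<partial>P))"
        using i3 by (simp add: P.prob_space)
      finally show ?thesis .
    qed
    have r8: "0 < r / (8 * (C + 1))" "0 < r / 8" using r C0 by auto
    have Cr: "C * (r / (8 * (C + 1))) \<le> r / 8"
      using r C0 by (simp add: field_simps)
    from LIMSEQ_D[OF convG r8(2)] obtain n1 where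
      n1: "\<And>n. n \<ge> n1 \<Longrightarrow> \<bar>(\<integral>\<omega>. G (\<lambda>j. X n j \<omega>) \<partial>M n) - (\<integral>\<omega>. G (\<lambda>j. Y j \<omega>) \<partial>N)\<bar> < r / 8" by auto
    have "eventually (\<lambda>n. 1 - r / (8 * (C + 1)) < (\<integral>\<omega>. S R (\<lambda>j. X n j \<omega>) \<partial>M n)) sequentially"
      by (rule order_tendstoD(1)[OF convS R])
    then obtain n2 where n2: "\<And>n. n \<ge> n2 \<Longrightarrow> 1 - r / (8 * (C + 1)) < (\<integral>\<omega>. S R (\<lambda>j. X n j \<omega>) \<partial>M n)"
      by (auto simp: eventually_sequentially)
    show "\<exists>no. \<forall>n\<ge>no. norm ((\<integral>\<omega>. g (\<lambda>j. X n j \<omega>) \<partial>M n) - (\<integral>\<omega>. g (\<lambda>j. Y j \<omega>) \<partial>N)) < r"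
    proof (intro exI[of _ "max n1 n2"] allI impI)
      fix n assume n: "max n1 n2 \<le> n"
      have "C * (1 - (\<integral>\<omega>. S R (\<lambda>j. X n j \<omega>) \<partial>M n)) \<le> C * (r / (8 * (C + 1)))"
        using n2[of n] n C0 by (intro mult_left_mono) auto
      moreover have "C * (1 - (\<integral>\<omega>. S R (\<lambda>j. Y j \<omega>) \<partial>N)) \<le> C * (r / (8 * (C + 1)))"
        using R C0 by (intro mult_left_mono) auto
      ultimately show "norm ((\<integral>\<omega>. g (\<lambda>j. X n j \<omega>) \<partial>M n) - (\<integral>\<omega>. g (\<lambda>j. Y j \<omega>) \<partial>N)) < r"
        using est[of "M n" "X n", OF M X] est[of N Y, OF N Y] n1[of n] n h(2) Cr r unfolding real_norm_def by linarith
    qed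
  qed
qed

section \<open>Sums of independent centred variables\<close>

context prob_space
begin

lemma expectation_power_mult_indep:
  fixes X Y :: "'a \<Rightarrow> real"
  assumes indep: "indep_var borel X borel Y"
    and X: "\<And>\<omega>. \<omega> \<in> space M \<Longrightarrow> \<bar>X \<omega>\<bar> \<le> A" and Y: "\<And>\<omega>. \<omega> \<in> space M \<Longrightarrow> \<bar>Y \<omega>\<bar> \<le> B"
  shows "integrable M (\<lambda>\<omega>. X \<omega> ^ a * Y \<omega> ^ b)"
    and "expectation (\<lambda>\<omega>. X \<omega> ^ a * Y \<omega> ^ b) = expectation (\<lambda>\<omega>. X \<omega> ^ a) * expectation (\<lambda>\<omega>. Y \<omega> ^ b)"
proof -
  have [measurable]: "X \<in> borel_measurable M" "Y \<in> borel_measurable M"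
    using indep_var_rv1[OF indep] indep_var_rv2[OF indep] by auto
  have iX: "integrable M (\<lambda>\<omega>. X \<omega> ^ a)"
    by (rule integrable_const_bound[where B="A ^ a"])
      (use X in \<open>auto simp: power_abs intro!: AE_I2 power_mono\<close>)
  have iY: "integrable M (\<lambda>\<omega>. Y \<omega> ^ b)"
    by (rule integrable_const_bound[where B="B ^ b"])
      (use Y in \<open>auto simp: power_abs intro!: AE_I2 power_mono\<close>)
  have "indep_var borel ((\<lambda>x. x ^ a) \<circ> X) borel ((\<lambda>x. x ^ b) \<circ> Y)"
    by (rule indep_var_compose[OF indep]) measurable
  then have ind: "indep_var borel (\<lambda>\<omega>. X \<omega> ^ a) borel (\<lambda>\<omega>. Y \<omega> ^ b)" by (simp add: o_def)
  show "integrable M (\<lambda>\<omega>. X \<omega> ^ a * Y \<omega> ^ b)" by (rule indep_var_integrable[OF ind iX iY])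
  show "expectation (\<lambda>\<omega>. X \<omega> ^ a * Y \<omega> ^ b) = expectation (\<lambda>\<omega>. X \<omega> ^ a) * expectation (\<lambda>\<omega>. Y \<omega> ^ b)"
    by (rule indep_var_lebesgue_integral[OF ind iX iY])
qed

text \<open>Induction on the number of summands. In the expansion of \<open>(y + S) ^ 4\<close> the
  terms with an odd power of \<open>y\<close> and \<open>S\<close> vanish, because one factor has
  mean 0, and the mixed term \<open>6 * E y^2 * E S^2\<close> is the cross term of
  \<open>3 * (E y^2 + E S^2)^2\<close>. The three claims go together because the last one uses mean
  and variance of the partial sum.\<close>

lemma fourth_moment_sum_indep:
  fixes Y :: "'i \<Rightarrow> 'a \<Rightarrow> real"
  assumes "finite I" and "indep_vars (\<lambda>_. borel) Y I"
    and "\<And>i \<omega>. i \<in> I \<Longrightarrow> \<omega> \<in> space M \<Longrightarrow> \<bar>Y i \<omega>\<bar> \<le> 1"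
    and "\<And>i. i \<in> I \<Longrightarrow> expectation (Y i) = 0"
  shows "expectation (\<lambda>\<omega>. \<Sum>i\<in>I. Y i \<omega>) = 0 \<and>
    expectation (\<lambda>\<omega>. (\<Sum>i\<in>I. Y i \<omega>)\<^sup>2) = (\<Sum>i\<in>I. expectation (\<lambda>\<omega>. (Y i \<omega>)\<^sup>2)) \<and>
    expectation (\<lambda>\<omega>. (\<Sum>i\<in>I. Y i \<omega>) ^ 4) \<le>
      3 * (\<Sum>i\<in>I. expectation (\<lambda>\<omega>. (Y i \<omega>)\<^sup>2))\<^sup>2 + (\<Sum>i\<in>I. expectation (\<lambda>\<omega>. (Y i \<omega>) ^ 4))"
  using assms
proof (induction I rule: finite_induct)
  case (insert i I)
  define S where "S \<omega> = (\<Sum>i\<in>I. Y i \<omega>)" for \<omega>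
  define y where "y = Y i"
  have ind: "indep_var borel y borel S"
    unfolding y_def S_def by (rule indep_vars_sum) (use insert in auto)
  have IH: "expectation S = 0" "expectation (\<lambda>\<omega>. (S \<omega>)\<^sup>2) = (\<Sum>i\<in>I. expectation (\<lambda>\<omega>. (Y i \<omega>)\<^sup>2))"
    "expectation (\<lambda>\<omega>. S \<omega> ^ 4) \<le> 3 * (\<Sum>i\<in>I. expectation (\<lambda>\<omega>. (Y i \<omega>)\<^sup>2))\<^sup>2 + (\<Sum>i\<in>I. expectation (\<lambda>\<omega>. (Y i \<omega>) ^ 4))"
    using insert.IH[OF indep_vars_subset[OF insert.prems(1)]] insert.prems(2,3) unfolding S_def by auto
  have y: "\<bar>y \<omega>\<bar> \<le> 1" if "\<omega> \<in> space M" for \<omega> using insert.prems(2)[OF _ that] by (simp add: y_def)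
  have S: "\<bar>S \<omega>\<bar> \<le> real (card I)" if "\<omega> \<in> space M" for \<omega>
  proof -
    have "\<bar>S \<omega>\<bar> \<le> (\<Sum>i\<in>I. \<bar>Y i \<omega>\<bar>)" unfolding S_def by (rule sum_abs)
    also have "\<dots> \<le> (\<Sum>i\<in>I. 1)" by (rule sum_mono) (use insert.prems(2) that in auto)
    finally show ?thesis by simp
  qed
  note m = expectation_power_mult_indep[OF ind y S]
  have Ey: "expectation y = 0" using insert.prems(3) by (simp add: y_def)
  have Ey2: "0 \<le> expectation (\<lambda>\<omega>. (y \<omega>)\<^sup>2)" by simp
  have i1: "integrable M y" "integrable M S" using m(1)[of 1 0] m(1)[of 0 1] by auto
  have sum: "(\<Sum>i\<in>insert i I. Y i \<omega>) = y \<omega> + S \<omega>" for \<omega>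
    using insert.hyps by (simp add: S_def y_def)
  have e1: "expectation (\<lambda>\<omega>. \<Sum>i\<in>insert i I. Y i \<omega>) = 0"
    unfolding sum using i1 Ey IH(1) by simp
  have "expectation (\<lambda>\<omega>. (y \<omega> + S \<omega>)\<^sup>2) =
      expectation (\<lambda>\<omega>. (y \<omega>)^2 * (S \<omega>)^0 + 2 * (y \<omega> ^ 1 * S \<omega> ^ 1) + (y \<omega>)^0 * (S \<omega>)\<^sup>2)"
    by (rule Bochner_Integration.integral_cong) (auto simp: power2_eq_square algebra_simps)
  also have "\<dots> = expectation (\<lambda>\<omega>. (y \<omega>)^2 * (S \<omega>)^0) + 2 * expectation (\<lambda>\<omega>. y \<omega> ^ 1 * S \<omega> ^ 1) +
      expectation (\<lambda>\<omega>. (y \<omega>)^0 * (S \<omega>)\<^sup>2)"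
    by (simp only: m(1) Bochner_Integration.integral_add integrable_mult_right
        Bochner_Integration.integrable_add integral_mult_right_zero)
  also have "\<dots> = expectation (\<lambda>\<omega>. (y \<omega>)\<^sup>2) + expectation (\<lambda>\<omega>. (S \<omega>)\<^sup>2)"
    using m(2)[of 1 1] Ey by simp
  finally have e2: "expectation (\<lambda>\<omega>. (y \<omega> + S \<omega>)\<^sup>2) = expectation (\<lambda>\<omega>. (y \<omega>)\<^sup>2) + expectation (\<lambda>\<omega>. (S \<omega>)\<^sup>2)" .
  have quad: "f + 6 * (p * q) + e \<le> 3 * (p + q)\<^sup>2 + (f + r)" if "e \<le> 3 * q\<^sup>2 + r" for e f p q r :: real
  proof -
    have "3 * (p + q)\<^sup>2 = 3 * p\<^sup>2 + 6 * (p * q) + 3 * q\<^sup>2" by (simp add: power2_sum algebra_simps)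
    then show ?thesis using that zero_le_power2[of p] by linarith
  qed
  have "expectation (\<lambda>\<omega>. (y \<omega> + S \<omega>) ^ 4) =
      expectation (\<lambda>\<omega>. y \<omega> ^ 4 * S \<omega> ^ 0 + 4 * (y \<omega> ^ 3 * S \<omega> ^ 1) + 6 * (y \<omega> ^ 2 * S \<omega> ^ 2) +
        4 * (y \<omega> ^ 1 * S \<omega> ^ 3) + y \<omega> ^ 0 * S \<omega> ^ 4)"
    by (rule Bochner_Integration.integral_cong) (auto simp: eval_nat_numeral algebra_simps)
  also have "\<dots> = expectation (\<lambda>\<omega>. y \<omega> ^ 4 * S \<omega> ^ 0) + 4 * expectation (\<lambda>\<omega>. y \<omega> ^ 3 * S \<omega> ^ 1) +
      6 * expectation (\<lambda>\<omega>. y \<omega> ^ 2 * S \<omega> ^ 2) + 4 * expectation (\<lambda>\<omega>. y \<omega> ^ 1 * S \<omega> ^ 3) +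
      expectation (\<lambda>\<omega>. y \<omega> ^ 0 * S \<omega> ^ 4)"
    by (simp only: m(1) Bochner_Integration.integral_add integrable_mult_right
        Bochner_Integration.integrable_add integral_mult_right_zero)
  also have "\<dots> = expectation (\<lambda>\<omega>. y \<omega> ^ 4) + 6 * (expectation (\<lambda>\<omega>. (y \<omega>)\<^sup>2) * expectation (\<lambda>\<omega>. (S \<omega>)\<^sup>2)) +
      expectation (\<lambda>\<omega>. S \<omega> ^ 4)"
    using m(2)[of 3 1] m(2)[of 2 2] m(2)[of 1 3] Ey IH(1) by simp
  also have "\<dots> \<le> 3 * (expectation (\<lambda>\<omega>. (y \<omega>)\<^sup>2) + expectation (\<lambda>\<omega>. (S \<omega>)\<^sup>2))\<^sup>2 +
      (expectation (\<lambda>\<omega>. y \<omega> ^ 4) + (\<Sum>i\<in>I. expectation (\<lambda>\<omega>. (Y i \<omega>) ^ 4)))"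
    using IH(3) unfolding IH(2)[symmetric] by (rule quad)
  finally have e4: "expectation (\<lambda>\<omega>. (y \<omega> + S \<omega>) ^ 4) \<le>
      3 * (expectation (\<lambda>\<omega>. (y \<omega>)\<^sup>2) + expectation (\<lambda>\<omega>. (S \<omega>)\<^sup>2))\<^sup>2 +
      (expectation (\<lambda>\<omega>. y \<omega> ^ 4) + (\<Sum>i\<in>I. expectation (\<lambda>\<omega>. (Y i \<omega>) ^ 4)))" .
  show ?case using e1 e2 e4 insert.hyps unfolding sum IH(2) by (simp add: y_def)
qed simp

text \<open>By independence both sides are products of factors of modulus at most 1, so their
  distance is at most the sum of the distances of the factors. For \<open>s = E Y^2\<close>,
  Taylor's formula gives \<open>1 - s/2\<close> up to \<open>\<eta> / 6 * s\<close>, and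
  \<open>exp (- s/2)\<close> differs from it by at most \<open>s^2 / 4\<close>, which is at most
  \<open>\<eta> / 4 * s\<close> since \<open>s \<le> \<eta>^2 \<le> \<eta>\<close>.\<close>

lemma char_sum_indep_approx:
  fixes Y :: "'i \<Rightarrow> 'a \<Rightarrow> real"
  assumes I: "finite I" and ind: "indep_vars (\<lambda>_. borel) Y I"
    and b: "\<And>i \<omega>. i \<in> I \<Longrightarrow> \<omega> \<in> space M \<Longrightarrow> \<bar>Y i \<omega>\<bar> \<le> \<eta>" and \<eta>: "\<eta> \<le> 1"
    and 0: "\<And>i. i \<in> I \<Longrightarrow> expectation (Y i) = 0"
  shows "cmod (expectation (\<lambda>\<omega>. iexp (\<Sum>i\<in>I. Y i \<omega>)) -
      complex_of_real (exp (- (\<Sum>i\<in>I. expectation (\<lambda>\<omega>. (Y i \<omega>)\<^sup>2)) / 2)))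
    \<le> \<eta> * (\<Sum>i\<in>I. expectation (\<lambda>\<omega>. (Y i \<omega>)\<^sup>2))"
proof -
  define s where "s i = expectation (\<lambda>\<omega>. (Y i \<omega>)\<^sup>2)" for i
  have meas: "Y i \<in> borel_measurable M" if "i \<in> I" for i
    using ind that by (simp add: indep_vars_def)
  have prod: "expectation (\<lambda>\<omega>. iexp (\<Sum>i\<in>I. Y i \<omega>)) = (\<Prod>i\<in>I. expectation (\<lambda>\<omega>. iexp (Y i \<omega>)))"
  proof -
    have "expectation (\<lambda>\<omega>. iexp (\<Sum>i\<in>I. Y i \<omega>)) = expectation (\<lambda>\<omega>. \<Prod>i\<in>I. iexp (Y i \<omega>))"
      using I by (simp add: exp_sum sum_distrib_left)
    also have "\<dots> = (\<Prod>i\<in>I. expectation (\<lambda>\<omega>. iexp (Y i \<omega>)))"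
    proof (rule indep_vars_lebesgue_integral[OF I])
      show "indep_vars (\<lambda>_. borel) (\<lambda>i \<omega>. iexp (Y i \<omega>)) I"
        by (rule indep_vars_compose2[OF ind]) measurable
      show "integrable M (\<lambda>\<omega>. iexp (Y i \<omega>))" if "i \<in> I" for i
        by (rule integrable_iexp) (use meas[OF that] in simp_all)
    qed
    finally show ?thesis .
  qed
  have s: "complex_of_real (exp (- (\<Sum>i\<in>I. s i) / 2)) = (\<Prod>i\<in>I. complex_of_real (exp (- s i / 2)))"
    using I by (simp add: exp_sum sum_negf[symmetric] sum_divide_distrib flip: of_real_prod)
  have each: "cmod (expectation (\<lambda>\<omega>. iexp (Y i \<omega>)) - complex_of_real (exp (- s i / 2))) \<le> \<eta> * s i"
    if i: "i \<in> I" for i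
  proof -
    note [measurable] = meas[OF i]
    obtain \<omega>0 where "\<omega>0 \<in> space M" using not_empty by blast
    then have \<eta>0: "0 \<le> \<eta>" using b[OF i] abs_ge_zero order_trans by blast
    have pw: "integrable M (\<lambda>\<omega>. Y i \<omega> ^ k)" for k
      by (rule integrable_const_bound[where B="\<eta> ^ k"])
        (use b[OF i] in \<open>auto simp: power_abs intro!: AE_I2 power_mono\<close>)
    have i1: "integrable M (Y i)" using pw[of 1] by simp
    have s0: "0 \<le> s i" by (simp add: s_def)
    have "s i \<le> expectation (\<lambda>\<omega>. \<eta>\<^sup>2)" unfolding s_def
      by (rule integral_mono) (use pw b[OF i] in \<open>auto simp: abs_le_square_iff[symmetric] \<eta>0\<close>)
    then have s1: "s i \<le> \<eta>\<^sup>2" by (simp add: prob_space)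
    have Yc: "integrable M (\<lambda>\<omega>. complex_of_real (Y i \<omega>))" "integrable M (\<lambda>\<omega>. complex_of_real ((Y i \<omega>)\<^sup>2))"
      by (rule integrable_of_real[OF i1], rule integrable_of_real[OF pw])
    have ii: "integrable M (\<lambda>\<omega>. iexp (Y i \<omega>))" by (rule integrable_iexp) measurable
    have eq: "expectation (\<lambda>\<omega>. iexp (Y i \<omega>) - (1 + \<i> * complex_of_real (Y i \<omega>) - complex_of_real ((Y i \<omega>)\<^sup>2) / 2))
        = expectation (\<lambda>\<omega>. iexp (Y i \<omega>)) - (1 - complex_of_real (s i / 2))"
    proof -
      have "expectation (\<lambda>\<omega>. 1 + \<i> * complex_of_real (Y i \<omega>) - complex_of_real ((Y i \<omega>)\<^sup>2) / 2)
          = 1 + \<i> * complex_of_real (expectation (Y i)) - complex_of_real (s i) / 2"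
        using Yc unfolding s_def
        by (subst Bochner_Integration.integral_diff; (subst Bochner_Integration.integral_add)?)
          (auto simp: prob_space simp del: of_real_power)
      then show ?thesis using Yc ii 0[OF i]
        by (subst Bochner_Integration.integral_diff) (auto simp del: of_real_power)
    qed
    have "cmod (expectation (\<lambda>\<omega>. iexp (Y i \<omega>) - (1 + \<i> * complex_of_real (Y i \<omega>) - complex_of_real ((Y i \<omega>)\<^sup>2) / 2)))
        \<le> expectation (\<lambda>\<omega>. \<eta> / 6 * (Y i \<omega>)\<^sup>2)"
    proof (rule order_trans[OF integral_norm_bound], rule integral_mono)
      show "integrable M (\<lambda>\<omega>. cmod (iexp (Y i \<omega>) - (1 + \<i> * complex_of_real (Y i \<omega>) - complex_of_real ((Y i \<omega>)\<^sup>2) / 2)))"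
        using Yc ii by (auto simp del: of_real_power)
      show "integrable M (\<lambda>\<omega>. \<eta> / 6 * (Y i \<omega>)\<^sup>2)" using pw[of 2] by simp
      fix \<omega> assume \<omega>: "\<omega> \<in> space M"
      have "cmod (iexp (Y i \<omega>) - (\<Sum>k\<le>2. (\<i> * Y i \<omega>) ^ k / fact k)) \<le> \<bar>Y i \<omega>\<bar> ^ Suc 2 / fact (Suc 2)"
        by (rule iexp_approx1)
      also have "(\<Sum>k\<le>2. (\<i> * complex_of_real (Y i \<omega>)) ^ k / fact k) =
          1 + \<i> * complex_of_real (Y i \<omega>) - complex_of_real ((Y i \<omega>)\<^sup>2) / 2"
        by (simp add: numeral_2_eq_2 power_mult_distrib algebra_simps)
      also have "\<bar>Y i \<omega>\<bar> ^ Suc 2 / fact (Suc 2) = \<bar>Y i \<omega>\<bar> * (Y i \<omega>)\<^sup>2 / 6"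
        by (simp add: numeral_2_eq_2 fact_numeral)
      also have "\<dots> \<le> \<eta> * (Y i \<omega>)\<^sup>2 / 6"
        using b[OF i \<omega>] by (intro divide_right_mono mult_right_mono) auto
      finally show "cmod (iexp (Y i \<omega>) - (1 + \<i> * complex_of_real (Y i \<omega>) - complex_of_real ((Y i \<omega>)\<^sup>2) / 2))
          \<le> \<eta> / 6 * (Y i \<omega>)\<^sup>2" by simp
    qed
    also have "\<dots> = \<eta> / 6 * s i" by (simp add: s_def)
    finally have A: "cmod (expectation (\<lambda>\<omega>. iexp (Y i \<omega>)) - (1 - complex_of_real (s i / 2))) \<le> \<eta> / 6 * s i"
      unfolding eq .
    define x where "x = s i / 2"
    have x: "0 \<le> x" using s0 by (simp add: x_def)
    have "1 - x \<le> exp (- x)" using exp_ge_add_one_self[of "- x"] by simp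
    \<comment> \<open>From \<open>(1 + x) * (1 - x + x^2) = 1 + x^3\<close>, which is at least
      1.\<close>
    moreover have "exp (- x) \<le> 1 - x + x\<^sup>2"
    proof -
      have "1 \<le> (1 + x) * (1 - x + x\<^sup>2)" using x by (simp add: algebra_simps power2_eq_square)
      also have "\<dots> \<le> exp x * (1 - x + x\<^sup>2)"
      proof (rule mult_right_mono)
        show "0 \<le> 1 - x + x\<^sup>2" using sum_power2_ge_zero[of "x - 1/2" 0] by (simp add: power2_eq_square algebra_simps)
      qed (rule exp_ge_add_one_self)
      finally show ?thesis by (simp add: exp_minus field_simps)
    qed
    ultimately have "\<bar>(1 - x) - exp (- x)\<bar> \<le> x\<^sup>2" by simp
    also have "x\<^sup>2 \<le> \<eta> / 4 * s i"
    proof -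
      have "\<eta>\<^sup>2 \<le> \<eta>" using mult_left_mono[OF \<eta> \<eta>0] by (simp add: power2_eq_square)
      with s1 have "s i \<le> \<eta>" by (rule order_trans)
      then have "s i * s i \<le> \<eta> * s i" using s0 by (rule mult_right_mono)
      then show ?thesis by (simp add: x_def power2_eq_square)
    qed
    finally have "cmod (complex_of_real ((1 - x) - exp (- x))) \<le> \<eta> / 4 * s i" unfolding norm_of_real .
    then have B: "cmod ((1 - complex_of_real (s i / 2)) - complex_of_real (exp (- s i / 2))) \<le> \<eta> / 4 * s i"
      by (simp add: x_def)
    have "cmod (expectation (\<lambda>\<omega>. iexp (Y i \<omega>)) - complex_of_real (exp (- s i / 2))) \<le> \<eta> / 6 * s i + \<eta> / 4 * s i"
      by (rule norm_diff_triangle_le[OF A B])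
    also have "\<dots> \<le> \<eta> * s i" using mult_nonneg_nonneg[OF \<eta>0 s0] by simp
    finally show ?thesis .
  qed
  have "cmod ((\<Prod>i\<in>I. expectation (\<lambda>\<omega>. iexp (Y i \<omega>))) - (\<Prod>i\<in>I. complex_of_real (exp (- s i / 2))))
      \<le> (\<Sum>i\<in>I. cmod (expectation (\<lambda>\<omega>. iexp (Y i \<omega>)) - complex_of_real (exp (- s i / 2))))"
  proof (rule norm_prod_diff)
    fix i assume i: "i \<in> I"
    note [measurable] = meas[OF i]
    have "cmod (expectation (\<lambda>\<omega>. iexp (Y i \<omega>))) \<le> expectation (\<lambda>\<omega>. cmod (iexp (Y i \<omega>)))"
      by (rule integral_norm_bound)
    then show "cmod (expectation (\<lambda>\<omega>. iexp (Y i \<omega>))) \<le> 1" by (simp add: prob_space)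
    have "0 \<le> s i" by (simp add: s_def)
    then show "cmod (complex_of_real (exp (- s i / 2))) \<le> 1" by simp
  qed
  also have "\<dots> \<le> (\<Sum>i\<in>I. \<eta> * s i)" by (rule sum_mono) (rule each)
  finally show ?thesis
    unfolding prod s_def[symmetric] s by (simp only: sum_distrib_left)
qed

text \<open>
  Chaining over dyadic grids with thresholds \<open>R (9/10)\<^sup>l\<close>. The finest level satisfies \<open>2\<^sup>L \<approx> n\<close>;
  inside its cells the one-sided Lipschitz bound takes over.
\<close>

lemma dyadic_chaining:
  fixes Z :: "real \<Rightarrow> 'a \<Rightarrow> real"
  assumes Z: "\<And>t. Z t \<in> borel_measurable M" and n: "1 \<le> n"
    and L: "2 ^ L \<le> n" "n < 2 ^ Suc L" and l0: "l0 < L" and R: "0 < R"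
    and int: "\<And>s t. 0 \<le> s \<Longrightarrow> s \<le> t \<Longrightarrow> t \<le> 1 \<Longrightarrow> integrable M (\<lambda>\<omega>. (Z t \<omega> - Z s \<omega>) ^ 4)"
    and m4: "\<And>s t. 0 \<le> s \<Longrightarrow> s \<le> t \<Longrightarrow> t \<le> 1 \<Longrightarrow>
      expectation (\<lambda>\<omega>. (Z t \<omega> - Z s \<omega>) ^ 4) \<le> 3 * (t - s)\<^sup>2 + (t - s) / real n"
    and mono: "\<And>s t \<omega>. 0 \<le> s \<Longrightarrow> s \<le> t \<Longrightarrow> t \<le> 1 \<Longrightarrow> \<omega> \<in> space M \<Longrightarrow>
      - (sqrt (real n) * (t - s)) \<le> Z t \<omega> - Z s \<omega>"
  shows "\<exists>A\<in>events. 1 - 16 * (4/5) ^ l0 / R ^ 4 \<le> prob A \<and> (\<forall>\<omega>\<in>A. \<forall>t\<in>{0..<1}.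
      \<bar>Z t \<omega> - Z (real (nat \<lfloor>2 ^ l0 * t\<rfloor>) / 2 ^ l0) \<omega>\<bar> \<le> 10 * R * (9/10) ^ l0 + 2 / sqrt (real n))"
proof -
  note Z[measurable]
  \<comment> \<open>The ratio must be below 1 for the thresholds to be summable, and
    \<open>a ^ 4 > 1/2\<close> for the failure probabilities: a level has \<open>2 ^ l\<close>
    cells, each failing with probability of order \<open>(1/4 / a ^ 4) ^ l\<close>. With 9/10 the
    latter base is below 2/5, which leaves \<open>(4/5) ^ l\<close> for the whole level.\<close>
  define a :: real where "a = 9/10"
  define g where "g l t = real (nat \<lfloor>2 ^ l * t\<rfloor>) / 2 ^ l" for l :: nat and t :: real
  define D where "D l i \<omega> = Z (real (Suc i) / 2 ^ l) \<omega> - Z (real i / 2 ^ l) \<omega>" for l i \<omega>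
  define Bad where "Bad l i = {\<omega> \<in> space M. R * a ^ l < \<bar>D l i \<omega>\<bar>}" for l i
  have [measurable]: "D l i \<in> borel_measurable M" for l i unfolding D_def by measurable
  have Bad_sets[measurable]: "Bad l i \<in> events" for l i unfolding Bad_def by measurable
  have a: "0 < a" "a < 1" by (auto simp: a_def)
  have Bad_prob: "prob (Bad l i) \<le> 4 * (2/5) ^ l / R ^ 4" if l: "l \<le> L" and i: "i < 2 ^ l" for l i
  proof -
    have le1: "real (Suc i) / 2 ^ l \<le> 1"
    proof -
      have "real (Suc i) \<le> real (2 ^ l)" using i by (intro of_nat_mono) simp
      then show ?thesis by simp
    qed
    have step: "real (Suc i) / 2 ^ l - real i / 2 ^ l = (1/2) ^ l"
      by (simp add: diff_divide_distrib[symmetric] power_divide)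
    have le: "real i / 2 ^ l \<le> real (Suc i) / 2 ^ l" by (simp add: divide_right_mono)
    \<comment> \<open>Up to level \<open>L\<close> the linear term \<open>(t - s) / n\<close> of the
      fourth moment is no larger than the square of the cell length; on finer levels it would
      dominate, which is why the chaining stops there.\<close>
    have nl: "1 / real n \<le> (1/2) ^ l"
    proof -
      have "(2::nat) ^ l \<le> 2 ^ L" using l by (intro power_increasing) auto
      then have "2 ^ l \<le> n" using L(1) by linarith
      then have "real (2 ^ l) \<le> real n" by (rule of_nat_mono)
      then have "1 / real n \<le> 1 / real (2 ^ l)" by (intro divide_left_mono) (use n in auto)
      then show ?thesis by (simp add: power_divide)
    qed
    have intD: "integrable M (\<lambda>\<omega>. D l i \<omega> ^ 4)" unfolding D_def by (rule int) (use le le1 in auto)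
    have "expectation (\<lambda>\<omega>. D l i \<omega> ^ 4) \<le> 3 * ((1/2) ^ l)\<^sup>2 + (1/2) ^ l / real n"
      unfolding D_def step[symmetric] by (rule m4) (use le le1 in auto)
    also have "\<dots> \<le> 3 * ((1/2) ^ l)\<^sup>2 + (1/2) ^ l * (1/2) ^ l"
      using mult_left_mono[OF nl, of "(1/2) ^ l"] by simp
    also have "\<dots> = 4 * (1/4) ^ l" by (simp add: power2_eq_square power_mult_distrib[symmetric])
    finally have E: "expectation (\<lambda>\<omega>. D l i \<omega> ^ 4) \<le> 4 * (1/4) ^ l" .
    have Ra: "0 < (R * a ^ l) ^ 4" using R a by simp
    have "prob (Bad l i) \<le> prob {\<omega> \<in> space M. (R * a ^ l) ^ 4 \<le> D l i \<omega> ^ 4}"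
    proof (rule finite_measure_mono)
      show "Bad l i \<subseteq> {\<omega> \<in> space M. (R * a ^ l) ^ 4 \<le> D l i \<omega> ^ 4}"
      proof
        fix \<omega> assume "\<omega> \<in> Bad l i"
        then have \<omega>: "\<omega> \<in> space M" "R * a ^ l \<le> \<bar>D l i \<omega>\<bar>" by (auto simp: Bad_def)
        have "(R * a ^ l) ^ 4 \<le> \<bar>D l i \<omega>\<bar> ^ 4" by (rule power_mono[OF \<omega>(2)]) (use R a in simp)
        then show "\<omega> \<in> {\<omega> \<in> space M. (R * a ^ l) ^ 4 \<le> D l i \<omega> ^ 4}"
          using \<omega>(1) by (simp add: power_even_abs)
      qed
    qed measurable
    also have "\<dots> \<le> expectation (\<lambda>\<omega>. D l i \<omega> ^ 4) / (R * a ^ l) ^ 4"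
      by (rule integral_Markov_inequality_measure[OF intD]) (use Ra in \<open>auto simp: zero_le_even_power\<close>)
    also have "\<dots> \<le> 4 * (1/4) ^ l / (R * a ^ l) ^ 4" using Ra by (intro divide_right_mono E) auto
    also have "\<dots> = 4 * ((1/4) / a ^ 4) ^ l / R ^ 4"
      by (simp add: power_mult_distrib power_divide power_mult[symmetric] mult.commute)
    also have "\<dots> \<le> 4 * (2/5) ^ l / R ^ 4"
      using R by (intro divide_right_mono mult_left_mono power_mono) (auto simp: a_def power_divide)
    finally show ?thesis .
  qed
  define A where "A = space M - (\<Union>l\<in>{l0<..L}. \<Union>i\<in>{..<2 ^ l}. Bad l i)"
  have A_sets: "A \<in> events" unfolding A_def by measurable
  have "prob (\<Union>l\<in>{l0<..L}. \<Union>i\<in>{..<2 ^ l}. Bad l i) \<le> (\<Sum>l\<in>{l0<..L}. prob (\<Union>i\<in>{..<2 ^ l}. Bad l i))"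
    by (rule finite_measure_subadditive_finite) auto
  also have "\<dots> \<le> (\<Sum>l\<in>{l0<..L}. 4 * (4/5) ^ l / R ^ 4)"
  proof (rule sum_mono)
    fix l assume l: "l \<in> {l0<..L}"
    have "prob (\<Union>i\<in>{..<2 ^ l}. Bad l i) \<le> (\<Sum>i\<in>{..<2 ^ l}. prob (Bad l i))"
      by (rule finite_measure_subadditive_finite) auto
    also have "\<dots> \<le> (\<Sum>i\<in>{..<(2::nat) ^ l}. 4 * (2/5) ^ l / R ^ 4)"
      by (rule sum_mono) (use l in \<open>auto intro!: Bad_prob\<close>)
    also have "\<dots> = 4 * (2 ^ l * (2/5) ^ l) / R ^ 4" by simp
    also have "2 ^ l * (2/5) ^ l = (4/5::real) ^ l" by (simp add: power_mult_distrib[symmetric])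
    finally show "prob (\<Union>i\<in>{..<2 ^ l}. Bad l i) \<le> 4 * (4/5) ^ l / R ^ 4" .
  qed
  also have "\<dots> = 4 / R ^ 4 * (\<Sum>l\<in>{l0<..L}. (4/5) ^ l)" by (simp add: sum_distrib_left)
  also have "\<dots> \<le> 4 / R ^ 4 * (4 * (4/5) ^ l0)"
  proof (rule mult_left_mono)
    have "(\<Sum>l\<in>{l0<..l}. (4/5::real) ^ l) = 4 * ((4/5) ^ l0 - (4/5) ^ l)" if "l0 \<le> l" for l
      using that
    proof (induction l rule: dec_induct)
      case (step l)
      then have "{l0<..Suc l} = insert (Suc l) {l0<..l}" by auto
      then show ?case using step.IH by simp
    qed simp
    then show "(\<Sum>l\<in>{l0<..L}. (4/5::real) ^ l) \<le> 4 * (4/5) ^ l0" using l0 by simp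
  qed (use R in simp)
  finally have "prob (\<Union>l\<in>{l0<..L}. \<Union>i\<in>{..<2 ^ l}. Bad l i) \<le> 16 * (4/5) ^ l0 / R ^ 4" by simp
  moreover have "prob A = 1 - prob (\<Union>l\<in>{l0<..L}. \<Union>i\<in>{..<2 ^ l}. Bad l i)"
    unfolding A_def by (rule prob_compl) measurable
  ultimately have A_prob: "1 - 16 * (4/5) ^ l0 / R ^ 4 \<le> prob A" by simp
  have "\<bar>Z t \<omega> - Z (g l0 t) \<omega>\<bar> \<le> 10 * R * a ^ l0 + 2 / sqrt (real n)"
    if \<omega>: "\<omega> \<in> A" and t: "t \<in> {0..<1}" for \<omega> t
  proof -
    have \<omega>s: "\<omega> \<in> space M" using \<omega> by (simp add: A_def)
    have good: "\<bar>D l i \<omega>\<bar> \<le> R * a ^ l" if "l \<in> {l0<..L}" "i < 2 ^ l" for l i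
      using \<omega> that by (force simp: A_def Bad_def not_less)
    define i where "i l = nat \<lfloor>2 ^ l * t\<rfloor>" for l
    have il: "real (i l) \<le> 2 ^ l * t" "2 ^ l * t < real (i l) + 1" for l
    proof -
      have "real (i l) = real_of_int \<lfloor>2 ^ l * t\<rfloor>" using t by (simp add: i_def)
      then show "real (i l) \<le> 2 ^ l * t" "2 ^ l * t < real (i l) + 1" by linarith+
    qed
    have i_less: "i l < 2 ^ l" for l
    proof -
      have "real (i l) < 2 ^ l" using il(1)[of l] t by (smt (verit) atLeastLessThan_iff mult_less_cancel_left2 zero_less_power)
      then show ?thesis by (simp add: of_nat_less_iff[symmetric] del: of_nat_less_iff)
    qed
    have g_eq: "g l t = real (i l) / 2 ^ l" for l by (simp add: g_def i_def)
    \<comment> \<open>One level down, the left end of the cell containing \<open>t\<close> either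
      stays or moves by one cell of the new level. For \<open>a = 9/10\<close> the threshold
      \<open>R * a ^ Suc l\<close> equals \<open>9 * R * (a ^ l - a ^ Suc l)\<close>, so the bounds
      telescope.\<close>
    have chain: "\<bar>Z (g l t) \<omega> - Z (g l0 t) \<omega>\<bar> \<le> 9 * R * (a ^ l0 - a ^ l)" if "l0 \<le> l" "l \<le> L" for l
      using that
    proof (induction l rule: dec_induct)
      case (step l)
      have "i (Suc l) = 2 * i l \<or> i (Suc l) = Suc (2 * i l)"
      proof -
        have "real (i (Suc l)) < 2 * real (i l) + 2" "2 * real (i l) < real (i (Suc l)) + 1"
          using il[of l] il[of "Suc l"] by auto
        then show ?thesis by linarith
      qed
      then have "\<bar>Z (g (Suc l) t) \<omega> - Z (g l t) \<omega>\<bar> \<le> R * a ^ Suc l"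
      proof
        assume "i (Suc l) = 2 * i l"
        then have "g (Suc l) t = g l t" by (simp add: g_eq)
        then show ?thesis using R a by simp
      next
        assume e: "i (Suc l) = Suc (2 * i l)"
        then have "Z (g (Suc l) t) \<omega> - Z (g l t) \<omega> = D (Suc l) (2 * i l) \<omega>"
          by (simp add: g_eq D_def)
        moreover have "2 * i l < 2 ^ Suc l" using i_less[of l] by simp
        ultimately show ?thesis using good[of "Suc l" "2 * i l"] step by simp
      qed
      moreover have "R * a ^ Suc l = 9 * R * (a ^ l - a ^ Suc l)" by (simp add: a_def)
      moreover have "\<bar>Z (g l t) \<omega> - Z (g l0 t) \<omega>\<bar> \<le> 9 * R * (a ^ l0 - a ^ l)"
        using step by simp
      ultimately show ?case unfolding right_diff_distrib by linarith
    qed (simp add: R)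
    \<comment> \<open>\<open>u\<close> and \<open>v\<close> are the ends of the finest cell around
      \<open>t\<close>. The one-sided bound from \<open>u\<close> to \<open>t\<close> limits
      \<open>Z t\<close> from below; the one from \<open>t\<close> to \<open>v\<close>, together
      with the good increment over the cell, limits it from above. This adds one multiple of
      \<open>R * a ^ l0\<close> to the nine from the chain.\<close>
    define u where "u = g L t"
    define v where "v = real (Suc (i L)) / 2 ^ L"
    have u: "u = real (i L) / 2 ^ L" by (simp add: u_def g_def i_def)
    have uv: "u \<le> t" "t \<le> v" "v - u = 1 / 2 ^ L" "0 \<le> u" "v \<le> 1"
    proof -
      show "u \<le> t" "t \<le> v" using il[of L] unfolding u v_def by (auto simp: field_simps)
      show "v - u = 1 / 2 ^ L" unfolding u v_def by (simp add: diff_divide_distrib[symmetric])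
      show "0 \<le> u" by (simp add: u)
      have "real (Suc (i L)) \<le> real (2 ^ L)" using i_less[of L] by (intro of_nat_mono) simp
      then show "v \<le> 1" unfolding v_def by simp
    qed
    \<comment> \<open>This uses that \<open>L\<close> is the largest level with
      \<open>2 ^ L \<le> n\<close>: a finest cell is shorter than \<open>2 / n\<close>.\<close>
    have sq: "sqrt (real n) * (1 / 2 ^ L) \<le> 2 / sqrt (real n)"
    proof -
      have "real n < real (2 ^ Suc L)" using L(2) by (rule of_nat_less_iff[THEN iffD2])
      then have "sqrt (real n) * sqrt (real n) \<le> 2 * 2 ^ L" by simp
      then show ?thesis using n by (simp add: field_simps)
    qed
    have small: "sqrt (real n) * x \<le> 2 / sqrt (real n)" if "x \<le> 1 / 2 ^ L" for x
      by (rule order_trans[OF mult_left_mono[OF that] sq]) simp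
    have lo: "- (2 / sqrt (real n)) \<le> Z t \<omega> - Z u \<omega>"
      using mono[of u t \<omega>] small[of "t - u"] uv t \<omega>s by simp
    have top: "Z v \<omega> - Z u \<omega> \<le> R * a ^ l0"
    proof -
      have "\<bar>D L (i L) \<omega>\<bar> \<le> R * a ^ L" using l0 i_less by (intro good) auto
      also have "\<dots> \<le> R * a ^ l0" using R a l0 by (intro mult_left_mono power_decreasing) auto
      finally show ?thesis by (simp add: D_def u v_def)
    qed
    have hi: "Z t \<omega> - Z u \<omega> \<le> R * a ^ l0 + 2 / sqrt (real n)"
      using mono[of t v \<omega>] small[of "v - t"] uv t \<omega>s top by simp
    have "\<bar>Z u \<omega> - Z (g l0 t) \<omega>\<bar> \<le> 9 * R * (a ^ l0 - a ^ L)"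
      unfolding u_def by (rule chain) (use l0 in auto)
    moreover have "9 * R * (a ^ l0 - a ^ L) \<le> 9 * R * a ^ l0" using R a by (intro mult_left_mono) auto
    moreover have "0 \<le> R * a ^ l0" using R a by simp
    ultimately show ?thesis using lo hi unfolding abs_le_iff by linarith
  qed
  then show ?thesis using A_sets A_prob unfolding g_def a_def by blast
qed

end

section \<open>Components, edges and cycles\<close>

definition edge_rel :: "nat set set \<Rightarrow> (nat \<times> nat) set" where
  "edge_rel E = {(i, j). {i, j} \<in> E}"

text \<open>The edges that are not bridges. An edge that closes a cycle when it is inserted is one
  of them from then on, so their number bounds the excess.\<close>

definition cyclic_edges :: "nat set set \<Rightarrow> nat set set" where
  "cyclic_edges E = {e \<in> E. \<exists>i j. i \<noteq> j \<and> e = {i, j} \<and> (i, j) \<in> (edge_rel (E - {e}))\<^sup>*}"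

lemma edge_rel_mono: "E \<subseteq> F \<Longrightarrow> edge_rel E \<subseteq> edge_rel F"
  unfolding edge_rel_def by auto

lemma sym_edge_rel: "sym (edge_rel E)"
  unfolding edge_rel_def sym_def by (auto simp: insert_commute)

lemma cyclic_edges_mono: "E \<subseteq> F \<Longrightarrow> cyclic_edges E \<subseteq> cyclic_edges F"
proof
  fix e assume EF: "E \<subseteq> F" and "e \<in> cyclic_edges E"
  then obtain i j where ij: "e \<in> E" "i \<noteq> j" "e = {i, j}" "(i, j) \<in> (edge_rel (E - {e}))\<^sup>*"
    by (auto simp: cyclic_edges_def)
  have "(edge_rel (E - {e}))\<^sup>* \<subseteq> (edge_rel (F - {e}))\<^sup>*"
    by (intro rtrancl_mono edge_rel_mono) (use EF in auto)
  then show "e \<in> cyclic_edges F" using ij EF by (auto simp: cyclic_edges_def)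
qed

lemma connected_in_eq: "connected_in (V, E) = (edge_rel E)\<^sup>* \<inter> V \<times> V"
  by (auto simp: connected_in_def edge_rel_def)

lemma equiv_connected_in: "equiv V (connected_in (V, E))"
proof -
  have "sym ((edge_rel E)\<^sup>*)" by (rule sym_rtrancl[OF sym_edge_rel])
  then show ?thesis
    unfolding connected_in_eq by (intro equivI refl_onI symI transI) (auto dest: symD rtrancl_trans)
qed

text \<open>A walk can be shortened so that it crosses the new edge at most once, in one of the two
  directions.\<close>

lemma rtrancl_insert_edge:
  "(x, y) \<in> (edge_rel (insert {i, j} E))\<^sup>* \<longleftrightarrow>
     (x, y) \<in> (edge_rel E)\<^sup>* \<or>
     (x, i) \<in> (edge_rel E)\<^sup>* \<and> (j, y) \<in> (edge_rel E)\<^sup>* \<or> (x, j) \<in> (edge_rel E)\<^sup>* \<and> (i, y) \<in> (edge_rel E)\<^sup>*"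
proof -
  have "edge_rel (insert {i, j} E) = insert (j, i) (insert (i, j) (edge_rel E))"
    by (auto simp: edge_rel_def doubleton_eq_iff)
  then show ?thesis
    by (simp add: rtrancl_insert) (meson rtrancl_trans)
qed

text \<open>If the ends were already connected, the relation does not change. Otherwise their two
  classes are replaced by their union, which was not a class before, and all other classes
  remain.\<close>

lemma num_components_insert:
  assumes V: "finite V" and ij: "i \<in> V" "j \<in> V"
  shows "(i, j) \<in> (edge_rel E)\<^sup>* \<Longrightarrow> num_components (V, insert {i, j} E) = num_components (V, E)"
    and "(i, j) \<notin> (edge_rel E)\<^sup>* \<Longrightarrow> Suc (num_components (V, insert {i, j} E)) = num_components (V, E)"
proof -
  let ?r = "connected_in (V, E)" and ?r' = "connected_in (V, insert {i, j} E)"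
  have eqv: "equiv V ?r" "equiv V ?r'" by (rule equiv_connected_in)+
  have sy: "(x, y) \<in> (edge_rel E)\<^sup>* \<Longrightarrow> (y, x) \<in> (edge_rel E)\<^sup>*" for x y
    using sym_rtrancl[OF sym_edge_rel] by (rule symD)
  show "num_components (V, insert {i, j} E) = num_components (V, E)" if c: "(i, j) \<in> (edge_rel E)\<^sup>*"
  proof -
    have "(x, y) \<in> (edge_rel (insert {i, j} E))\<^sup>* \<longleftrightarrow> (x, y) \<in> (edge_rel E)\<^sup>*" for x y
      unfolding rtrancl_insert_edge using c sy[OF c] by (meson rtrancl_trans)
    then have "?r' = ?r" unfolding connected_in_eq by auto
    then show ?thesis by (simp add: num_components_def)
  qed
  show "Suc (num_components (V, insert {i, j} E)) = num_components (V, E)" if nc: "(i, j) \<notin> (edge_rel E)\<^sup>*"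
  proof -
    let ?A = "?r `` {i}" and ?B = "?r `` {j}"
    have AB: "?A \<in> V // ?r" "?B \<in> V // ?r" using ij by (auto simp: quotient_def)
    have ne: "?A \<noteq> ?B"
    proof
      assume "?A = ?B"
      then have "(i, j) \<in> ?r" using eq_equiv_class_iff[OF eqv(1) ij] by simp
      then show False using nc by (simp add: connected_in_eq)
    qed
    have cls: "?r' `` {x} = (if x \<in> ?A \<union> ?B then ?A \<union> ?B else ?r `` {x})" if x: "x \<in> V" for x
    proof -
      have "y \<in> ?r' `` {x} \<longleftrightarrow> y \<in> (if x \<in> ?A \<union> ?B then ?A \<union> ?B else ?r `` {x})" for y
        using x ij unfolding connected_in_eq
        by (auto simp: rtrancl_insert_edge intro: sy rtrancl_trans dest: sy)
      then show ?thesis by blast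
    qed
    have inA: "x \<in> ?A \<longleftrightarrow> ?r `` {x} = ?A" if "x \<in> V" for x
      using that ij equiv_class_eq_iff[OF eqv(1), of i x] by auto
    have inB: "x \<in> ?B \<longleftrightarrow> ?r `` {x} = ?B" if "x \<in> V" for x
      using that ij equiv_class_eq_iff[OF eqv(1), of j x] by auto
    have q': "V // ?r' = insert (?A \<union> ?B) (V // ?r - {?A, ?B})"
    proof (intro equalityI subsetI)
      fix C assume "C \<in> V // ?r'"
      then obtain x where x: "x \<in> V" "C = ?r' `` {x}" by (auto simp: quotient_def)
      show "C \<in> insert (?A \<union> ?B) (V // ?r - {?A, ?B})"
      proof (cases "x \<in> ?A \<union> ?B")
        case True
        then show ?thesis using x cls by simp
      next
        case False
        then have "C = ?r `` {x}" "?r `` {x} \<noteq> ?A" "?r `` {x} \<noteq> ?B"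
          using x cls inA[OF x(1)] inB[OF x(1)] by auto
        moreover have "?r `` {x} \<in> V // ?r" using x(1) by (rule quotientI)
        ultimately show ?thesis by simp
      qed
    next
      fix C assume C: "C \<in> insert (?A \<union> ?B) (V // ?r - {?A, ?B})"
      show "C \<in> V // ?r'"
      proof (cases "C = ?A \<union> ?B")
        case True
        have "i \<in> ?A" using equiv_class_self[OF eqv(1) ij(1)] .
        then have "C = ?r' `` {i}" using True cls[OF ij(1)] by simp
        then show ?thesis using ij(1) by (auto intro: quotientI)
      next
        case False
        then obtain x where x: "x \<in> V" "C = ?r `` {x}" "C \<noteq> ?A" "C \<noteq> ?B"
          using C by (auto simp: quotient_def)
        then have "x \<notin> ?A \<union> ?B" using inA[OF x(1)] inB[OF x(1)] by auto
        then have "C = ?r' `` {x}" using x cls[OF x(1)] by simp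
        then show ?thesis using x(1) by (auto intro: quotientI)
      qed
    qed
    have fin: "finite (V // ?r)"
      by (rule finite_quotient[OF V]) (auto simp: connected_in_eq)
    have "?A \<union> ?B \<notin> V // ?r"
    proof
      assume AB': "?A \<union> ?B \<in> V // ?r"
      have "i \<in> ?A" "j \<in> ?B" using equiv_class_self[OF eqv(1)] ij by auto
      then have "?A \<union> ?B = ?A" "?A \<union> ?B = ?B"
        using quotient_disj[OF eqv(1) AB' AB(1)] quotient_disj[OF eqv(1) AB' AB(2)] by auto
      then show False using ne by simp
    qed
    then have "card (V // ?r') = Suc (card (V // ?r - {?A, ?B}))"
      unfolding q' using fin by (subst card_insert_disjoint) auto
    moreover have "card (V // ?r - {?A, ?B}) = card (V // ?r) - 2"
      using AB ne fin by (subst card_Diff_subset) auto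
    moreover have "card {?A, ?B} \<le> card (V // ?r)" by (rule card_mono[OF fin]) (use AB in auto)
    ultimately show ?thesis using ne by (simp add: num_components_def)
  qed
qed

text \<open>Insert the edges one by one. An edge between two components lowers their number by one,
  which balances the edge count. Any other edge raises the sum by one but is itself a new
  non-bridge, and by monotonicity no earlier non-bridge is lost.\<close>

lemma num_components_bounds:
  assumes V: "finite V" and E: "finite E"
    and edges: "\<And>e. e \<in> E \<Longrightarrow> \<exists>i j. e = {i, j} \<and> i \<noteq> j \<and> i \<in> V \<and> j \<in> V"
  shows "card V \<le> num_components (V, E) + card E \<and>
    num_components (V, E) + card E \<le> card V + card (cyclic_edges E)"
  using E edges
proof (induction E rule: finite_induct)
  case empty
  have "edge_rel {} = {}" by (auto simp: edge_rel_def)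
  then have "connected_in (V, {}) = Id_on V" by (auto simp: connected_in_eq)
  then have "V // connected_in (V, {}) = (\<lambda>x. {x}) ` V" by (auto simp: quotient_def)
  then have "num_components (V, {}) = card V" by (simp add: num_components_def card_image)
  then show ?case by simp
next
  case (insert e E)
  obtain i j where ij: "e = {i, j}" "i \<noteq> j" "i \<in> V" "j \<in> V" using insert.prems by blast
  have IH: "card V \<le> num_components (V, E) + card E"
    "num_components (V, E) + card E \<le> card V + card (cyclic_edges E)"
    using insert.IH insert.prems by auto
  have fin: "finite (cyclic_edges (insert e E))"
    using insert.hyps(1) by (auto simp: cyclic_edges_def)
  show ?case
  proof (cases "(i, j) \<in> (edge_rel E)\<^sup>*")
    case True
    have "insert e E - {e} = E" using insert.hyps(2) by auto
    then have "e \<in> cyclic_edges (insert e E)" using True ij by (auto simp: cyclic_edges_def)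
    moreover have "e \<notin> cyclic_edges E" using insert.hyps(2) by (auto simp: cyclic_edges_def)
    moreover have "cyclic_edges E \<subseteq> cyclic_edges (insert e E)" by (rule cyclic_edges_mono) auto
    ultimately have "card (insert e (cyclic_edges E)) \<le> card (cyclic_edges (insert e E))"
      by (intro card_mono fin) auto
    moreover have "finite (cyclic_edges E)" using insert.hyps(1) by (auto simp: cyclic_edges_def)
    ultimately have "Suc (card (cyclic_edges E)) \<le> card (cyclic_edges (insert e E))"
      using \<open>e \<notin> cyclic_edges E\<close> by simp
    then show ?thesis
      using IH num_components_insert(1)[OF V ij(3,4) True] insert.hyps ij(1) by simp
  next
    case False
    have "card (cyclic_edges E) \<le> card (cyclic_edges (insert e E))"
      by (intro card_mono fin cyclic_edges_mono) auto
    then show ?thesis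
      using IH num_components_insert(2)[OF V ij(3,4) False] insert.hyps ij(1) by simp
  qed
qed

section \<open>Cycles as injective vertex sequences\<close>

text \<open>
  A cycle of length \<open>k\<close> is encoded by the extensional map of its successive vertices; the edges are
  \<open>{f i, f ((i + 1) mod k)}\<close>.
\<close>

definition cycle_edge :: "nat \<Rightarrow> (nat \<Rightarrow> nat) \<Rightarrow> nat \<Rightarrow> nat set" where
  "cycle_edge k f i = {f i, f (Suc i mod k)}"

definition vertex_cycles :: "nat set \<Rightarrow> nat \<Rightarrow> (nat \<Rightarrow> nat) set" where
  "vertex_cycles V k = {f \<in> {..<k} \<rightarrow>\<^sub>E V. inj_on f {..<k}}"

text \<open>When the next vertex has been visited before, the path is cut back to that visit;
  otherwise it is extended.\<close>

lemma rtrancl_distinct_path: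
  assumes "(x, y) \<in> r\<^sup>*"
  shows "\<exists>xs. xs \<noteq> [] \<and> hd xs = x \<and> last xs = y \<and> distinct xs \<and>
    (\<forall>i. Suc i < length xs \<longrightarrow> (xs ! i, xs ! Suc i) \<in> r)"
  using assms
proof (induction rule: rtrancl_induct)
  case base
  then show ?case by (intro exI[of _ "[x]"]) auto
next
  case (step y z)
  then obtain xs where xs: "xs \<noteq> []" "hd xs = x" "last xs = y" "distinct xs"
    "\<And>i. Suc i < length xs \<Longrightarrow> (xs ! i, xs ! Suc i) \<in> r" by blast
  show ?case
  proof (cases "z \<in> set xs")
    case True
    then obtain k where k: "k < length xs" "xs ! k = z" by (auto simp: in_set_conv_nth)
    show ?thesis
    proof (intro exI[of _ "take (Suc k) xs"] conjI allI impI)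
      show "hd (take (Suc k) xs) = x" using xs by (cases xs) auto
      show "last (take (Suc k) xs) = z" using k by (simp add: take_Suc_conv_app_nth)
    qed (use xs k in auto)
  next
    case False
    show ?thesis
    proof (intro exI[of _ "xs @ [z]"] conjI allI impI)
      fix i assume i: "Suc i < length (xs @ [z])"
      show "((xs @ [z]) ! i, (xs @ [z]) ! Suc i) \<in> r"
      proof (cases "Suc i < length xs")
        case True then show ?thesis using xs(5) by (simp add: nth_append)
      next
        case False
        then have "i = length xs - 1" "Suc i = length xs" using i by auto
        then show ?thesis using xs(1,3) step.hyps by (simp add: nth_append last_conv_nth)
      qed
    qed (use xs False in auto)
  qed
qed

text \<open>A simple path between the ends of \<open>e\<close> that avoids \<open>e\<close> is
  closed up by \<open>e\<close> as the last edge of the cycle. Its length is at least 3, because a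
  path with two vertices would consist of \<open>e\<close> itself.\<close>

lemma cyclic_edge_cycle:
  assumes E: "\<And>e. e \<in> E \<Longrightarrow> e \<subseteq> V" and e: "e \<in> cyclic_edges E"
  shows "\<exists>k f. 3 \<le> k \<and> f \<in> vertex_cycles V k \<and> (\<forall>i<k. cycle_edge k f i \<in> E) \<and> cycle_edge k f (k - 1) = e"
proof -
  obtain i j where ij: "e \<in> E" "i \<noteq> j" "e = {i, j}" "(i, j) \<in> (edge_rel (E - {e}))\<^sup>*"
    using e by (auto simp: cyclic_edges_def)
  obtain xs where xs: "xs \<noteq> []" "hd xs = i" "last xs = j" "distinct xs"
    "\<And>l. Suc l < length xs \<Longrightarrow> (xs ! l, xs ! Suc l) \<in> edge_rel (E - {e})"
    using rtrancl_distinct_path[OF ij(4)] by blast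
  define k where "k = length xs"
  have x0: "xs ! 0 = i" using xs by (simp add: hd_conv_nth)
  have xl: "xs ! (k - 1) = j" using xs by (simp add: last_conv_nth k_def)
  have "k \<noteq> 0" using xs(1) by (simp add: k_def)
  moreover have "k \<noteq> 1" using x0 xl ij(2) by auto
  moreover have "k \<noteq> 2"
  proof
    assume k: "k = 2"
    then have "(xs ! 0, xs ! 1) \<in> edge_rel (E - {e})" using xs(5)[of 0] by (simp add: k_def)
    then show False using x0 xl k ij(3) by (auto simp: edge_rel_def)
  qed
  ultimately have k3: "3 \<le> k" by linarith
  define f where "f = restrict (nth xs) {..<k}"
  have edge: "cycle_edge k f l \<in> E" if l: "l < k - 1" for l
  proof -
    have "(xs ! l, xs ! Suc l) \<in> edge_rel (E - {e})" using l by (intro xs(5)) (simp add: k_def)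
    moreover have "Suc l < k" using l by simp
    then have "cycle_edge k f l = {xs ! l, xs ! Suc l}" by (simp add: cycle_edge_def f_def)
    ultimately show ?thesis by (auto simp: edge_rel_def)
  qed
  have last: "cycle_edge k f (k - 1) = e"
    using k3 x0 xl ij(3) by (simp add: cycle_edge_def f_def insert_commute)
  have all: "cycle_edge k f l \<in> E" if "l < k" for l
    using that edge[of l] last ij(1) by (cases "l = k - 1") auto
  have "f l \<in> V" if "l < k" for l
    using E[OF all[OF that]] by (auto simp: cycle_edge_def)
  then have "f \<in> {..<k} \<rightarrow>\<^sub>E V" by (auto simp: f_def)
  moreover have "inj_on f {..<k}"
    using xs(4) by (auto simp: inj_on_def f_def k_def nth_eq_iff_index_eq)
  ultimately have "f \<in> vertex_cycles V k" by (simp add: vertex_cycles_def)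
  then show ?thesis using k3 all last by blast
qed

lemma vertex_cycles_empty:
  assumes "finite V" "card V < k"
  shows "vertex_cycles V k = {}"
proof -
  have False if "f \<in> {..<k} \<rightarrow>\<^sub>E V" "inj_on f {..<k}" for f
  proof -
    have "card (f ` {..<k}) \<le> card V" using that assms(1) by (intro card_mono) auto
    then show False using card_image[OF that(2)] assms(2) by simp
  qed
  then show ?thesis by (auto simp: vertex_cycles_def)
qed

lemma finite_vertex_cycles: "finite V \<Longrightarrow> finite (vertex_cycles V k)"
  unfolding vertex_cycles_def by (rule finite_subset[of _ "{..<k} \<rightarrow>\<^sub>E V"]) (auto intro: finite_PiE)

text \<open>Every non-bridge is the last edge of some cycle in the graph, so the map from cycles to
  last edges covers them. A cycle is counted several times on the right, which only weakens the
  bound.\<close>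

lemma card_cyclic_edges_le:
  assumes V: "finite V" and E: "\<And>e. e \<in> E \<Longrightarrow> e \<subseteq> V"
  shows "card (cyclic_edges E) \<le>
    card (SIGMA k:{3..card V}. {f \<in> vertex_cycles V k. \<forall>i<k. cycle_edge k f i \<in> E})"
proof -
  let ?C = "SIGMA k:{3..card V}. {f \<in> vertex_cycles V k. \<forall>i<k. cycle_edge k f i \<in> E}"
  have fin: "finite ?C" using finite_vertex_cycles[OF V] by (intro finite_SigmaI) auto
  have "cyclic_edges E \<subseteq> (\<lambda>(k, f). cycle_edge k f (k - 1)) ` ?C"
  proof
    fix e assume "e \<in> cyclic_edges E"
    from cyclic_edge_cycle[OF E this] obtain k f where
      kf: "3 \<le> k" "f \<in> vertex_cycles V k" "\<forall>i<k. cycle_edge k f i \<in> E" "cycle_edge k f (k - 1) = e" by blast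
    have "k \<le> card V" using vertex_cycles_empty[OF V, of k] kf(2) by (metis empty_iff not_le)
    then have "(k, f) \<in> ?C" using kf by auto
    then show "e \<in> (\<lambda>(k, f). cycle_edge k f (k - 1)) ` ?C" using kf(4) by force
  qed
  then have "card (cyclic_edges E) \<le> card ((\<lambda>(k, f). cycle_edge k f (k - 1)) ` ?C)"
    by (rule card_mono[OF finite_imageI[OF fin]])
  also have "\<dots> \<le> card ?C" by (rule card_image_le[OF fin])
  finally show ?thesis .
qed

text \<open>Needed to apply independence to \<open>k\<close> different clocks. Two positions giving
  the same edge in opposite directions would be successors of each other modulo \<open>k\<close>,
  which forces \<open>k \<le> 2\<close>.\<close>

lemma inj_on_cycle_edge:
  assumes k: "3 \<le> k" and f: "inj_on f {..<k}"
  shows "inj_on (cycle_edge k f) {..<k}"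
proof (rule inj_onI)
  fix a b assume ab: "a \<in> {..<k}" "b \<in> {..<k}" and eq: "cycle_edge k f a = cycle_edge k f b"
  have k0: "0 < k" using k by simp
  have fi: "f x = f y \<longleftrightarrow> x = y" if "x < k" "y < k" for x y
    using inj_on_eq_iff[OF f] that by simp
  have m: "Suc a mod k < k" "Suc b mod k < k" using k0 by auto
  have "a = b \<or> a = Suc b mod k \<and> Suc a mod k = b"
    using eq ab fi m unfolding cycle_edge_def by (auto simp: doubleton_eq_iff)
  then show "a = b"
  proof
    assume *: "a = Suc b mod k \<and> Suc a mod k = b"
    have ma: "Suc a mod k = (if Suc a = k then 0 else Suc a)" using ab by auto
    have mb: "Suc b mod k = (if Suc b = k then 0 else Suc b)" using ab by auto
    show ?thesis using * k unfolding ma mb by (auto split: if_splits)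
  qed
qed

text \<open>Every vertex of a cycle lies on two of its edges; formally, the cyclic shift permutes
  the positions. Hence the rates along a cycle multiply to a product of squared masses.\<close>

lemma prod_cycle:
  fixes g :: "nat \<Rightarrow> real"
  assumes k: "0 < k"
  shows "(\<Prod>i<k. g (f i) * g (f (Suc i mod k))) = (\<Prod>i<k. (g (f i))\<^sup>2)"
proof -
  have "bij_betw (\<lambda>i. Suc i mod k) {..<k} {..<k}"
  proof (rule bij_betw_byWitness[where f'="\<lambda>i. (i + (k - 1)) mod k"])
    show "\<forall>a\<in>{..<k}. (Suc a mod k + (k - 1)) mod k = a"
    proof
      fix a assume a: "a \<in> {..<k}"
      have "(Suc a mod k + (k - 1)) mod k = (Suc a + (k - 1)) mod k" by (rule mod_add_left_eq)
      also have "Suc a + (k - 1) = a + k" using k by simp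
      finally show "(Suc a mod k + (k - 1)) mod k = a" using a by simp
    qed
    show "\<forall>a\<in>{..<k}. Suc ((a + (k - 1)) mod k) mod k = a"
    proof
      fix a assume a: "a \<in> {..<k}"
      have "Suc ((a + (k - 1)) mod k) mod k = Suc (a + (k - 1)) mod k" by (rule mod_Suc_eq)
      also have "Suc (a + (k - 1)) = a + k" using k by simp
      finally show "Suc ((a + (k - 1)) mod k) mod k = a" using a by simp
    qed
  qed (use k in auto)
  then have "(\<Prod>i<k. g (f (Suc i mod k))) = (\<Prod>i<k. g (f i))"
    by (rule prod.reindex_bij_betw)
  then show ?thesis by (simp add: prod.distrib power2_eq_square)
qed

section \<open>The multiplicative graph process\<close>

text \<open>The square of the sum runs over ordered pairs: those below and above the diagonal each
  give the sum over edges, and the diagonal gives the squares. Applied to the masses and to their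
  squares.\<close>

lemma sum_potential_edges:
  fixes z w :: "nat \<Rightarrow> real"
  assumes fin: "finite {i. 0 < z i}"
  shows "2 * (\<Sum>e\<in>potential_edges z. \<Prod>i\<in>e. w i) = (\<Sum>i | 0 < z i. w i)\<^sup>2 - (\<Sum>i | 0 < z i. (w i)\<^sup>2)"
proof -
  let ?V = "{i. 0 < z i}"
  define L where "L = {(i, j). i \<in> ?V \<and> j \<in> ?V \<and> i < j}"
  define G where "G = {(i, j). i \<in> ?V \<and> j \<in> ?V \<and> j < i}"
  define D where "D = (\<lambda>i. (i, i)) ` ?V"
  have finite_VV: "finite (?V \<times> ?V)" using fin by auto
  have finite_LG: "finite L" "finite G" "finite D"
    by (rule finite_subset[OF _ finite_VV]; auto simp: L_def G_def D_def)+
  have P: "potential_edges z = (\<lambda>(i, j). {i, j}) ` L"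
  proof (intro equalityI subsetI)
    fix e assume "e \<in> potential_edges z"
    then obtain i j where ij: "e = {i, j}" "i \<noteq> j" "0 < z i" "0 < z j" by (auto simp: potential_edges_def)
    show "e \<in> (\<lambda>(i, j). {i, j}) ` L"
    proof (cases "i < j")
      case True then show ?thesis using ij by (auto simp: L_def)
    next
      case False
      then have "(j, i) \<in> L" "e = {j, i}" using ij by (auto simp: L_def)
      then show ?thesis by force
    qed
  qed (auto simp: potential_edges_def L_def)
  have "inj_on (\<lambda>(i, j). {i, j}) L" by (auto simp: inj_on_def L_def doubleton_eq_iff)
  then have "(\<Sum>e\<in>potential_edges z. \<Prod>i\<in>e. w i) = (\<Sum>p\<in>L. \<Prod>i\<in>(case p of (i, j) \<Rightarrow> {i, j}). w i)"
    unfolding P by (rule sum.reindex_cong[OF _ refl refl])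
  also have "\<dots> = (\<Sum>(i, j)\<in>L. w i * w j)" by (rule sum.cong) (auto simp: L_def)
  finally have L: "(\<Sum>e\<in>potential_edges z. \<Prod>i\<in>e. w i) = (\<Sum>(i, j)\<in>L. w i * w j)" .
  have "bij_betw prod.swap L G" by (rule bij_betwI[where g=prod.swap]) (auto simp: L_def G_def)
  then have G: "(\<Sum>(i, j)\<in>G. w i * w j) = (\<Sum>(i, j)\<in>L. w i * w j)"
    by (subst sum.reindex_bij_betw[symmetric, where h=prod.swap and S=L]) (auto simp: case_prod_beta mult.commute)
  have D: "(\<Sum>(i, j)\<in>D. w i * w j) = (\<Sum>i\<in>?V. (w i)\<^sup>2)"
    unfolding D_def by (subst sum.reindex) (auto simp: inj_on_def power2_eq_square)
  have "(\<Sum>i\<in>?V. w i)\<^sup>2 = (\<Sum>(i, j)\<in>?V \<times> ?V. w i * w j)"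
    by (simp add: power2_eq_square sum_product sum.cartesian_product)
  also have "?V \<times> ?V = L \<union> (G \<union> D)" by (auto simp: L_def G_def D_def)
  also have "(\<Sum>(i, j)\<in>L \<union> (G \<union> D). w i * w j) =
      (\<Sum>(i, j)\<in>L. w i * w j) + ((\<Sum>(i, j)\<in>G. w i * w j) + (\<Sum>(i, j)\<in>D. w i * w j))"
    using finite_LG by (subst sum.union_disjoint; (subst sum.union_disjoint)?) (auto simp: L_def G_def D_def)
  finally show ?thesis unfolding L G D by simp
qed

locale multiplicative_clocks = prob_space M for M :: "'w measure" +
  fixes z :: "nat \<Rightarrow> real" and \<xi> :: "nat set \<Rightarrow> 'w \<Rightarrow> real"
  assumes finite_vertices: "finite {i. 0 < z i}"
    and indep: "indep_vars (\<lambda>_. borel) \<xi> (potential_edges z)"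
    and clock: "\<And>i j. i \<noteq> j \<Longrightarrow> 0 < z i \<Longrightarrow> 0 < z j \<Longrightarrow>
      distributed M lborel (\<xi> {i, j}) (exponential_density (z i * z j))"
begin

abbreviation "V \<equiv> {i. 0 < z i}"
abbreviation "P \<equiv> potential_edges z"

text \<open>Written as a product over the end points so that it depends on the unordered edge only
  and so that \<open>sum_potential_edges\<close> applies to it and to its square.\<close>

definition rate :: "nat set \<Rightarrow> real" where "rate e = (\<Prod>i\<in>e. z i)"
definition total_rate :: real where "total_rate = (\<Sum>e\<in>P. rate e)"
definition total_rate2 :: real where "total_rate2 = (\<Sum>e\<in>P. (rate e)\<^sup>2)"
definition edges_at :: "real \<Rightarrow> 'w \<Rightarrow> nat set set" where "edges_at t \<omega> = {e \<in> P. \<xi> e \<omega> \<le> t}"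
definition hit_prob :: "real \<Rightarrow> real \<Rightarrow> nat set \<Rightarrow> real" where
  "hit_prob s t e = exp (- (s * rate e)) - exp (- (t * rate e))"
definition mean_edges :: "real \<Rightarrow> real" where "mean_edges t = (\<Sum>e\<in>P. 1 - exp (- (t * rate e)))"
definition centred :: "real \<Rightarrow> 'w \<Rightarrow> real" where
  "centred t \<omega> = real (card (edges_at t \<omega>)) - mean_edges t"
definition jump :: "real \<Rightarrow> real \<Rightarrow> nat set \<Rightarrow> 'w \<Rightarrow> real" where
  "jump s t e \<omega> = indicator {s<..t} (\<xi> e \<omega>) - hit_prob s t e"

section \<open>Clock probabilities and the centred edge count\<close>

lemma edgeE:
  assumes "e \<in> P"
  obtains i j where "e = {i, j}" "i \<noteq> j" "0 < z i" "0 < z j" "rate e = z i * z j"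
  using assms unfolding potential_edges_def rate_def by auto

lemma finite_P: "finite P"
  by (rule finite_subset[of _ "Pow V"]) (auto simp: potential_edges_def finite_vertices)

lemma rate_pos: "e \<in> P \<Longrightarrow> 0 < rate e"
  by (erule edgeE) simp

lemma total_rate_nonneg: "0 \<le> total_rate" "0 \<le> total_rate2"
  unfolding total_rate_def total_rate2_def by (auto intro!: sum_nonneg dest: rate_pos)

lemma measurable_clock: "e \<in> P \<Longrightarrow> \<xi> e \<in> borel_measurable M"
  using indep by (simp add: indep_vars_def)

lemma prob_clock_le:
  assumes e: "e \<in> P" and t: "0 \<le> t"
  shows "prob {\<omega> \<in> space M. \<xi> e \<omega> \<le> t} = 1 - exp (- (t * rate e))"
proof -
  obtain i j where ij: "e = {i, j}" "i \<noteq> j" "0 < z i" "0 < z j" "rate e = z i * z j"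
    using e by (rule edgeE)
  have "distributed M lborel (\<xi> e) (exponential_density (rate e))" using clock ij by simp
  from exponential_distributedD_le[OF this t] rate_pos[OF e] show ?thesis by simp
qed

lemma prob_hit:
  assumes e: "e \<in> P" and st: "0 \<le> s" "s \<le> t"
  shows "prob {\<omega> \<in> space M. s < \<xi> e \<omega> \<and> \<xi> e \<omega> \<le> t} = hit_prob s t e"
proof -
  note measurable_clock[OF e, measurable]
  have "{\<omega> \<in> space M. s < \<xi> e \<omega> \<and> \<xi> e \<omega> \<le> t} = {\<omega> \<in> space M. \<xi> e \<omega> \<le> t} - {\<omega> \<in> space M. \<xi> e \<omega> \<le> s}"
    by auto
  also have "prob \<dots> = prob {\<omega> \<in> space M. \<xi> e \<omega> \<le> t} - prob {\<omega> \<in> space M. \<xi> e \<omega> \<le> s}"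
    by (rule finite_measure_Diff) (use st in auto)
  finally show ?thesis using prob_clock_le[OF e] st by (simp add: hit_prob_def)
qed

text \<open>Factor out \<open>exp (- (s * rate e))\<close> for the upper bound and
  \<open>exp (- (t * rate e))\<close> for the lower one, and use \<open>1 + x \<le> exp x\<close>.
  The probability is thus linear in \<open>t - s\<close> up to a term with
  \<open>(rate e)\<^sup>2\<close>, the origin of \<open>total_rate2\<close>.\<close>

lemma hit_prob_bounds:
  assumes e: "e \<in> P" and st: "0 \<le> s" "s \<le> t"
  shows "0 \<le> hit_prob s t e" "hit_prob s t e \<le> 1" "hit_prob s t e \<le> rate e * (t - s)"
    "rate e * (t - s) - (rate e)\<^sup>2 * t * (t - s) \<le> hit_prob s t e"
proof -
  let ?l = "rate e"
  have l: "0 < ?l" by (rule rate_pos[OF e])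
  show "0 \<le> hit_prob s t e" "hit_prob s t e \<le> 1"
    using prob_hit[OF e st] by (metis measure_nonneg, metis prob_le_1)
  have eq: "hit_prob s t e = exp (- (s * ?l)) * (1 - exp (- (?l * (t - s))))"
    unfolding hit_prob_def right_diff_distrib exp_add[symmetric] by (simp add: algebra_simps)
  have eq': "hit_prob s t e = exp (- (t * ?l)) * (exp (?l * (t - s)) - 1)"
    unfolding hit_prob_def right_diff_distrib exp_add[symmetric] by (simp add: algebra_simps)
  have d: "0 \<le> ?l * (t - s)" using l st by simp
  have "hit_prob s t e \<le> 1 * (?l * (t - s))"
    unfolding eq
  proof (rule mult_mono)
    show "exp (- (s * ?l)) \<le> 1" using st l by simp
    show "1 - exp (- (?l * (t - s))) \<le> ?l * (t - s)" using exp_ge_add_one_self[of "- (?l * (t - s))"] by simp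
    show "0 \<le> 1 - exp (- (?l * (t - s)))" using d by simp
  qed simp
  then show "hit_prob s t e \<le> ?l * (t - s)" by simp
  have "(1 - t * ?l) * (?l * (t - s)) \<le> exp (- (t * ?l)) * (?l * (t - s))"
    using exp_ge_add_one_self[of "- (t * ?l)"] d by (intro mult_right_mono) auto
  also have "\<dots> \<le> hit_prob s t e"
    unfolding eq'
  proof (rule mult_left_mono)
    show "?l * (t - s) \<le> exp (?l * (t - s)) - 1" using exp_ge_add_one_self[of "?l * (t - s)"] by linarith
  qed simp
  finally show "?l * (t - s) - ?l\<^sup>2 * t * (t - s) \<le> hit_prob s t e"
    by (simp add: algebra_simps power2_eq_square)
qed

lemma sum_hit_prob_le:
  assumes "0 \<le> s" "s \<le> t"
  shows "(\<Sum>e\<in>P. hit_prob s t e) \<le> total_rate * (t - s)"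
  unfolding total_rate_def sum_distrib_right by (rule sum_mono) (use hit_prob_bounds(3) assms in auto)

lemma mean_edges_diff: "mean_edges t - mean_edges s = (\<Sum>e\<in>P. hit_prob s t e)"
  unfolding mean_edges_def hit_prob_def sum_subtractf[symmetric] by (rule sum.cong) auto

lemma mean_edges_approx:
  assumes "0 \<le> t"
  shows "\<bar>mean_edges t - total_rate * t\<bar> \<le> total_rate2 * t\<^sup>2"
proof -
  have m: "mean_edges t = (\<Sum>e\<in>P. hit_prob 0 t e)" using mean_edges_diff[of t 0] by (simp add: mean_edges_def)
  have "total_rate * t - total_rate2 * t\<^sup>2 = (\<Sum>e\<in>P. rate e * (t - 0) - (rate e)\<^sup>2 * t * (t - 0))"
    unfolding total_rate_def total_rate2_def sum_distrib_right sum_subtractf[symmetric]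
    by (rule sum.cong) (auto simp: power2_eq_square)
  also have "\<dots> \<le> mean_edges t" unfolding m
    by (rule sum_mono) (rule hit_prob_bounds(4)[OF _ order_refl assms])
  finally have "total_rate * t - total_rate2 * t\<^sup>2 \<le> mean_edges t" .
  moreover have "mean_edges t \<le> total_rate * t" using sum_hit_prob_le[of 0 t] assms m by simp
  moreover have "0 \<le> total_rate2 * t\<^sup>2" using total_rate_nonneg by simp
  ultimately show ?thesis by (simp add: abs_le_iff)
qed

lemma card_edges_at: "real (card (edges_at t \<omega>)) = (\<Sum>e\<in>P. indicator {..t} (\<xi> e \<omega>))"
proof -
  have "(\<Sum>e\<in>P. indicator {..t} (\<xi> e \<omega>) :: real) = (\<Sum>e\<in>P. if \<xi> e \<omega> \<le> t then 1 else 0)"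
    by (rule sum.cong) (auto simp: indicator_def)
  also have "\<dots> = real (card {e \<in> P. \<xi> e \<omega> \<le> t})"
    using finite_P by (simp add: sum.If_cases Int_def)
  finally show ?thesis by (simp add: edges_at_def)
qed

lemma measurable_centred[measurable]: "centred t \<in> borel_measurable M"
proof -
  have "(\<lambda>\<omega>. \<Sum>e\<in>P. indicator {..t} (\<xi> e \<omega>) :: real) \<in> borel_measurable M"
  proof (rule borel_measurable_sum)
    fix e assume "e \<in> P"
    note measurable_clock[OF this, measurable]
    show "(\<lambda>\<omega>. indicator {..t} (\<xi> e \<omega>) :: real) \<in> borel_measurable M" by measurable
  qed
  then show ?thesis unfolding centred_def[abs_def] card_edges_at by measurable
qed

lemma centred_diff:
  assumes "s \<le> t"
  shows "centred t \<omega> - centred s \<omega> = (\<Sum>e\<in>P. jump s t e \<omega>)"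
proof -
  have "(\<Sum>e\<in>P. jump s t e \<omega>) = (\<Sum>e\<in>P. indicator {..t} (\<xi> e \<omega>) - indicator {..s} (\<xi> e \<omega>) - hit_prob s t e)"
    unfolding jump_def by (rule sum.cong) (use assms in \<open>auto simp: indicator_def\<close>)
  then show ?thesis
    unfolding centred_def card_edges_at sum_subtractf by (simp add: mean_edges_diff[symmetric])
qed

text \<open>The edge count never decreases, so the centred process falls no faster than its mean
  grows. This is the one-sided bound used inside the finest cells of the chaining.\<close>

lemma centred_diff_ge:
  assumes "0 \<le> s" "s \<le> t"
  shows "- (total_rate * (t - s)) \<le> centred t \<omega> - centred s \<omega>"
proof -
  have "card (edges_at s \<omega>) \<le> card (edges_at t \<omega>)"
    using assms finite_P by (intro card_mono) (auto simp: edges_at_def)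
  then have "- (mean_edges t - mean_edges s) \<le> centred t \<omega> - centred s \<omega>"
    unfolding centred_def by simp
  then show ?thesis using sum_hit_prob_le[OF assms] unfolding mean_edges_diff by linarith
qed

lemma jump_facts:
  assumes e: "e \<in> P" and st: "0 \<le> s" "s \<le> t"
  shows "jump s t e \<in> borel_measurable M" "\<bar>jump s t e \<omega>\<bar> \<le> 1" "expectation (jump s t e) = 0"
    "expectation (\<lambda>\<omega>. (jump s t e \<omega>)\<^sup>2) \<le> hit_prob s t e"
proof -
  note measurable_clock[OF e, measurable]
  show m[measurable]: "jump s t e \<in> borel_measurable M" unfolding jump_def[abs_def] by measurable
  show b: "\<bar>jump s t e \<omega>\<bar> \<le> 1" for \<omega>
    using hit_prob_bounds(1,2)[OF e st] by (auto simp: jump_def indicator_def)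
  have iI: "integrable M (\<lambda>\<omega>. indicator {s<..t} (\<xi> e \<omega>) :: real)"
    by (rule integrable_const_bound[where B=1]) (auto simp: indicator_def)
  have EI: "expectation (\<lambda>\<omega>. indicator {s<..t} (\<xi> e \<omega>)) = hit_prob s t e"
  proof -
    have "expectation (\<lambda>\<omega>. indicator {s<..t} (\<xi> e \<omega>)) =
        expectation (indicator {\<omega> \<in> space M. s < \<xi> e \<omega> \<and> \<xi> e \<omega> \<le> t})"
      by (rule Bochner_Integration.integral_cong) (auto simp: indicator_def)
    also have "\<dots> = prob {\<omega> \<in> space M. s < \<xi> e \<omega> \<and> \<xi> e \<omega> \<le> t}" by simp
    finally show ?thesis by (simp add: prob_hit[OF e st])
  qed
  show "expectation (jump s t e) = 0" unfolding jump_def using iI EI by (simp add: prob_space)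
  have "expectation (\<lambda>\<omega>. (jump s t e \<omega>)\<^sup>2) =
      expectation (\<lambda>\<omega>. (1 - 2 * hit_prob s t e) * indicator {s<..t} (\<xi> e \<omega>) + (hit_prob s t e)\<^sup>2)"
    by (rule Bochner_Integration.integral_cong)
      (auto simp: jump_def indicator_def power2_eq_square algebra_simps)
  also have "\<dots> = (1 - 2 * hit_prob s t e) * hit_prob s t e + (hit_prob s t e)\<^sup>2"
    using iI EI by (simp add: prob_space)
  also have "\<dots> \<le> hit_prob s t e"
    by (simp add: power2_eq_square algebra_simps)
  finally show "expectation (\<lambda>\<omega>. (jump s t e \<omega>)\<^sup>2) \<le> hit_prob s t e" .
qed

lemma indep_jump: "indep_vars (\<lambda>_. borel) (\<lambda>e \<omega>. jump s t e \<omega>) P"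
  unfolding jump_def by (rule indep_vars_compose2[OF indep]) measurable

text \<open>The jumps are bounded by 1, so their fourth moments are at most their second moments,
  and these are at most the hitting probabilities.\<close>

lemma centred_fourth_moment:
  assumes st: "0 \<le> s" "s \<le> t"
  shows "integrable M (\<lambda>\<omega>. (centred t \<omega> - centred s \<omega>) ^ 4)"
    and "expectation (\<lambda>\<omega>. (centred t \<omega> - centred s \<omega>) ^ 4) \<le>
      3 * (total_rate * (t - s))\<^sup>2 + total_rate * (t - s)"
proof -
  note j = jump_facts[OF _ st]
  have b: "\<bar>centred t \<omega> - centred s \<omega>\<bar> \<le> real (card P)" for \<omega>
  proof -
    have "\<bar>\<Sum>e\<in>P. jump s t e \<omega>\<bar> \<le> (\<Sum>e\<in>P. 1)"
      by (rule order_trans[OF sum_abs]) (rule sum_mono, rule j(2))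
    then show ?thesis unfolding centred_diff[OF st(2)] by simp
  qed
  have b4: "norm ((centred t \<omega> - centred s \<omega>) ^ 4) \<le> real (card P) ^ 4" for \<omega>
    unfolding real_norm_def power_abs by (rule power_mono[OF b]) simp
  show "integrable M (\<lambda>\<omega>. (centred t \<omega> - centred s \<omega>) ^ 4)"
    by (rule integrable_const_bound[OF AE_I2[OF b4]]) measurable
  have "expectation (\<lambda>\<omega>. (centred t \<omega> - centred s \<omega>) ^ 4) \<le>
      3 * (\<Sum>e\<in>P. expectation (\<lambda>\<omega>. (jump s t e \<omega>)\<^sup>2))\<^sup>2 + (\<Sum>e\<in>P. expectation (\<lambda>\<omega>. (jump s t e \<omega>) ^ 4))"
    unfolding centred_diff[OF st(2)] using fourth_moment_sum_indep[OF finite_P indep_jump[of s t]] j(2,3) by blast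
  also have "\<dots> \<le> 3 * (\<Sum>e\<in>P. hit_prob s t e)\<^sup>2 + (\<Sum>e\<in>P. hit_prob s t e)"
  proof (intro add_mono mult_left_mono power_mono sum_mono sum_nonneg)
    fix e assume e: "e \<in> P"
    note j(1)[OF e, measurable]
    have i: "integrable M (\<lambda>\<omega>. (jump s t e \<omega>) ^ k)" for k
      by (rule integrable_const_bound[where B="1"])
        (use j(2)[OF e] in \<open>auto simp: power_abs intro!: power_le_one\<close>)
    have "expectation (\<lambda>\<omega>. (jump s t e \<omega>) ^ 4) \<le> expectation (\<lambda>\<omega>. (jump s t e \<omega>)\<^sup>2)"
    proof (rule integral_mono[OF i i])
      fix \<omega>
      have "(jump s t e \<omega>)\<^sup>2 * (jump s t e \<omega>)\<^sup>2 \<le> (jump s t e \<omega>)\<^sup>2 * 1"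
        using j(2)[OF e, of \<omega>] by (intro mult_left_mono) (auto simp: abs_square_le_1)
      then show "(jump s t e \<omega>) ^ 4 \<le> (jump s t e \<omega>)\<^sup>2" by (simp add: power2_eq_square eval_nat_numeral)
    qed
    then show "expectation (\<lambda>\<omega>. (jump s t e \<omega>) ^ 4) \<le> hit_prob s t e" using j(4)[OF e] by simp
  qed (use j(4) in auto)
  also have "\<dots> \<le> 3 * (total_rate * (t - s))\<^sup>2 + total_rate * (t - s)"
    using sum_hit_prob_le[OF st] hit_prob_bounds(1)[OF _ st]
    by (intro add_mono mult_left_mono power_mono) (auto intro: sum_nonneg)
  finally show "expectation (\<lambda>\<omega>. (centred t \<omega> - centred s \<omega>) ^ 4) \<le>
      3 * (total_rate * (t - s))\<^sup>2 + total_rate * (t - s)" .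
qed

text \<open>Increments over different cells are dependent through each single edge, but different
  edges are independent; so the linear combination is regrouped as a sum over edges. A clock rings
  in at most one cell, hence the variance for an edge is \<open>\<Sum> v^2 * p\<close> minus the
  square of the mean. The linear part of \<open>p\<close> gives
  \<open>total_rate * h * \<Sum> v^2\<close>; its quadratic correction and the squared mean give the
  error with \<open>total_rate2\<close>.\<close>

lemma char_increments_approx:
  fixes v :: "nat \<Rightarrow> real"
  assumes h: "0 \<le> h" and v: "(\<Sum>j<m. \<bar>v j\<bar>) \<le> \<eta>" and \<eta>: "\<eta> \<le> 1"
  shows "\<exists>\<sigma>. \<bar>\<sigma> - total_rate * h * (\<Sum>j<m. (v j)\<^sup>2)\<bar> \<le>
      total_rate2 * h\<^sup>2 * (real m * (\<Sum>j<m. (v j)\<^sup>2) + \<eta>\<^sup>2) \<and>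
    cmod (expectation (\<lambda>\<omega>. iexp (\<Sum>j<m. v j * (centred (real (Suc j) * h) \<omega> - centred (real j * h) \<omega>)))
      - complex_of_real (exp (- \<sigma> / 2))) \<le> \<eta> * \<sigma>"
proof -
  define a b where "a j = real j * h" and "b j = real (Suc j) * h" for j
  have ab: "0 \<le> a j" "a j \<le> b j" "b j - a j = h" for j using h by (auto simp: a_def b_def algebra_simps)
  define p where "p j e = hit_prob (a j) (b j) e" for j e
  define Y where "Y e \<omega> = (\<Sum>j<m. v j * jump (a j) (b j) e \<omega>)" for e \<omega>
  define f where "f e \<omega> = (\<Sum>j<m. v j * indicator {a j<..b j} (\<xi> e \<omega>))" for e \<omega>
  have \<eta>0: "0 \<le> \<eta>" using v by (meson abs_ge_zero order_trans sum_nonneg)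
  have Yf: "Y e \<omega> = f e \<omega> - (\<Sum>j<m. v j * p j e)" for e \<omega>
    unfolding Y_def f_def jump_def p_def by (simp add: sum_subtractf right_diff_distrib)
  have sum_eq: "(\<Sum>j<m. v j * (centred (real (Suc j) * h) \<omega> - centred (real j * h) \<omega>)) = (\<Sum>e\<in>P. Y e \<omega>)" for \<omega>
  proof -
    have "(\<Sum>j<m. v j * (centred (b j) \<omega> - centred (a j) \<omega>)) = (\<Sum>j<m. \<Sum>e\<in>P. v j * jump (a j) (b j) e \<omega>)"
      by (simp add: centred_diff[OF ab(2)] sum_distrib_left)
    also have "\<dots> = (\<Sum>e\<in>P. Y e \<omega>)" unfolding Y_def by (rule sum.swap)
    finally show ?thesis by (simp add: a_def b_def)
  qed
  \<comment> \<open>The cells are pairwise disjoint, so all cross terms in the square of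
    \<open>f e\<close> vanish.\<close>
  have disj: "indicator {a j<..b j} x * indicator {a k<..b k} x = (0::real)" if "j \<noteq> k" for j k x
  proof -
    have "b j \<le> a k" if "j < k" for j k
      using that h unfolding a_def b_def by (intro mult_right_mono) auto
    then have "b j \<le> a k \<or> b k \<le> a j" using that by (cases "j < k") auto
    then show ?thesis by (auto simp: indicator_def)
  qed
  have f2: "(f e \<omega>)\<^sup>2 = (\<Sum>j<m. (v j)\<^sup>2 * indicator {a j<..b j} (\<xi> e \<omega>))" for e \<omega>
  proof -
    have "(f e \<omega>)\<^sup>2 = (\<Sum>j<m. \<Sum>k<m. (v j * v k) * (indicator {a j<..b j} (\<xi> e \<omega>) * indicator {a k<..b k} (\<xi> e \<omega>)))"
      unfolding f_def power2_eq_square sum_product by (intro sum.cong refl) (simp add: mult_ac)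
    also have "\<dots> = (\<Sum>j<m. \<Sum>k<m. if k = j then (v j)\<^sup>2 * indicator {a j<..b j} (\<xi> e \<omega>) else 0)"
    proof (intro sum.cong refl)
      fix j k
      show "(v j * v k) * (indicator {a j<..b j} (\<xi> e \<omega>) * indicator {a k<..b k} (\<xi> e \<omega>)) =
          (if k = j then (v j)\<^sup>2 * indicator {a j<..b j} (\<xi> e \<omega>) else 0)"
        using disj[of j k "\<xi> e \<omega>"] by (cases "k = j") (auto simp: power2_eq_square indicator_def)
    qed
    also have "\<dots> = (\<Sum>j<m. (v j)\<^sup>2 * indicator {a j<..b j} (\<xi> e \<omega>))" by (intro sum.cong refl) simp
    finally show ?thesis .
  qed
  have EI: "integrable M (\<lambda>\<omega>. indicator {a j<..b j} (\<xi> e \<omega>) :: real)"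
    "expectation (\<lambda>\<omega>. indicator {a j<..b j} (\<xi> e \<omega>)) = p j e" if e: "e \<in> P" for e j
  proof -
    note measurable_clock[OF e, measurable]
    show i: "integrable M (\<lambda>\<omega>. indicator {a j<..b j} (\<xi> e \<omega>) :: real)"
      by (rule integrable_const_bound[where B=1]) (auto simp: indicator_def)
    have "expectation (\<lambda>\<omega>. jump (a j) (b j) e \<omega>) = expectation (\<lambda>\<omega>. indicator {a j<..b j} (\<xi> e \<omega>)) - p j e"
      unfolding jump_def p_def using i by (simp add: prob_space)
    then show "expectation (\<lambda>\<omega>. indicator {a j<..b j} (\<xi> e \<omega>)) = p j e"
      using jump_facts(3)[OF e ab(1,2)] by simp
  qed
  have Yb: "\<bar>Y e \<omega>\<bar> \<le> \<eta>" if e: "e \<in> P" for e \<omega>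
  proof -
    have "\<bar>Y e \<omega>\<bar> \<le> (\<Sum>j<m. \<bar>v j\<bar> * 1)"
      unfolding Y_def using jump_facts(2)[OF e ab(1,2)]
      by (intro order_trans[OF sum_abs] sum_mono) (simp add: abs_mult mult_left_le)
    then show ?thesis using v by simp
  qed
  have EY: "expectation (Y e) = 0" if e: "e \<in> P" for e
  proof -
    have "integrable M (jump (a j) (b j) e)" for j
      by (rule integrable_const_bound[where B=1]) (use jump_facts[OF e ab(1,2)] in auto)
    then show ?thesis unfolding Y_def[abs_def] by (simp add: jump_facts(3)[OF e ab(1,2)])
  qed
  define q where "q e = (\<Sum>j<m. v j * p j e)" for e
  have EY2: "expectation (\<lambda>\<omega>. (Y e \<omega>)\<^sup>2) = (\<Sum>j<m. (v j)\<^sup>2 * p j e) - (q e)\<^sup>2" if e: "e \<in> P" for e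
  proof -
    have if': "integrable M (f e)" "expectation (f e) = q e"
    proof -
      have i: "integrable M (\<lambda>\<omega>. v j * indicator {a j<..b j} (\<xi> e \<omega>))" for j
        by (rule integrable_mult_right[OF EI(1)[OF e]])
      show "integrable M (f e)" unfolding f_def[abs_def] by (rule Bochner_Integration.integrable_sum) (rule i)
      show "expectation (f e) = q e" unfolding f_def[abs_def] q_def
        by (subst Bochner_Integration.integral_sum, rule i) (simp only: integral_mult_right_zero EI(2)[OF e])
    qed
    have if2: "integrable M (\<lambda>\<omega>. (f e \<omega>)\<^sup>2)" "expectation (\<lambda>\<omega>. (f e \<omega>)\<^sup>2) = (\<Sum>j<m. (v j)\<^sup>2 * p j e)"
    proof -
      have i: "integrable M (\<lambda>\<omega>. (v j)\<^sup>2 * indicator {a j<..b j} (\<xi> e \<omega>))" for j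
        by (rule integrable_mult_right[OF EI(1)[OF e]])
      show "integrable M (\<lambda>\<omega>. (f e \<omega>)\<^sup>2)" unfolding f2 by (rule Bochner_Integration.integrable_sum) (rule i)
      show "expectation (\<lambda>\<omega>. (f e \<omega>)\<^sup>2) = (\<Sum>j<m. (v j)\<^sup>2 * p j e)" unfolding f2
        by (subst Bochner_Integration.integral_sum, rule i) (simp only: integral_mult_right_zero EI(2)[OF e])
    qed
    have "expectation (\<lambda>\<omega>. (Y e \<omega>)\<^sup>2) = expectation (\<lambda>\<omega>. (f e \<omega>)\<^sup>2 - 2 * q e * f e \<omega> + (q e)\<^sup>2)"
      unfolding Yf q_def[symmetric] by (rule Bochner_Integration.integral_cong) (auto simp: power2_eq_square algebra_simps)
    also have "\<dots> = (\<Sum>j<m. (v j)\<^sup>2 * p j e) - 2 * q e * q e + (q e)\<^sup>2"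
      using if' if2 by (simp add: prob_space)
    finally show ?thesis by (simp add: power2_eq_square)
  qed
  \<comment> \<open>The witness is the exact variance of the sum over the edges.\<close>
  define \<sigma> where "\<sigma> = (\<Sum>e\<in>P. expectation (\<lambda>\<omega>. (Y e \<omega>)\<^sup>2))"
  have "indep_vars (\<lambda>_. borel) Y P"
    unfolding Y_def jump_def by (rule indep_vars_compose2[OF indep]) measurable
  from char_sum_indep_approx[OF finite_P this Yb \<eta> EY]
  have char: "cmod (expectation (\<lambda>\<omega>. iexp (\<Sum>j<m. v j * (centred (real (Suc j) * h) \<omega> - centred (real j * h) \<omega>)))
      - complex_of_real (exp (- \<sigma> / 2))) \<le> \<eta> * \<sigma>"
    unfolding sum_eq \<sigma>_def by simp
  have "\<sigma> - total_rate * h * (\<Sum>j<m. (v j)\<^sup>2) =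
      (\<Sum>e\<in>P. (\<Sum>j<m. (v j)\<^sup>2 * p j e) - (q e)\<^sup>2 - rate e * h * (\<Sum>j<m. (v j)\<^sup>2))"
    unfolding \<sigma>_def total_rate_def by (simp add: EY2 sum_subtractf sum_distrib_right)
  also have "\<bar>\<dots>\<bar> \<le> (\<Sum>e\<in>P. (rate e)\<^sup>2 * (h\<^sup>2 * (real m * (\<Sum>j<m. (v j)\<^sup>2) + \<eta>\<^sup>2)))"
  proof (rule order_trans[OF sum_abs], rule sum_mono)
    fix e assume e: "e \<in> P"
    have pu: "p j e \<le> rate e * h" "0 \<le> p j e" for j
      using hit_prob_bounds[OF e ab(1,2)] by (auto simp: p_def ab(3))
    have pl: "rate e * h - (rate e)\<^sup>2 * (real m * h\<^sup>2) \<le> p j e" if j: "j < m" for j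
    proof -
      have "b j \<le> real m * h" using j h unfolding b_def by (intro mult_right_mono) auto
      then have "(rate e)\<^sup>2 * b j * h \<le> (rate e)\<^sup>2 * (real m * h) * h"
        using h by (intro mult_right_mono mult_left_mono) auto
      then show ?thesis using hit_prob_bounds(4)[OF e ab(1,2), of j]
        by (simp add: p_def ab(3) power2_eq_square mult.assoc)
    qed
    have A: "\<bar>(\<Sum>j<m. (v j)\<^sup>2 * p j e) - rate e * h * (\<Sum>j<m. (v j)\<^sup>2)\<bar> \<le> (rate e)\<^sup>2 * (real m * h\<^sup>2) * (\<Sum>j<m. (v j)\<^sup>2)"
    proof -
      have "(\<Sum>j<m. (v j)\<^sup>2 * p j e) - rate e * h * (\<Sum>j<m. (v j)\<^sup>2) = (\<Sum>j<m. (v j)\<^sup>2 * (p j e - rate e * h))"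
        by (simp add: sum_subtractf sum_distrib_left right_diff_distrib mult.commute)
      also have "\<bar>\<dots>\<bar> \<le> (\<Sum>j<m. (v j)\<^sup>2 * ((rate e)\<^sup>2 * (real m * h\<^sup>2)))"
      proof (rule order_trans[OF sum_abs], rule sum_mono)
        fix j assume "j \<in> {..<m}"
        then show "\<bar>(v j)\<^sup>2 * (p j e - rate e * h)\<bar> \<le> (v j)\<^sup>2 * ((rate e)\<^sup>2 * (real m * h\<^sup>2))"
          using pu[of j] pl[of j] by (simp add: abs_mult) (intro mult_left_mono; simp)
      qed
      also have "(\<Sum>j<m. (v j)\<^sup>2 * ((rate e)\<^sup>2 * (real m * h\<^sup>2))) =
          (rate e)\<^sup>2 * (real m * h\<^sup>2) * (\<Sum>j<m. (v j)\<^sup>2)"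
        unfolding sum_distrib_right[symmetric] by (rule mult.commute)
      finally show ?thesis .
    qed
    have "\<bar>q e\<bar> \<le> \<eta> * (rate e * h)"
    proof -
      have "\<bar>q e\<bar> \<le> (\<Sum>j<m. \<bar>v j\<bar> * (rate e * h))"
        unfolding q_def using pu by (intro order_trans[OF sum_abs] sum_mono) (simp add: abs_mult mult_left_mono)
      also have "\<dots> = (\<Sum>j<m. \<bar>v j\<bar>) * (rate e * h)" by (simp add: sum_distrib_right)
      also have "\<dots> \<le> \<eta> * (rate e * h)" using v rate_pos[OF e] h by (intro mult_right_mono) auto
      finally show ?thesis .
    qed
    then have B: "(q e)\<^sup>2 \<le> (\<eta> * (rate e * h))\<^sup>2"
      by (metis abs_ge_zero power2_abs power_mono)
    have "\<bar>(\<Sum>j<m. (v j)\<^sup>2 * p j e) - (q e)\<^sup>2 - rate e * h * (\<Sum>j<m. (v j)\<^sup>2)\<bar>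
        \<le> (rate e)\<^sup>2 * (real m * h\<^sup>2) * (\<Sum>j<m. (v j)\<^sup>2) + (\<eta> * (rate e * h))\<^sup>2"
      using A B zero_le_power2[of "q e"] by linarith
    also have "\<dots> = (rate e)\<^sup>2 * (h\<^sup>2 * (real m * (\<Sum>j<m. (v j)\<^sup>2) + \<eta>\<^sup>2))"
      by (simp add: power_mult_distrib algebra_simps)
    finally show "\<bar>(\<Sum>j<m. (v j)\<^sup>2 * p j e) - (q e)\<^sup>2 - rate e * h * (\<Sum>j<m. (v j)\<^sup>2)\<bar>
        \<le> (rate e)\<^sup>2 * (h\<^sup>2 * (real m * (\<Sum>j<m. (v j)\<^sup>2) + \<eta>\<^sup>2))" .
  qed
  also have "\<dots> = total_rate2 * h\<^sup>2 * (real m * (\<Sum>j<m. (v j)\<^sup>2) + \<eta>\<^sup>2)"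
    by (simp add: total_rate2_def sum_distrib_right mult.assoc)
  finally show ?thesis using char by blast
qed

text \<open>Only the laws of the clocks are prescribed, so some edge might be present at time 0 on a
  null set. Discarding it makes the centred process start at 0.\<close>

lemma AE_clocks_pos: "AE \<omega> in M. \<forall>e\<in>P. 0 < \<xi> e \<omega>"
proof (rule AE_finite_allI[OF finite_P])
  fix e assume e: "e \<in> P"
  note measurable_clock[OF e, measurable]
  have "prob {\<omega> \<in> space M. \<xi> e \<omega> \<le> 0} = 0" using prob_clock_le[OF e, of 0] by simp
  then have "AE \<omega> in M. \<not> \<xi> e \<omega> \<le> 0" by (subst (asm) prob_eq_0) auto
  then show "AE \<omega> in M. 0 < \<xi> e \<omega>" by (simp add: not_le)
qed

section \<open>The random edge set and the expected number of its non-bridges\<close>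

lemma edges_at_subset: "edges_at t \<omega> \<subseteq> P" "finite (edges_at t \<omega>)"
  using finite_P by (auto simp: edges_at_def)

lemma edges_at_mono: "s \<le> t \<Longrightarrow> edges_at s \<omega> \<subseteq> edges_at t \<omega>"
  by (auto simp: edges_at_def)

text \<open>The edge set takes finitely many values, each determined by finitely many comparisons of
  clocks with \<open>t\<close>. Consequently every real function of the graph is measurable.\<close>

lemma measurable_edges_at: "edges_at t \<in> M \<rightarrow>\<^sub>M count_space (Pow P)"
proof (subst measurable_count_space_eq2)
  show "finite (Pow P)" using finite_P by simp
  show "edges_at t \<in> space M \<rightarrow> Pow P \<and> (\<forall>F\<in>Pow P. edges_at t -` {F} \<inter> space M \<in> sets M)"
  proof (intro conjI ballI)
    fix F assume F: "F \<in> Pow P"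
    have "edges_at t -` {F} \<inter> space M = {\<omega> \<in> space M. \<forall>e\<in>P. (\<xi> e \<omega> \<le> t) = (e \<in> F)}"
    proof -
      have "edges_at t \<omega> = F \<longleftrightarrow> (\<forall>e\<in>P. (\<xi> e \<omega> \<le> t) = (e \<in> F))" for \<omega>
        using F unfolding edges_at_def by blast
      then show ?thesis by auto
    qed
    also have "\<dots> \<in> sets M"
    proof -
      have "Measurable.pred M (\<lambda>\<omega>. \<forall>e\<in>P. (\<xi> e \<omega> \<le> t) = (e \<in> F))"
      proof (rule pred_intros_finite(3)[OF finite_P])
        fix e assume "e \<in> P"
        note measurable_clock[OF this, measurable]
        show "Measurable.pred M (\<lambda>\<omega>. (\<xi> e \<omega> \<le> t) = (e \<in> F))" by measurable
      qed
      then show ?thesis by (simp add: pred_def)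
    qed
    finally show "edges_at t -` {F} \<inter> space M \<in> sets M" .
  qed (use edges_at_subset in auto)
qed

lemma measurable_of_edges: "(\<lambda>\<omega>. f (edges_at t \<omega>)) \<in> borel_measurable M"
  by (rule measurable_compose[OF measurable_edges_at]) simp

lemma num_components_edges_at:
  "card V \<le> num_components (V, edges_at t \<omega>) + card (edges_at t \<omega>)"
  "num_components (V, edges_at t \<omega>) + card (edges_at t \<omega>) \<le> card V + card (cyclic_edges (edges_at t \<omega>))"
proof -
  have "\<exists>i j. e = {i, j} \<and> i \<noteq> j \<and> i \<in> V \<and> j \<in> V" if "e \<in> edges_at t \<omega>" for e
    using that edges_at_subset(1)[of t \<omega>] by (auto simp: potential_edges_def)
  from num_components_bounds[OF finite_vertices edges_at_subset(2) this]
  show "card V \<le> num_components (V, edges_at t \<omega>) + card (edges_at t \<omega>)"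
    "num_components (V, edges_at t \<omega>) + card (edges_at t \<omega>) \<le> card V + card (cyclic_edges (edges_at t \<omega>))" by auto
qed

text \<open>A first moment bound over cycles. The clocks of a cycle are independent and each rings
  by time \<open>t\<close> with probability at most \<open>t\<close> times its rate, so
  \<open>prod_cycle\<close> bounds the probability of a cycle by a product over its vertices.
  Summation over all vertex sequences and then over all lengths gives a geometric series.\<close>

lemma expectation_cyclic_edges:
  assumes t: "0 \<le> t" and \<rho>: "t * (\<Sum>i\<in>V. (z i)\<^sup>2) \<le> \<rho>" "\<rho> < 1"
  shows "integrable M (\<lambda>\<omega>. real (card (cyclic_edges (edges_at t \<omega>))))"
    and "expectation (\<lambda>\<omega>. real (card (cyclic_edges (edges_at t \<omega>)))) \<le> 1 / (1 - \<rho>)"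
proof -
  let ?C = "\<lambda>\<omega>. SIGMA k:{3..card V}. {f \<in> vertex_cycles V k. \<forall>i<k. cycle_edge k f i \<in> edges_at t \<omega>}"
  have \<rho>0: "0 \<le> \<rho>" using t by (intro order_trans[OF _ \<rho>(1)] mult_nonneg_nonneg sum_nonneg) auto
  have sub: "cyclic_edges (edges_at t \<omega>) \<subseteq> P" for \<omega>
    using edges_at_subset(1)[of t \<omega>] by (auto simp: cyclic_edges_def)
  show int: "integrable M (\<lambda>\<omega>. real (card (cyclic_edges (edges_at t \<omega>))))"
  proof (rule integrable_const_bound[where B="real (card P)"])
    show "(\<lambda>\<omega>. real (card (cyclic_edges (edges_at t \<omega>)))) \<in> borel_measurable M" by (rule measurable_of_edges)
  qed (use sub finite_P in \<open>auto intro!: card_mono\<close>)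
  define H where "H k f = {\<omega> \<in> space M. \<forall>i<k. cycle_edge k f i \<in> edges_at t \<omega>}" for k f
  have H: "H k f \<in> events \<and> prob (H k f) \<le> (\<Prod>i<k. t * (z (f i))\<^sup>2)" if k: "3 \<le> k" and f: "f \<in> vertex_cycles V k" for k f
  proof -
    have fV: "f i \<in> V" if "i < k" for i using f that by (auto simp: vertex_cycles_def)
    have inj: "inj_on f {..<k}" using f by (simp add: vertex_cycles_def)
    have e: "cycle_edge k f i \<in> P" "rate (cycle_edge k f i) = z (f i) * z (f (Suc i mod k))" if i: "i < k" for i
    proof -
      have m: "Suc i mod k < k" using k by simp
      have "i \<noteq> Suc i mod k" using k i by (cases "Suc i = k") auto
      then have "f i \<noteq> f (Suc i mod k)" using inj i m by (auto dest: inj_onD)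
      then show "cycle_edge k f i \<in> P" "rate (cycle_edge k f i) = z (f i) * z (f (Suc i mod k))"
        using fV[OF i] fV[OF m] by (auto simp: cycle_edge_def potential_edges_def rate_def)
    qed
    let ?F = "cycle_edge k f ` {..<k}"
    have FP: "?F \<subseteq> P" using e by auto
    have "cycle_edge k f 0 \<in> ?F" using k by (intro imageI) simp
    then have F0: "?F \<noteq> {}" by blast
    have Hk: "H k f = (\<Inter>e\<in>?F. \<xi> e -` {..t} \<inter> space M)"
    proof -
      have "0 \<in> {..<k}" using k by simp
      then show ?thesis using e(1) by (auto simp: H_def edges_at_def)
    qed
    have "prob (H k f) = (\<Prod>e\<in>?F. prob (\<xi> e -` {..t} \<inter> space M))"
      unfolding Hk by (rule indep_varsD_finite[OF indep_vars_subset[OF indep FP] F0]) auto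
    also have "\<dots> = (\<Prod>i<k. prob (\<xi> (cycle_edge k f i) -` {..t} \<inter> space M))"
      by (rule prod.reindex_cong[OF inj_on_cycle_edge[OF k inj]]) auto
    also have "\<dots> \<le> (\<Prod>i<k. t * (z (f i) * z (f (Suc i mod k))))"
    proof (rule prod_mono)
      fix i assume i: "i \<in> {..<k}"
      have "prob (\<xi> (cycle_edge k f i) -` {..t} \<inter> space M) = prob {\<omega> \<in> space M. \<xi> (cycle_edge k f i) \<omega> \<le> t}"
        by (rule arg_cong[where f=prob]) auto
      also have "\<dots> = 1 - exp (- (t * rate (cycle_edge k f i)))" using e i by (intro prob_clock_le t) auto
      also have "\<dots> \<le> t * (z (f i) * z (f (Suc i mod k)))"
        using exp_ge_add_one_self[of "- (t * rate (cycle_edge k f i))"] e(2) i by simp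
      finally show "0 \<le> prob (\<xi> (cycle_edge k f i) -` {..t} \<inter> space M) \<and>
          prob (\<xi> (cycle_edge k f i) -` {..t} \<inter> space M) \<le> t * (z (f i) * z (f (Suc i mod k)))" by simp
    qed
    also have "\<dots> = (\<Prod>i<k. t * (z (f i))\<^sup>2)"
      unfolding prod.distrib[of "\<lambda>_. t"] using prod_cycle[of k z f] k by simp
    finally have "prob (H k f) \<le> (\<Prod>i<k. t * (z (f i))\<^sup>2)" .
    moreover have "H k f \<in> events"
    proof -
      have "\<xi> e -` {..t} \<inter> space M \<in> events" if "e \<in> ?F" for e
        using measurable_clock FP that by (intro measurable_sets[of _ _ borel]) auto
      then show ?thesis unfolding Hk using F0 by (intro sets.finite_INT) auto
    qed
    ultimately show ?thesis by simp
  qed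
  have fin: "finite (vertex_cycles V k)" for k by (rule finite_vertex_cycles[OF finite_vertices])
  have le: "real (card (cyclic_edges (edges_at t \<omega>))) \<le> (\<Sum>k\<in>{3..card V}. \<Sum>f\<in>vertex_cycles V k. indicator (H k f) \<omega>)"
    if \<omega>: "\<omega> \<in> space M" for \<omega>
  proof -
    have "e \<subseteq> V" if "e \<in> edges_at t \<omega>" for e
      using that edges_at_subset(1)[of t \<omega>] by (auto simp: potential_edges_def)
    then have "card (cyclic_edges (edges_at t \<omega>)) \<le> card (?C \<omega>)"
      by (rule card_cyclic_edges_le[OF finite_vertices])
    also have "\<dots> = (\<Sum>k\<in>{3..card V}. card {f \<in> vertex_cycles V k. \<forall>i<k. cycle_edge k f i \<in> edges_at t \<omega>})"
      by (rule card_SigmaI) (use fin in auto)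
    finally have "real (card (cyclic_edges (edges_at t \<omega>))) \<le>
        (\<Sum>k\<in>{3..card V}. real (card {f \<in> vertex_cycles V k. \<forall>i<k. cycle_edge k f i \<in> edges_at t \<omega>}))"
      unfolding of_nat_sum[symmetric] by (rule of_nat_mono)
    also have "\<dots> = (\<Sum>k\<in>{3..card V}. \<Sum>f\<in>vertex_cycles V k. indicator (H k f) \<omega>)"
    proof (rule sum.cong[OF refl])
      fix k
      have "(\<Sum>f\<in>vertex_cycles V k. indicator (H k f) \<omega> :: real) =
          (\<Sum>f\<in>vertex_cycles V k. if \<forall>i<k. cycle_edge k f i \<in> edges_at t \<omega> then 1 else 0)"
        by (rule sum.cong) (use \<omega> in \<open>auto simp: H_def indicator_def\<close>)
      also have "\<dots> = real (card {f \<in> vertex_cycles V k. \<forall>i<k. cycle_edge k f i \<in> edges_at t \<omega>})"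
        using fin by (simp add: sum.If_cases Int_def)
      finally show "real (card {f \<in> vertex_cycles V k. \<forall>i<k. cycle_edge k f i \<in> edges_at t \<omega>}) =
          (\<Sum>f\<in>vertex_cycles V k. indicator (H k f) \<omega>)" by simp
    qed
    finally show ?thesis .
  qed
  have iH: "integrable M (indicator (H k f) :: _ \<Rightarrow> real)" if "k \<in> {3..card V}" "f \<in> vertex_cycles V k" for k f
    using H[of k f] that by (intro integrable_real_indicator) (auto simp: emeasure_eq_measure)
  have "expectation (\<lambda>\<omega>. real (card (cyclic_edges (edges_at t \<omega>)))) \<le>
      expectation (\<lambda>\<omega>. \<Sum>k\<in>{3..card V}. \<Sum>f\<in>vertex_cycles V k. indicator (H k f) \<omega>)"
    by (rule integral_mono[OF int _ le]) (use iH in \<open>auto intro!: Bochner_Integration.integrable_sum\<close>)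
  also have "\<dots> = (\<Sum>k\<in>{3..card V}. expectation (\<lambda>\<omega>. \<Sum>f\<in>vertex_cycles V k. indicator (H k f) \<omega>))"
    by (rule Bochner_Integration.integral_sum) (intro Bochner_Integration.integrable_sum iH)
  also have "\<dots> = (\<Sum>k\<in>{3..card V}. \<Sum>f\<in>vertex_cycles V k. prob (H k f))"
  proof (rule sum.cong[OF refl])
    fix k assume k: "k \<in> {3..card V}"
    have "expectation (\<lambda>\<omega>. \<Sum>f\<in>vertex_cycles V k. indicator (H k f) \<omega>) =
        (\<Sum>f\<in>vertex_cycles V k. expectation (indicator (H k f)) :: real)"
      by (rule Bochner_Integration.integral_sum) (rule iH[OF k])
    also have "\<dots> = (\<Sum>f\<in>vertex_cycles V k. prob (H k f))"
      by (rule sum.cong) (use H k in auto)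
    finally show "expectation (\<lambda>\<omega>. \<Sum>f\<in>vertex_cycles V k. indicator (H k f) \<omega>) =
        (\<Sum>f\<in>vertex_cycles V k. prob (H k f))" .
  qed
  also have "\<dots> \<le> (\<Sum>k\<in>{3..card V}. \<rho> ^ k)"
  proof (rule sum_mono)
    fix k assume k: "k \<in> {3..card V}"
    have "(\<Sum>f\<in>vertex_cycles V k. prob (H k f)) \<le> (\<Sum>f\<in>vertex_cycles V k. \<Prod>i<k. t * (z (f i))\<^sup>2)"
      by (rule sum_mono) (use H k in auto)
    \<comment> \<open>Dropping the injectivity of \<open>f\<close> lets the sum over sequences
      factor into a \<open>k\<close>-th power.\<close>
    also have "\<dots> \<le> (\<Sum>f\<in>{..<k} \<rightarrow>\<^sub>E V. \<Prod>i<k. t * (z (f i))\<^sup>2)"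
    proof (rule sum_mono2)
      show "finite ({..<k} \<rightarrow>\<^sub>E V)" using finite_vertices by (intro finite_PiE) auto
      show "vertex_cycles V k \<subseteq> {..<k} \<rightarrow>\<^sub>E V" unfolding vertex_cycles_def by blast
    qed (rule prod_nonneg, use t in simp)
    also have "\<dots> = (\<Prod>i<k. \<Sum>v\<in>V. t * (z v)\<^sup>2)"
      by (rule prod_sum_PiE[symmetric]) (use finite_vertices in auto)
    also have "\<dots> = (t * (\<Sum>v\<in>V. (z v)\<^sup>2)) ^ k" by (simp add: sum_distrib_left)
    also have "\<dots> \<le> \<rho> ^ k" using t \<rho>(1) by (intro power_mono mult_nonneg_nonneg sum_nonneg) auto
    finally show "(\<Sum>f\<in>vertex_cycles V k. prob (H k f)) \<le> \<rho> ^ k" .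
  qed
  also have "\<dots> \<le> (\<Sum>k. \<rho> ^ k)"
    by (rule sum_le_suminf) (use \<rho>0 \<rho>(2) in \<open>auto intro!: summable_geometric\<close>)
  also have "\<dots> = 1 / (1 - \<rho>)" by (rule suminf_geometric) (use \<rho>0 \<rho>(2) in auto)
  finally show "expectation (\<lambda>\<omega>. real (card (cyclic_edges (edges_at t \<omega>)))) \<le> 1 / (1 - \<rho>)" .
qed

end

section \<open>The component count as a random path and its distance from the edge count\<close>

context multiplicative_clocks
begin

text \<open>In the slowed-down time the edge \<open>e\<close> appears at
  \<open>\<nu> * \<xi> e \<omega>\<close>, and the path is a function of the set of these times
  already passed. The factor \<open>\<alpha>\<close> and the continuous part \<open>g\<close> cover
  both normalisations of the count.\<close>

lemma measurable_component_path:
  assumes c: "0 \<le> c" and \<nu>: "0 < \<nu>" and g: "continuous_on {0..c} g"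
  shows "(\<lambda>\<omega>. \<lambda>t\<in>{0..c}. \<alpha> * real (num_components (V, edges_at (t / \<nu>) \<omega>)) + g t)
    \<in> M \<rightarrow>\<^sub>M borel_sigma (skorokhod_topology c)"
proof (rule measurable_skorokhod[OF c])
  show "(\<lambda>\<omega>. \<alpha> * real (num_components (V, edges_at (t / \<nu>) \<omega>)) + g t) \<in> borel_measurable M" for t
    by (rule measurable_of_edges[where f="\<lambda>E. \<alpha> * real (num_components (V, E)) + g t"])
  fix \<omega>
  let ?S = "(\<lambda>e. \<nu> * \<xi> e \<omega>) ` P"
  let ?f = "\<lambda>t. \<alpha> * real (num_components (V, edges_at (t / \<nu>) \<omega>))"
  have "edges_at (t / \<nu>) \<omega> = edges_at (u / \<nu>) \<omega>" if eq: "{s\<in>?S. s \<le> t} = {s\<in>?S. s \<le> u}" for t u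
  proof -
    have "\<xi> e \<omega> \<le> t / \<nu> \<longleftrightarrow> \<xi> e \<omega> \<le> u / \<nu>" if e: "e \<in> P" for e
    proof -
      have "\<nu> * \<xi> e \<omega> \<in> {s\<in>?S. s \<le> t} \<longleftrightarrow> \<nu> * \<xi> e \<omega> \<in> {s\<in>?S. s \<le> u}" by (simp only: eq)
      then have "\<nu> * \<xi> e \<omega> \<le> t \<longleftrightarrow> \<nu> * \<xi> e \<omega> \<le> u" using e by blast
      then show ?thesis using \<nu> by (simp add: pos_le_divide_eq mult.commute)
    qed
    then show ?thesis unfolding edges_at_def by blast
  qed
  note same_edges = this
  have "steps_at c ?S ?f"
    unfolding steps_at_def
  proof (intro conjI ballI impI)
    show "finite ?S" using finite_P by simp
    fix t u assume "{s\<in>?S. s \<le> t} = {s\<in>?S. s \<le> u}"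
    from same_edges[OF this] show "?f t = ?f u" by simp
  qed
  then show "\<exists>S f g'. steps_at c S f \<and> continuous_on {0..c} g' \<and>
      (\<forall>t\<in>{0..c}. \<alpha> * real (num_components (V, edges_at (t / \<nu>) \<omega>)) + g t = f t + g' t)"
    using g by blast
qed

text \<open>After time is divided by \<open>n\<close>, the bound on the total rate allows at most
  \<open>n * (t - s)\<close> expected edges in an interval. Dividing the process by
  \<open>sqrt n\<close> turns the fourth moment bound and the one-sided bound into the hypotheses of
  \<open>dyadic_chaining\<close>.\<close>

lemma centred_chaining:
  assumes n: "1 \<le> n" and rate: "total_rate \<le> (real n)\<^sup>2"
    and L: "2 ^ L \<le> n" "n < 2 ^ Suc L" and l0: "l0 < L" and R: "0 < R"
  shows "\<exists>A\<in>events. 1 - 16 * (4/5) ^ l0 / R ^ 4 \<le> prob A \<and> (\<forall>\<omega>\<in>A. \<forall>t\<in>{0..<1}.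
      \<bar>centred (t / real n) \<omega> / sqrt (real n) -
        centred (real (nat \<lfloor>2 ^ l0 * t\<rfloor>) / 2 ^ l0 / real n) \<omega> / sqrt (real n)\<bar>
      \<le> 10 * R * (9/10) ^ l0 + 2 / sqrt (real n))"
proof -
  define Z where "Z t \<omega> = centred (t / real n) \<omega> / sqrt (real n)" for t \<omega>
  have n0: "0 < real n" using n by simp
  have sq: "sqrt (real n) ^ 4 = (real n)\<^sup>2"
    using n0 by (simp add: power4_eq_xxxx power2_eq_square)
  have Zd: "(Z t \<omega> - Z s \<omega>) ^ 4 = (1 / (real n)\<^sup>2) * (centred (t / real n) \<omega> - centred (s / real n) \<omega>) ^ 4" for s t \<omega>
    unfolding Z_def diff_divide_distrib[symmetric] power_divide sq by simp
  have le: "0 \<le> s / real n" "s / real n \<le> t / real n" "total_rate * (t / real n - s / real n) \<le> real n * (t - s)"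
    if st: "0 \<le> s" "s \<le> t" for s t
  proof -
    show "0 \<le> s / real n" "s / real n \<le> t / real n" using st n0 by (auto intro: divide_right_mono)
    have "total_rate * (t / real n - s / real n) = total_rate * ((t - s) / real n)"
      by (simp add: diff_divide_distrib)
    also have "\<dots> \<le> (real n)\<^sup>2 * ((t - s) / real n)"
      using rate st n0 by (intro mult_right_mono) auto
    also have "\<dots> = real n * (t - s)" using n0 by (simp add: power2_eq_square)
    finally show "total_rate * (t / real n - s / real n) \<le> real n * (t - s)" .
  qed
  have "\<exists>A\<in>events. 1 - 16 * (4/5) ^ l0 / R ^ 4 \<le> prob A \<and> (\<forall>\<omega>\<in>A. \<forall>t\<in>{0..<1}.
      \<bar>Z t \<omega> - Z (real (nat \<lfloor>2 ^ l0 * t\<rfloor>) / 2 ^ l0) \<omega>\<bar> \<le> 10 * R * (9/10) ^ l0 + 2 / sqrt (real n))"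
  proof (rule dyadic_chaining[OF _ n L l0 R])
    show "Z t \<in> borel_measurable M" for t unfolding Z_def[abs_def] by measurable
    fix s t :: real assume st: "0 \<le> s" "s \<le> t"
    note le = le[OF st]
    show "integrable M (\<lambda>\<omega>. (Z t \<omega> - Z s \<omega>) ^ 4)"
      unfolding Zd by (rule integrable_mult_right[OF centred_fourth_moment(1)[OF le(1,2)]])
    have nn: "0 \<le> total_rate * (t / real n - s / real n)"
      using total_rate_nonneg(1) le(2) by (intro mult_nonneg_nonneg) auto
    have "expectation (\<lambda>\<omega>. (Z t \<omega> - Z s \<omega>) ^ 4) \<le>
        (1 / (real n)\<^sup>2) * (3 * (total_rate * (t / real n - s / real n))\<^sup>2 + total_rate * (t / real n - s / real n))"
      unfolding Zd integral_mult_right_zero by (rule mult_left_mono[OF centred_fourth_moment(2)[OF le(1,2)]]) simp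
    also have "\<dots> \<le> (1 / (real n)\<^sup>2) * (3 * (real n * (t - s))\<^sup>2 + real n * (t - s))"
      using power_mono[OF le(3) nn, of 2] le(3) by (intro mult_left_mono add_mono) auto
    also have "\<dots> = 3 * (t - s)\<^sup>2 + (t - s) / real n"
      using n0 by (simp add: field_simps power2_eq_square)
    finally show "expectation (\<lambda>\<omega>. (Z t \<omega> - Z s \<omega>) ^ 4) \<le> 3 * (t - s)\<^sup>2 + (t - s) / real n" .
    fix \<omega>
    have "- (real n * (t - s)) / sqrt (real n) \<le> (centred (t / real n) \<omega> - centred (s / real n) \<omega>) / sqrt (real n)"
      using centred_diff_ge[OF le(1,2), of \<omega>] le(3) n0 by (intro divide_right_mono) auto
    moreover have "real n * (t - s) / sqrt (real n) = sqrt (real n) * (t - s)"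
      using n0 by (simp add: real_div_sqrt field_simps)
    ultimately show "- (sqrt (real n) * (t - s)) \<le> Z t \<omega> - Z s \<omega>"
      by (simp add: Z_def diff_divide_distrib)
  qed
  then show ?thesis unfolding Z_def .
qed

text \<open>The count is exactly vertices minus edges plus excess, so only the excess and the
  discretisation of the centred process have to be estimated. The exceptional event is a failure of
  the chaining, at least \<open>a * sqrt n\<close> non-bridges, or a clock that is not positive; the
  last has probability 0.\<close>

lemma component_deviation:
  assumes n: "1 \<le> n" and rate: "total_rate \<le> (real n)\<^sup>2"
    and L: "2 ^ L \<le> n" "n < 2 ^ Suc L" and l0: "l0 < L" and R: "0 < R"
    and c: "0 \<le> c" "c < 1" and \<rho>: "c / real n * (\<Sum>i\<in>V. (z i)\<^sup>2) \<le> \<rho>" "\<rho> < 1" and a: "0 < a"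
  shows "\<exists>A\<in>events. 1 - 16 * (4/5) ^ l0 / R ^ 4 - 1 / ((1 - \<rho>) * (a * sqrt (real n))) \<le> prob A \<and>
    (\<forall>\<omega>\<in>A. \<forall>t\<in>{0..c}.
      \<bar>sqrt (real n) * (1 / real n * real (num_components (V, edges_at (t / real n) \<omega>)) - (1 - t / 2))
        - ((real (card V) - real n) / sqrt (real n)
           - (mean_edges (t / real n) - real n * (t / 2)) / sqrt (real n)
           - (centred (real (nat \<lfloor>2 ^ l0 * t\<rfloor>) / 2 ^ l0 / real n) \<omega> - centred 0 \<omega>) / sqrt (real n))\<bar>
      \<le> 10 * R * (9/10) ^ l0 + 2 / sqrt (real n) + a)"
proof -
  have n0: "0 < real n" "0 < sqrt (real n)" using n by auto
  obtain A1 where A1: "A1 \<in> events" "1 - 16 * (4/5) ^ l0 / R ^ 4 \<le> prob A1"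
    "\<And>\<omega> t. \<omega> \<in> A1 \<Longrightarrow> t \<in> {0..<1} \<Longrightarrow> \<bar>centred (t / real n) \<omega> / sqrt (real n) -
        centred (real (nat \<lfloor>2 ^ l0 * t\<rfloor>) / 2 ^ l0 / real n) \<omega> / sqrt (real n)\<bar>
      \<le> 10 * R * (9/10) ^ l0 + 2 / sqrt (real n)"
    using centred_chaining[OF n rate L l0 R] by blast
  \<comment> \<open>Non-bridges only increase in time, so one Markov bound at the final time
    \<open>c / n\<close> serves all \<open>t\<close> in \<open>{0..c}\<close>.\<close>
  define B where "B = {\<omega> \<in> space M. a * sqrt (real n) \<le> real (card (cyclic_edges (edges_at (c / real n) \<omega>)))}"
  have [measurable]: "(\<lambda>\<omega>. real (card (cyclic_edges (edges_at (c / real n) \<omega>)))) \<in> borel_measurable M"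
    by (rule measurable_of_edges[where f="\<lambda>E. real (card (cyclic_edges E))"])
  have B: "B \<in> events" unfolding B_def by measurable
  have cn: "0 \<le> c / real n" using c n0 by simp
  have an: "0 < a * sqrt (real n)" using a n0 by simp
  have "prob B \<le> expectation (\<lambda>\<omega>. real (card (cyclic_edges (edges_at (c / real n) \<omega>)))) / (a * sqrt (real n))"
    unfolding B_def
    by (rule integral_Markov_inequality_measure[OF expectation_cyclic_edges(1)[OF cn \<rho>]]) (use an in auto)
  also have "\<dots> \<le> 1 / (1 - \<rho>) / (a * sqrt (real n))"
    using an by (intro divide_right_mono expectation_cyclic_edges(2)[OF cn \<rho>]) auto
  finally have pB: "prob B \<le> 1 / ((1 - \<rho>) * (a * sqrt (real n)))" by simp
  define C where "C = {\<omega> \<in> space M. \<forall>e\<in>P. 0 < \<xi> e \<omega>}"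
  have C: "C \<in> events"
  proof -
    have "Measurable.pred M (\<lambda>\<omega>. \<forall>e\<in>P. 0 < \<xi> e \<omega>)"
    proof (rule pred_intros_finite(3)[OF finite_P])
      fix e assume "e \<in> P"
      note measurable_clock[OF this, measurable]
      show "Measurable.pred M (\<lambda>\<omega>. 0 < \<xi> e \<omega>)" by measurable
    qed
    then show ?thesis by (simp add: C_def pred_def)
  qed
  have pC: "prob C = 1"
    using AE_clocks_pos C unfolding C_def by (subst prob_Collect_eq_1) auto
  define A where "A = A1 \<inter> C - B"
  have A: "A \<in> events" using A1(1) B C by (simp add: A_def)
  have "prob (A1 \<inter> C) = prob A1"
  proof (rule measure_eq_AE)
    show "AE x in M. (x \<in> A1 \<inter> C) = (x \<in> A1)" using AE_clocks_pos by eventually_elim (use sets.sets_into_space[OF A1(1)] in \<open>auto simp: C_def\<close>)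
  qed (use A1 C in auto)
  moreover have "prob (A1 \<inter> C) \<le> prob A + prob B"
  proof -
    have "prob (A1 \<inter> C) \<le> prob (A \<union> B)"
      by (rule finite_measure_mono[OF _ sets.Un[OF A B]]) (auto simp: A_def)
    also have "\<dots> \<le> prob A + prob B" by (rule measure_Un_le[OF A B])
    finally show ?thesis .
  qed
  ultimately have pA: "1 - 16 * (4/5) ^ l0 / R ^ 4 - 1 / ((1 - \<rho>) * (a * sqrt (real n))) \<le> prob A"
    using A1(2) pB by linarith
  show ?thesis
  proof (intro bexI[OF _ A] conjI ballI pA)
    fix \<omega> t assume \<omega>: "\<omega> \<in> A" and t: "t \<in> {0..c}"
    have c0: "centred 0 \<omega> = 0"
    proof -
      have "edges_at 0 \<omega> = {}" using \<omega> by (force simp: A_def C_def edges_at_def)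
      then show ?thesis by (simp add: centred_def mean_edges_def)
    qed
    \<comment> \<open>\<open>X\<close> is the excess, which lies between 0 and the number of
      non-bridges.\<close>
    define N E X where "N = real (num_components (V, edges_at (t / real n) \<omega>))"
      and "E = real (card (edges_at (t / real n) \<omega>))" and "X = N + E - real (card V)"
    have X0: "0 \<le> X" using num_components_edges_at(1)[of "t / real n" \<omega>] unfolding X_def N_def E_def by linarith
    have "X \<le> real (card (cyclic_edges (edges_at (t / real n) \<omega>)))"
      using num_components_edges_at(2)[of "t / real n" \<omega>] unfolding X_def N_def E_def by linarith
    also have "card (cyclic_edges (edges_at (t / real n) \<omega>)) \<le> card (cyclic_edges (edges_at (c / real n) \<omega>))"
    proof (rule card_mono)
      show "finite (cyclic_edges (edges_at (c / real n) \<omega>))"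
        using edges_at_subset(2)[of "c / real n" \<omega>] by (simp add: cyclic_edges_def)
      show "cyclic_edges (edges_at (t / real n) \<omega>) \<subseteq> cyclic_edges (edges_at (c / real n) \<omega>)"
        using t n0 by (intro cyclic_edges_mono edges_at_mono divide_right_mono) auto
    qed
    also have "real (card (cyclic_edges (edges_at (c / real n) \<omega>))) \<le> a * sqrt (real n)"
      using \<omega> A sets.sets_into_space[OF A] by (auto simp: A_def B_def)
    finally have X1: "X \<le> a * sqrt (real n)" by simp
    have eq: "sqrt (real n) * (1 / real n * N - (1 - t / 2)) =
        (real (card V) - real n) / sqrt (real n) - (mean_edges (t / real n) - real n * (t / 2)) / sqrt (real n)
        - centred (t / real n) \<omega> / sqrt (real n) + X / sqrt (real n)"
    proof -
      have "N - real n * (1 - t / 2) = (real (card V) - real n) - (mean_edges (t / real n) - real n * (t / 2))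
          - centred (t / real n) \<omega> + X"
        by (simp add: X_def centred_def E_def algebra_simps)
      moreover have "sqrt (real n) * (1 / real n * N - (1 - t / 2)) = (N - real n * (1 - t / 2)) / sqrt (real n)"
      proof -
        have "1 / real n * N - (1 - t / 2) = (N - real n * (1 - t / 2)) / (sqrt (real n) * sqrt (real n))"
          using n0 by (simp add: field_simps)
        moreover have "q * (x / (q * q)) = x / q" if "q \<noteq> 0" for q x :: real using that by simp
        ultimately show ?thesis using n0(2) by (metis less_irrefl)
      qed
      ultimately show ?thesis by (simp add: add_divide_distrib diff_divide_distrib)
    qed
    have "0 \<le> X / sqrt (real n)" "X / sqrt (real n) \<le> a"
      using X0 X1 n0 by (auto simp: pos_divide_le_eq)
    moreover have "\<bar>centred (t / real n) \<omega> / sqrt (real n) -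
        centred (real (nat \<lfloor>2 ^ l0 * t\<rfloor>) / 2 ^ l0 / real n) \<omega> / sqrt (real n)\<bar>
      \<le> 10 * R * (9/10) ^ l0 + 2 / sqrt (real n)"
      by (rule A1(3)) (use \<omega> t c in \<open>auto simp: A_def\<close>)
    ultimately show "\<bar>sqrt (real n) * (1 / real n * real (num_components (V, edges_at (t / real n) \<omega>)) - (1 - t / 2))
        - ((real (card V) - real n) / sqrt (real n)
           - (mean_edges (t / real n) - real n * (t / 2)) / sqrt (real n)
           - (centred (real (nat \<lfloor>2 ^ l0 * t\<rfloor>) / 2 ^ l0 / real n) \<omega> - centred 0 \<omega>) / sqrt (real n))\<bar>
      \<le> 10 * R * (9/10) ^ l0 + 2 / sqrt (real n) + a"
      unfolding eq N_def[symmetric] c0 diff_0_right by linarith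
  qed
qed

end

section \<open>Gaussian characteristic functions and symmetric sums of the masses\<close>

lemma (in prob_space) char_distr_normal:
  assumes \<sigma>: "0 < \<sigma>" and X: "distributed M lborel X (normal_density 0 \<sigma>)"
  shows "char (distr M borel X) u = complex_of_real (exp (- (\<sigma> * u)\<^sup>2 / 2))"
proof -
  have mX[measurable]: "X \<in> borel_measurable M" using distributed_measurable[OF X] by simp
  have "distributed M lborel (\<lambda>x. (X x - 0) / \<sigma>) std_normal_density"
    using normal_standard_normal_convert[OF \<sigma>, of X 0] X by simp
  then have d: "distr M lborel (\<lambda>x. X x / \<sigma>) = std_normal_distribution"
    by (simp add: distributed_def)
  have "char (distr M borel X) u = (\<integral>x. iexp (u * X x) \<partial>M)"
    unfolding char_def by (rule integral_distr) auto
  also have "\<dots> = (\<integral>x. iexp ((\<sigma> * u) * (X x / \<sigma>)) \<partial>M)" using \<sigma> by simp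
  also have "\<dots> = (\<integral>y. iexp ((\<sigma> * u) * y) \<partial>distr M lborel (\<lambda>x. X x / \<sigma>))"
    by (rule integral_distr[symmetric]) auto
  also have "\<dots> = char std_normal_distribution (\<sigma> * u)" unfolding d char_def ..
  finally show ?thesis by (simp add: char_std_normal_distribution)
qed

text \<open>The rearrangement permutes the positive entries, so sums over them can be computed in
  the original order. These sums are all that the proof uses of the ordering.\<close>

lemma sum_initial_masses:
  assumes \<theta>: "\<And>i. 0 < \<theta> i"
  shows "finite {i. 0 < initial_masses \<theta> m n i}"
    and "(\<Sum>i | 0 < initial_masses \<theta> m n i. f (initial_masses \<theta> m n i)) = real n * f 1 + (\<Sum>i<m n. f (\<theta> i))"
proof -
  define x where "x k = (if k < n then 1 else if k < n + m n then \<theta> (k - n) else 0)" for k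
  define z where "z = initial_masses \<theta> m n"
  have pos: "{i. 0 < x i} = {..<n + m n}" using \<theta> by (auto simp: x_def)
  have "is_decreasing_rearrangement x z"
    unfolding z_def initial_masses_def x_def[symmetric]
    by (rule is_decreasing_rearrangement_decreasing_rearrangement) (simp add: pos)
  then obtain p where p: "bij_betw p {i. 0 < z i} {i. 0 < x i}" and zp: "\<And>i. 0 < z i \<Longrightarrow> z i = x (p i)"
    by (auto simp: is_decreasing_rearrangement_def)
  show "finite {i. 0 < initial_masses \<theta> m n i}"
    using bij_betw_finite[OF p] by (simp add: pos z_def)
  have "(\<Sum>i | 0 < z i. f (z i)) = (\<Sum>i | 0 < z i. f (x (p i)))" by (rule sum.cong) (use zp in auto)
  also have "\<dots> = (\<Sum>k<n + m n. f (x k))" using sum.reindex_bij_betw[OF p] by (simp add: pos)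
  also have "\<dots> = (\<Sum>k<n. f (x k)) + (\<Sum>k\<in>{n..<n + m n}. f (x k))"
    by (subst sum.union_disjoint[symmetric]) (auto intro!: sum.cong)
  also have "(\<Sum>k<n. f (x k)) = real n * f 1" by (simp add: x_def)
  also have "(\<Sum>k\<in>{n..<n + m n}. f (x k)) = (\<Sum>i<m n. f (\<theta> i))"
    by (rule sum.reindex_bij_witness[where i="\<lambda>i. i + n" and j="\<lambda>k. k - n"]) (auto simp: x_def)
  finally show "(\<Sum>i | 0 < initial_masses \<theta> m n i. f (initial_masses \<theta> m n i)) = real n * f 1 + (\<Sum>i<m n. f (\<theta> i))"
    by (simp add: z_def)
qed

section \<open>The subcritical scaling limit\<close>

locale graph_sequence =
  fixes \<theta> :: "nat \<Rightarrow> real" and m :: "nat \<Rightarrow> nat" and \<beta>\<^sub>1 \<beta>\<^sub>2 :: real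
    and M :: "nat \<Rightarrow> 'w measure" and \<xi> :: "nat \<Rightarrow> nat set \<Rightarrow> 'w \<Rightarrow> real"
  assumes \<theta>: "\<And>i. 0 < \<theta> i"
    and lim_m: "(\<lambda>n. real (m n) / sqrt (real n)) \<longlonglongrightarrow> \<beta>\<^sub>1"
    and lim_sum: "(\<lambda>n. 2 / sqrt (real n) * (\<Sum>i<m n. \<theta> i)) \<longlonglongrightarrow> \<beta>\<^sub>2"
    and lim_sum2: "(\<lambda>n. 1 / real n * (\<Sum>i<m n. (\<theta> i)\<^sup>2)) \<longlonglongrightarrow> 0"
    and clocks: "\<And>n. 1 \<le> n \<Longrightarrow> multiplicative_clocks (M n) (initial_masses \<theta> m n) (\<xi> n)"
begin

abbreviation "masses n \<equiv> initial_masses \<theta> m n"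
abbreviation "vertices n \<equiv> {i. 0 < masses n i}"
abbreviation "lam n \<equiv> multiplicative_clocks.total_rate (masses n)"
abbreviation "lam2 n \<equiv> multiplicative_clocks.total_rate2 (masses n)"

definition comps :: "nat \<Rightarrow> real \<Rightarrow> 'w \<Rightarrow> real" where
  "comps n t \<omega> = real (num_components (vertices n, multiplicative_clocks.edges_at (masses n) (\<xi> n) (t / real n) \<omega>))"

definition fluct :: "nat \<Rightarrow> real \<Rightarrow> 'w \<Rightarrow> real" where
  "fluct n t \<omega> = sqrt (real n) * (1 / real n * comps n t \<omega> - (1 - t / 2))"

definition Z :: "nat \<Rightarrow> real \<Rightarrow> 'w \<Rightarrow> real" where
  "Z n t \<omega> = multiplicative_clocks.centred (masses n) (\<xi> n) (t / real n) \<omega> / sqrt (real n)"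

text \<open>The deterministic part of \<open>fluct\<close>: what remains is minus \<open>Z\<close>
  plus the normalised excess.\<close>

definition drift :: "nat \<Rightarrow> real \<Rightarrow> real" where
  "drift n t = (real (card (vertices n)) - real n) / sqrt (real n) -
     (multiplicative_clocks.mean_edges (masses n) (t / real n) - real n * (t / 2)) / sqrt (real n)"

section \<open>Asymptotics of the rates and of the drift\<close>

lemma card_vertices: "real (card (vertices n)) = real n + real (m n)"
  using sum_initial_masses(2)[OF \<theta>, where f="\<lambda>_. 1"] by simp

lemma sum_sq: "(\<Sum>i\<in>vertices n. (masses n i)\<^sup>2) = real n + (\<Sum>i<m n. (\<theta> i)\<^sup>2)"
  using sum_initial_masses(2)[OF \<theta>, where f="\<lambda>x. x\<^sup>2"] by simp

lemma lam_eq: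
  assumes "1 \<le> n"
  shows "lam n = ((real n + (\<Sum>i<m n. \<theta> i))\<^sup>2 - (real n + (\<Sum>i<m n. (\<theta> i)\<^sup>2))) / 2"
    and "lam2 n \<le> (real n + (\<Sum>i<m n. (\<theta> i)\<^sup>2))\<^sup>2 / 2"
proof -
  interpret multiplicative_clocks "M n" "masses n" "\<xi> n" by (rule clocks[OF assms])
  show "lam n = ((real n + (\<Sum>i<m n. \<theta> i))\<^sup>2 - (real n + (\<Sum>i<m n. (\<theta> i)\<^sup>2))) / 2"
    using sum_potential_edges[OF finite_vertices, of "masses n"] sum_sq[of n]
      sum_initial_masses(2)[OF \<theta>, where f="\<lambda>x. x" and m=m and n=n]
    by (simp add: total_rate_def rate_def)
  have "2 * lam2 n = (\<Sum>i\<in>vertices n. (masses n i)\<^sup>2)\<^sup>2 - (\<Sum>i\<in>vertices n. ((masses n i)\<^sup>2)\<^sup>2)"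
    using sum_potential_edges[OF finite_vertices, of "\<lambda>i. (masses n i)\<^sup>2"]
    by (simp add: total_rate2_def rate_def prod_power_distrib)
  moreover have "0 \<le> (\<Sum>i\<in>vertices n. ((masses n i)\<^sup>2)\<^sup>2)" by (intro sum_nonneg) auto
  ultimately show "lam2 n \<le> (real n + (\<Sum>i<m n. (\<theta> i)\<^sup>2))\<^sup>2 / 2" unfolding sum_sq by linarith
qed

lemma inverse_sqrt_tendsto: "(\<lambda>n. 1 / sqrt (real n)) \<longlonglongrightarrow> 0"
  by (rule tendsto_divide_0[OF tendsto_const filterlim_compose[OF filterlim_at_top_imp_at_infinity[OF sqrt_at_top] filterlim_real_sequentially]])

lemma sum_sq_limit: "(\<lambda>n. (\<Sum>i\<in>vertices n. (masses n i)\<^sup>2) / real n) \<longlonglongrightarrow> 1"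
proof -
  have "(\<lambda>n. 1 + 1 / real n * (\<Sum>i<m n. (\<theta> i)\<^sup>2)) \<longlonglongrightarrow> 1 + 0" by (intro tendsto_intros lim_sum2)
  moreover have "eventually (\<lambda>n. 1 + 1 / real n * (\<Sum>i<m n. (\<theta> i)\<^sup>2) = (\<Sum>i\<in>vertices n. (masses n i)\<^sup>2) / real n) sequentially"
    using eventually_ge_at_top[of 1] by eventually_elim (simp add: sum_sq add_divide_distrib)
  ultimately show ?thesis by (simp add: tendsto_cong)
qed

text \<open>With \<open>q = sqrt n\<close> the sum of the \<theta>'s is \<open>a n * q / 2\<close>
  and the sum of their squares is \<open>b n * q\<^sup>2\<close>, so both quotients become
  polynomials in \<open>a n\<close>, \<open>b n\<close> and \<open>1 / q\<close>. In the second one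
  the part that survives, \<open>a n / 2\<close>, comes from the cross term
  \<open>n * \<Sum> \<theta>\<close> of the squared total mass.\<close>

lemma lam_limits:
  shows "(\<lambda>n. lam n / (real n)\<^sup>2) \<longlonglongrightarrow> 1 / 2"
    and "(\<lambda>n. (lam n / real n - real n / 2) / sqrt (real n)) \<longlonglongrightarrow> \<beta>\<^sub>2 / 2"
proof -
  define a where "a n = 2 / sqrt (real n) * (\<Sum>i<m n. \<theta> i)" for n
  define b where "b n = 1 / real n * (\<Sum>i<m n. (\<theta> i)\<^sup>2)" for n
  define s where "s n = 1 / sqrt (real n)" for n
  have lims: "a \<longlonglongrightarrow> \<beta>\<^sub>2" "b \<longlonglongrightarrow> 0" "s \<longlonglongrightarrow> 0"
    using lim_sum lim_sum2 inverse_sqrt_tendsto by (simp_all add: a_def[abs_def] b_def[abs_def] s_def[abs_def])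
  have key: "lam n / (real n)\<^sup>2 = ((1 + a n / 2 * s n)\<^sup>2 - (1 + b n) * (s n)\<^sup>2) / 2 \<and>
      (lam n / real n - real n / 2) / sqrt (real n) = a n / 2 + (a n / 2)\<^sup>2 * s n / 2 - s n / 2 - b n * s n / 2"
    if n: "1 \<le> n" for n
  proof -
    define q where "q = sqrt (real n)"
    have q: "0 < q" "real n = q\<^sup>2" using n by (auto simp: q_def)
    have A: "(\<Sum>i<m n. \<theta> i) = a n * q / 2" using q(1) by (simp add: a_def q_def[symmetric])
    have B: "(\<Sum>i<m n. (\<theta> i)\<^sup>2) = b n * q\<^sup>2" using q by (simp add: b_def)
    have S: "s n = 1 / q" by (simp add: s_def q_def)
    have l: "lam n = ((q\<^sup>2 + a n * q / 2)\<^sup>2 - (q\<^sup>2 + b n * q\<^sup>2)) / 2"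
      using lam_eq(1)[OF n] unfolding A B q(2) .
    show ?thesis
      unfolding l S q(2) real_sqrt_abs abs_of_pos[OF q(1)] using q(1)
      by (auto simp: field_simps power2_eq_square)
  qed
  have "(\<lambda>n. ((1 + a n / 2 * s n)\<^sup>2 - (1 + b n) * (s n)\<^sup>2) / 2) \<longlonglongrightarrow> ((1 + \<beta>\<^sub>2 / 2 * 0)\<^sup>2 - (1 + 0) * 0\<^sup>2) / 2"
    by (intro tendsto_intros lims) auto
  moreover have "eventually (\<lambda>n. ((1 + a n / 2 * s n)\<^sup>2 - (1 + b n) * (s n)\<^sup>2) / 2 = lam n / (real n)\<^sup>2) sequentially"
    using eventually_ge_at_top[of 1] by eventually_elim (simp add: key)
  ultimately have "(\<lambda>n. lam n / (real n)\<^sup>2) \<longlonglongrightarrow> ((1 + \<beta>\<^sub>2 / 2 * 0)\<^sup>2 - (1 + 0) * 0\<^sup>2) / 2"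
    by (rule Lim_transform_eventually)
  then show "(\<lambda>n. lam n / (real n)\<^sup>2) \<longlonglongrightarrow> 1 / 2" by simp
  have "(\<lambda>n. a n / 2 + (a n / 2)\<^sup>2 * s n / 2 - s n / 2 - b n * s n / 2) \<longlonglongrightarrow>
      \<beta>\<^sub>2 / 2 + (\<beta>\<^sub>2 / 2)\<^sup>2 * 0 / 2 - 0 / 2 - 0 * 0 / 2"
    by (intro tendsto_intros lims) auto
  moreover have "eventually (\<lambda>n. a n / 2 + (a n / 2)\<^sup>2 * s n / 2 - s n / 2 - b n * s n / 2 =
      (lam n / real n - real n / 2) / sqrt (real n)) sequentially"
    using eventually_ge_at_top[of 1] by eventually_elim (simp add: key)
  ultimately have "(\<lambda>n. (lam n / real n - real n / 2) / sqrt (real n)) \<longlonglongrightarrow>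
      \<beta>\<^sub>2 / 2 + (\<beta>\<^sub>2 / 2)\<^sup>2 * 0 / 2 - 0 / 2 - 0 * 0 / 2"
    by (rule Lim_transform_eventually)
  then show "(\<lambda>n. (lam n / real n - real n / 2) / sqrt (real n)) \<longlonglongrightarrow> \<beta>\<^sub>2 / 2" by simp
qed

lemma eventually_lam_le: "eventually (\<lambda>n. lam n \<le> (real n)\<^sup>2) sequentially"
proof -
  have "eventually (\<lambda>n. lam n / (real n)\<^sup>2 < 1) sequentially"
    by (rule order_tendstoD(2)[OF lam_limits(1)]) simp
  then show ?thesis
    using eventually_ge_at_top[of 1] by eventually_elim (simp add: pos_divide_less_eq)
qed

text \<open>This bounds the error \<open>lam2 n * (t / n)^2\<close> in the linearised mean by a
  constant, which disappears after division by \<open>sqrt n\<close>.\<close>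

lemma eventually_lam2_le: "eventually (\<lambda>n. lam2 n \<le> (real n)\<^sup>2) sequentially"
proof -
  have "(\<lambda>n. ((\<Sum>i\<in>vertices n. (masses n i)\<^sup>2) / real n)\<^sup>2 / 2) \<longlonglongrightarrow> 1\<^sup>2 / 2"
    by (intro tendsto_intros sum_sq_limit) auto
  then have "eventually (\<lambda>n. ((\<Sum>i\<in>vertices n. (masses n i)\<^sup>2) / real n)\<^sup>2 / 2 < 1) sequentially"
    by (rule order_tendstoD) simp
  then show ?thesis
    using eventually_ge_at_top[of 1]
  proof eventually_elim
    case (elim n)
    then have "(\<Sum>i\<in>vertices n. (masses n i)\<^sup>2)\<^sup>2 / 2 \<le> (real n)\<^sup>2"
      by (simp add: power_divide pos_divide_less_eq)
    then show ?case using lam_eq(2)[OF elim(2)] unfolding sum_sq by linarith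
  qed
qed

lemma drift_limit:
  assumes e: "0 < e"
  shows "eventually (\<lambda>n. \<forall>t\<in>{0..1}. \<bar>drift n t - (\<beta>\<^sub>1 - \<beta>\<^sub>2 * (t / 2))\<bar> \<le> e) sequentially"
proof -
  define x where "x n = (lam n / real n - real n / 2) / sqrt (real n)" for n
  \<comment> \<open>In this order: the surplus of vertices, the linearisation of the mean number of
    edges, and the limit of its slope. None depends on \<open>t\<close>, which makes the estimate
    uniform.\<close>
  define err where "err n = \<bar>real (m n) / sqrt (real n) - \<beta>\<^sub>1\<bar> + 1 / sqrt (real n) + \<bar>x n - \<beta>\<^sub>2 / 2\<bar>" for n
  have "err \<longlonglongrightarrow> \<bar>\<beta>\<^sub>1 - \<beta>\<^sub>1\<bar> + 0 + \<bar>\<beta>\<^sub>2 / 2 - \<beta>\<^sub>2 / 2\<bar>"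
    unfolding err_def[abs_def] x_def
    by (intro tendsto_intros lim_m lam_limits(2) inverse_sqrt_tendsto)
  then have "err \<longlonglongrightarrow> 0" by simp
  then have "eventually (\<lambda>n. err n < e) sequentially" by (rule order_tendstoD) (rule e)
  then show ?thesis
    using eventually_lam2_le eventually_ge_at_top[of 1]
  proof eventually_elim
    case (elim n)
    interpret multiplicative_clocks "M n" "masses n" "\<xi> n" by (rule clocks[OF elim(3)])
    have n0: "0 < real n" "0 < sqrt (real n)" using elim(3) by auto
    show ?case
    proof
      fix t :: real assume t: "t \<in> {0..1}"
      have "\<bar>mean_edges (t / real n) - lam n * (t / real n)\<bar> \<le> lam2 n * (t / real n)\<^sup>2"
        by (rule mean_edges_approx) (use t n0 in simp)
      also have "\<dots> \<le> (real n)\<^sup>2 * (t / real n)\<^sup>2" using elim(2) by (rule mult_right_mono) simp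
      also have "\<dots> = t\<^sup>2" using n0 by (simp add: power_divide)
      also have "\<dots> \<le> 1" using t by (simp add: power_le_one)
      finally have "\<bar>(mean_edges (t / real n) - lam n * (t / real n)) / sqrt (real n)\<bar> \<le> 1 / sqrt (real n)"
        using n0 by (simp add: divide_right_mono)
      moreover have "(mean_edges (t / real n) - real n * (t / 2)) / sqrt (real n) =
          (mean_edges (t / real n) - lam n * (t / real n)) / sqrt (real n) + t * x n"
        by (simp add: x_def diff_divide_distrib algebra_simps)
      moreover have "\<bar>t * x n - \<beta>\<^sub>2 * (t / 2)\<bar> \<le> \<bar>x n - \<beta>\<^sub>2 / 2\<bar>"
      proof -
        have "\<bar>t * x n - \<beta>\<^sub>2 * (t / 2)\<bar> = t * \<bar>x n - \<beta>\<^sub>2 / 2\<bar>"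
        proof -
          have "t * x n - \<beta>\<^sub>2 * (t / 2) = t * (x n - \<beta>\<^sub>2 / 2)" by (simp add: algebra_simps)
          then show ?thesis using t by (simp add: abs_mult)
        qed
        also have "\<dots> \<le> 1 * \<bar>x n - \<beta>\<^sub>2 / 2\<bar>" using t by (intro mult_right_mono) auto
        finally show ?thesis by simp
      qed
      moreover have "(real (card (vertices n)) - real n) / sqrt (real n) = real (m n) / sqrt (real n)"
        by (simp add: card_vertices)
      ultimately show "\<bar>drift n t - (\<beta>\<^sub>1 - \<beta>\<^sub>2 * (t / 2))\<bar> \<le> e"
        using elim(1) unfolding drift_def err_def by linarith
    qed
  qed
qed

lemma fluct_deviation:
  assumes c: "0 \<le> c" "c < 1" and R: "0 < R" and e: "0 < e"
  shows "\<exists>n0. \<forall>n\<ge>n0. \<exists>A\<in>sets (M n). 1 - 16 * (4/5) ^ q / R ^ 4 - e \<le> measure (M n) A \<and>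
    (\<forall>\<omega>\<in>A. \<forall>t\<in>{0..c}. \<bar>fluct n t \<omega> - (\<beta>\<^sub>1 - \<beta>\<^sub>2 * (t / 2) - (Z n (real (nat \<lfloor>2 ^ q * t\<rfloor>) / 2 ^ q) \<omega> - Z n 0 \<omega>))\<bar>
      \<le> 10 * R * (9/10) ^ q + e)"
proof -
  \<comment> \<open>The midpoint between \<open>c\<close> and 1: \<open>c\<close> times the
    normalised sum of squared masses tends to \<open>c\<close> and so is eventually below
    \<open>\<rho>\<close>, while \<open>1 / (1 - \<rho>)\<close> is a fixed constant.\<close>
  define \<rho> where "\<rho> = (1 + c) / 2"
  have \<rho>: "c < \<rho>" "\<rho> < 1" using c by (auto simp: \<rho>_def)
  \<comment> \<open>Three errors of size \<open>a\<close> occur: the normalised excess, the term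
    \<open>2 / sqrt n\<close> of the chaining, and the drift.\<close>
  define a where "a = e / 4"
  have a: "0 < a" using e by (simp add: a_def)
  have "(\<lambda>n. c * ((\<Sum>i\<in>vertices n. (masses n i)\<^sup>2) / real n)) \<longlonglongrightarrow> c * 1"
    by (intro tendsto_intros sum_sq_limit)
  then have e1: "eventually (\<lambda>n. c * ((\<Sum>i\<in>vertices n. (masses n i)\<^sup>2) / real n) < \<rho>) sequentially"
    by (rule order_tendstoD) (use \<rho> in simp)
  have "(\<lambda>n. 1 / ((1 - \<rho>) * a) * (1 / sqrt (real n))) \<longlonglongrightarrow> 1 / ((1 - \<rho>) * a) * 0"
    by (intro tendsto_intros inverse_sqrt_tendsto)
  then have e2: "eventually (\<lambda>n. 1 / ((1 - \<rho>) * a) * (1 / sqrt (real n)) < e) sequentially"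
    by (rule order_tendstoD) (use e in simp)
  have "(\<lambda>n. 2 * (1 / sqrt (real n))) \<longlonglongrightarrow> 2 * 0" by (intro tendsto_intros inverse_sqrt_tendsto)
  then have e3: "eventually (\<lambda>n. 2 * (1 / sqrt (real n)) < a) sequentially"
    by (rule order_tendstoD) (use a in simp)
  have "eventually (\<lambda>n. \<exists>A\<in>sets (M n). 1 - 16 * (4/5) ^ q / R ^ 4 - e \<le> measure (M n) A \<and>
    (\<forall>\<omega>\<in>A. \<forall>t\<in>{0..c}. \<bar>fluct n t \<omega> - (\<beta>\<^sub>1 - \<beta>\<^sub>2 * (t / 2) - (Z n (real (nat \<lfloor>2 ^ q * t\<rfloor>) / 2 ^ q) \<omega> - Z n 0 \<omega>))\<bar>
      \<le> 10 * R * (9/10) ^ q + e)) sequentially"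
    using e1 e2 e3 drift_limit[OF a] eventually_lam_le eventually_ge_at_top[of "2 ^ Suc q"]
  proof eventually_elim
    case (elim n)
    have n1: "1 \<le> n" using elim(6) by (meson one_le_numeral one_le_power order_trans)
    then have n0: "0 < real n" by simp
    interpret multiplicative_clocks "M n" "masses n" "\<xi> n" by (rule clocks[OF n1])
    obtain L where L: "2 ^ L \<le> n" "n < 2 ^ Suc L" using ex_power_ivl1[of 2 n] n1 by auto
    \<comment> \<open>The requirement \<open>2 ^ Suc q \<le> n\<close> puts the finest level
      \<open>L\<close> strictly above the starting level \<open>q\<close>.\<close>
    have "(2::nat) ^ Suc q < 2 ^ Suc L" using L(2) elim(6) by (rule order.strict_trans1[rotated])
    then have qL: "q < L" by simp
    have "c / real n * (\<Sum>i\<in>vertices n. (masses n i)\<^sup>2) \<le> \<rho>" using elim(1) by simp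
    from component_deviation[OF n1 elim(5) L qL R c this \<rho>(2) a]
    obtain A where A: "A \<in> events" "1 - 16 * (4/5) ^ q / R ^ 4 - 1 / ((1 - \<rho>) * (a * sqrt (real n))) \<le> prob A"
      "\<And>\<omega> t. \<omega> \<in> A \<Longrightarrow> t \<in> {0..c} \<Longrightarrow> \<bar>sqrt (real n) * (1 / real n * real (num_components (vertices n, edges_at (t / real n) \<omega>)) - (1 - t / 2))
        - ((real (card (vertices n)) - real n) / sqrt (real n)
           - (mean_edges (t / real n) - real n * (t / 2)) / sqrt (real n)
           - (centred (real (nat \<lfloor>2 ^ q * t\<rfloor>) / 2 ^ q / real n) \<omega> - centred 0 \<omega>) / sqrt (real n))\<bar>
      \<le> 10 * R * (9/10) ^ q + 2 / sqrt (real n) + a" by blast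
    show ?case
    proof (intro bexI[OF _ A(1)] conjI ballI)
      have "1 / ((1 - \<rho>) * (a * sqrt (real n))) = 1 / ((1 - \<rho>) * a) * (1 / sqrt (real n))" by simp
      then show "1 - 16 * (4/5) ^ q / R ^ 4 - e \<le> prob A" using A(2) elim(2) by linarith
      fix \<omega> t assume \<omega>: "\<omega> \<in> A" and t: "t \<in> {0..c}"
      have "\<bar>fluct n t \<omega> - (drift n t - (Z n (real (nat \<lfloor>2 ^ q * t\<rfloor>) / 2 ^ q) \<omega> - Z n 0 \<omega>))\<bar>
          \<le> 10 * R * (9/10) ^ q + 2 / sqrt (real n) + a"
        using A(3)[OF \<omega> t] by (simp add: fluct_def comps_def drift_def Z_def diff_divide_distrib)
      moreover have "\<bar>drift n t - (\<beta>\<^sub>1 - \<beta>\<^sub>2 * (t / 2))\<bar> \<le> a"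
        using elim(4) t c by (intro bspec[OF elim(4)]) auto
      moreover have "2 / sqrt (real n) < a" using elim(3) by simp
      ultimately show "\<bar>fluct n t \<omega> - (\<beta>\<^sub>1 - \<beta>\<^sub>2 * (t / 2) - (Z n (real (nat \<lfloor>2 ^ q * t\<rfloor>) / 2 ^ q) \<omega> - Z n 0 \<omega>))\<bar>
          \<le> 10 * R * (9/10) ^ q + e"
        unfolding a_def by linarith
    qed
  qed
  then show ?thesis by (simp add: eventually_sequentially)
qed

text \<open>The limit is the characteristic function of independent Gaussians of variance
  \<open>1 / (2 * k)\<close>, the limit \<open>1/2\<close> of \<open>lam n / n^2\<close> times the
  mesh. The minus sign is there because new edges reduce the number of components. The number
  \<open>l\<close> of increments is kept apart from the mesh \<open>1 / k\<close>, since the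
  coordinates \<open>0..k\<close> of a grid function call for \<open>k + 1\<close> of them.\<close>

lemma increments_char_limit:
  fixes k :: nat and u :: "nat \<Rightarrow> real"
  assumes k: "1 \<le> k"
  shows "(\<lambda>n. \<integral>\<omega>. iexp (\<Sum>j<l. u j * - (Z n (real (Suc j) / real k) \<omega> - Z n (real j / real k) \<omega>)) \<partial>M n)
    \<longlonglongrightarrow> complex_of_real (exp (- ((\<Sum>j<l. (u j)\<^sup>2) / (2 * real k)) / 2))"
proof -
  define Q where "Q = (\<Sum>j<l. (u j)\<^sup>2)"
  define U where "U = (\<Sum>j<l. \<bar>u j\<bar>)"
  define \<eta> where "\<eta> n = U * (1 / sqrt (real n))" for n
  have k0: "0 < real k" using k by simp
  have U0: "0 \<le> U" and Q0: "0 \<le> Q" by (auto simp: U_def Q_def intro!: sum_nonneg)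
  define ch where "ch n = (\<integral>\<omega>. iexp (\<Sum>j<l. u j * - (Z n (real (Suc j) / real k) \<omega> - Z n (real j / real k) \<omega>)) \<partial>M n)" for n
  define bd where "bd n = (1 / (real k)\<^sup>2) * (real l * Q + U\<^sup>2) * (1 / sqrt (real n) * (1 / sqrt (real n)))" for n
  have \<eta>lim: "\<eta> \<longlonglongrightarrow> 0"
    using tendsto_mult[OF tendsto_const[of U] inverse_sqrt_tendsto] by (simp add: \<eta>_def[abs_def])
  have bdlim: "bd \<longlonglongrightarrow> 0"
  proof -
    have "bd \<longlonglongrightarrow> (1 / (real k)\<^sup>2) * (real l * Q + U\<^sup>2) * (0 * 0)"
      unfolding bd_def[abs_def] by (intro tendsto_intros inverse_sqrt_tendsto)
    then show ?thesis by simp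
  qed
  have "eventually (\<lambda>n. \<eta> n < 1) sequentially" by (rule order_tendstoD(2)[OF \<eta>lim]) simp
  then have ev: "eventually (\<lambda>n. \<exists>\<sigma>. \<bar>\<sigma> - lam n / (real n)\<^sup>2 * (Q / real k)\<bar> \<le> bd n \<and>
      cmod (ch n - complex_of_real (exp (- \<sigma> / 2))) \<le> \<eta> n * \<sigma>) sequentially"
    using eventually_lam2_le eventually_ge_at_top[of 1]
  proof eventually_elim
    case (elim n)
    interpret multiplicative_clocks "M n" "masses n" "\<xi> n" by (rule clocks[OF elim(3)])
    have n0: "0 < real n" "0 < sqrt (real n)" using elim(3) by auto
    \<comment> \<open>The cell length in the time of the graph process. The spatial scaling and the
      sign go into \<open>v\<close>, so that its absolute sum is at most \<open>\<eta> n\<close>,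
      which tends to 0.\<close>
    define h where "h = 1 / (real k * real n)"
    define v where "v j = - u j / sqrt (real n)" for j
    have h0: "0 \<le> h" using k0 n0 by (simp add: h_def)
    have v1: "(\<Sum>j<l. \<bar>v j\<bar>) \<le> \<eta> n"
      using n0 by (simp add: v_def \<eta>_def U_def sum_divide_distrib)
    have v2: "(\<Sum>j<l. (v j)\<^sup>2) = Q / real n"
      using n0 by (simp add: v_def Q_def sum_divide_distrib power_divide)
    have eq: "(\<Sum>j<l. u j * - (Z n (real (Suc j) / real k) \<omega> - Z n (real j / real k) \<omega>)) =
        (\<Sum>j<l. v j * (centred (real (Suc j) * h) \<omega> - centred (real j * h) \<omega>))" for \<omega>
    proof (rule sum.cong[OF refl])
      fix j
      have "x / real k / real n = x * h" for x by (simp add: h_def)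
      then show "u j * - (Z n (real (Suc j) / real k) \<omega> - Z n (real j / real k) \<omega>) =
          v j * (centred (real (Suc j) * h) \<omega> - centred (real j * h) \<omega>)"
        by (simp add: Z_def v_def diff_divide_distrib right_diff_distrib)
    qed
    obtain \<sigma> where \<sigma>: "\<bar>\<sigma> - lam n * h * (\<Sum>j<l. (v j)\<^sup>2)\<bar> \<le> lam2 n * h\<^sup>2 * (real l * (\<Sum>j<l. (v j)\<^sup>2) + (\<eta> n)\<^sup>2)"
      "cmod (ch n - complex_of_real (exp (- \<sigma> / 2))) \<le> \<eta> n * \<sigma>"
      using char_increments_approx[OF h0 v1 less_imp_le[OF elim(1)]] unfolding ch_def eq by blast
    have "lam n * h * (\<Sum>j<l. (v j)\<^sup>2) = lam n / (real n)\<^sup>2 * (Q / real k)"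
      unfolding v2 h_def by (simp add: power2_eq_square)
    moreover have "lam2 n * h\<^sup>2 * (real l * (\<Sum>j<l. (v j)\<^sup>2) + (\<eta> n)\<^sup>2) \<le> bd n"
    proof -
      have \<eta>2: "(\<eta> n)\<^sup>2 = U\<^sup>2 / real n" using n0 by (simp add: \<eta>_def power_divide)
      have "lam2 n * h\<^sup>2 * (real l * (\<Sum>j<l. (v j)\<^sup>2) + (\<eta> n)\<^sup>2) \<le>
          (real n)\<^sup>2 * h\<^sup>2 * (real l * (\<Sum>j<l. (v j)\<^sup>2) + (\<eta> n)\<^sup>2)"
        using elim(2) by (intro mult_right_mono add_nonneg_nonneg mult_nonneg_nonneg sum_nonneg) auto
      also have "\<dots> = (1 / (real k)\<^sup>2) * ((real l * Q + U\<^sup>2) / real n)"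
        unfolding v2 \<eta>2 h_def using n0 by (simp add: power_divide power_mult_distrib add_divide_distrib)
      also have "\<dots> = bd n" using n0 by (simp add: bd_def)
      finally show ?thesis .
    qed
    ultimately show ?case using \<sigma> by (intro exI[of _ \<sigma>]) auto
  qed
  then obtain n0 where n0: "\<And>n. n \<ge> n0 \<Longrightarrow> \<exists>\<sigma>. \<bar>\<sigma> - lam n / (real n)\<^sup>2 * (Q / real k)\<bar> \<le> bd n \<and>
      cmod (ch n - complex_of_real (exp (- \<sigma> / 2))) \<le> \<eta> n * \<sigma>"
    by (auto simp: eventually_sequentially)
  \<comment> \<open>The implication in the existential statement gives \<open>\<sigma>\<close> an
    arbitrary value for the finitely many \<open>n\<close> below \<open>n0\<close>.\<close>
  then have "\<forall>n. \<exists>\<sigma>. n \<ge> n0 \<longrightarrow> \<bar>\<sigma> - lam n / (real n)\<^sup>2 * (Q / real k)\<bar> \<le> bd n \<and>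
      cmod (ch n - complex_of_real (exp (- \<sigma> / 2))) \<le> \<eta> n * \<sigma>" by blast
  from choice[OF this] obtain \<sigma> where \<sigma>: "\<And>n. n \<ge> n0 \<Longrightarrow> \<bar>\<sigma> n - lam n / (real n)\<^sup>2 * (Q / real k)\<bar> \<le> bd n"
    "\<And>n. n \<ge> n0 \<Longrightarrow> cmod (ch n - complex_of_real (exp (- \<sigma> n / 2))) \<le> \<eta> n * \<sigma> n" by blast
  have "(\<lambda>n. \<sigma> n - lam n / (real n)\<^sup>2 * (Q / real k)) \<longlonglongrightarrow> 0"
    by (rule Lim_null_comparison[OF _ bdlim]) (use \<sigma>(1) in \<open>auto simp: eventually_sequentially\<close>)
  then have "(\<lambda>n. (\<sigma> n - lam n / (real n)\<^sup>2 * (Q / real k)) + lam n / (real n)\<^sup>2 * (Q / real k)) \<longlonglongrightarrow>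
      0 + 1 / 2 * (Q / real k)"
    by (intro tendsto_intros lam_limits(1))
  then have \<sigma>lim: "\<sigma> \<longlonglongrightarrow> Q / (2 * real k)" by simp
  have "(\<lambda>n. \<eta> n * \<sigma> n) \<longlonglongrightarrow> 0 * (Q / (2 * real k))" by (intro tendsto_intros \<eta>lim \<sigma>lim)
  then have \<eta>\<sigma>: "(\<lambda>n. \<eta> n * \<sigma> n) \<longlonglongrightarrow> 0" by simp
  have "(\<lambda>n. ch n - complex_of_real (exp (- \<sigma> n / 2))) \<longlonglongrightarrow> 0"
    by (rule Lim_null_comparison[OF _ \<eta>\<sigma>]) (use \<sigma>(2) in \<open>auto simp: eventually_sequentially\<close>)
  moreover have "(\<lambda>n. complex_of_real (exp (- \<sigma> n / 2))) \<longlonglongrightarrow> complex_of_real (exp (- (Q / (2 * real k)) / 2))"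
    by (intro tendsto_intros \<sigma>lim) auto
  ultimately have "(\<lambda>n. (ch n - complex_of_real (exp (- \<sigma> n / 2))) + complex_of_real (exp (- \<sigma> n / 2))) \<longlonglongrightarrow>
      0 + complex_of_real (exp (- (Q / (2 * real k)) / 2))"
    by (rule tendsto_add)
  then show ?thesis by (simp add: ch_def Q_def)
qed

lemma measurable_Z: "1 \<le> n \<Longrightarrow> Z n t \<in> borel_measurable (M n)"
proof -
  assume n: "1 \<le> n"
  interpret multiplicative_clocks "M n" "masses n" "\<xi> n" by (rule clocks[OF n])
  show "Z n t \<in> borel_measurable (M n)" unfolding Z_def[abs_def] by measurable
qed

lemma prob_space_M: "1 \<le> n \<Longrightarrow> prob_space (M n)"
  using clocks multiplicative_clocks.axioms(1) by blast

lemma measurable_paths: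
  assumes n: "1 \<le> n" and c: "0 \<le> c"
  shows "(\<lambda>\<omega>. \<lambda>t\<in>{0..c}. 1 / real n * comps n t \<omega>) \<in> M n \<rightarrow>\<^sub>M borel_sigma (skorokhod_topology c)"
    and "(\<lambda>\<omega>. \<lambda>t\<in>{0..c}. fluct n t \<omega>) \<in> M n \<rightarrow>\<^sub>M borel_sigma (skorokhod_topology c)"
proof -
  interpret multiplicative_clocks "M n" "masses n" "\<xi> n" by (rule clocks[OF n])
  have n0: "0 < real n" using n by simp
  show "(\<lambda>\<omega>. \<lambda>t\<in>{0..c}. 1 / real n * comps n t \<omega>) \<in> M n \<rightarrow>\<^sub>M borel_sigma (skorokhod_topology c)"
    using measurable_component_path[OF c n0 continuous_on_const, of "1 / real n" 0] by (simp add: comps_def)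
  have g: "continuous_on {0..c} (\<lambda>t. - (sqrt (real n) * (1 - t / 2)))" by (intro continuous_intros) auto
  have "fluct n t \<omega> = (sqrt (real n) * (1 / real n)) * real (num_components (vertices n, edges_at (t / real n) \<omega>)) +
      - (sqrt (real n) * (1 - t / 2))" for t \<omega>
    unfolding fluct_def comps_def by (simp add: right_diff_distrib)
  then show "(\<lambda>\<omega>. \<lambda>t\<in>{0..c}. fluct n t \<omega>) \<in> M n \<rightarrow>\<^sub>M borel_sigma (skorokhod_topology c)"
    using measurable_component_path[OF c n0 g, of "sqrt (real n) * (1 / real n)"] by simp
qed

lemma grid_floor:
  assumes "0 \<le> t" "t \<le> (1::real)"
  shows "min 1 (real (nat \<lfloor>2 ^ q * t\<rfloor>) / 2 ^ q) = real (nat \<lfloor>2 ^ q * t\<rfloor>) / 2 ^ q"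
    and "\<bar>t - real (nat \<lfloor>2 ^ q * t\<rfloor>) / 2 ^ q\<bar> \<le> (1/2) ^ q"
proof -
  define x where "x = real (nat \<lfloor>2 ^ q * t\<rfloor>)"
  have "x = real_of_int \<lfloor>2 ^ q * t\<rfloor>" using assms by (simp add: x_def)
  then have x: "x \<le> 2 ^ q * t" "2 ^ q * t < x + 1" by linarith+
  have l: "x / 2 ^ q \<le> t" "t < x / 2 ^ q + (1/2) ^ q"
    using x by (auto simp: field_simps power_divide)
  then show "min 1 (x / 2 ^ q) = x / 2 ^ q" "\<bar>t - x / 2 ^ q\<bar> \<le> (1/2) ^ q" using assms by auto
qed

text \<open>The fluctuations are bounded with high probability, so dividing them by
  \<open>sqrt n\<close> gives uniform closeness to \<open>1 - t/2\<close>. The grid variables are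
  constants here, which makes the convergence on the grid trivial, and the limit lives on a
  one-point space.\<close>

lemma components_law_of_large_numbers:
  assumes c: "0 \<le> c" "c < 1"
  shows "converges_in_distribution (skorokhod_topology c)
    M (\<lambda>n \<omega>. \<lambda>t\<in>{0..c}. 1 / real n * comps n t \<omega>)
    (return (count_space UNIV) ()) (\<lambda>_. \<lambda>t\<in>{0..c}. 1 - t / 2)"
proof -
  let ?N = "return (count_space UNIV) ()"
  have N: "prob_space ?N" by (rule prob_space_return) simp
  interpret N: prob_space ?N by (rule N)
  show ?thesis
  proof (rule skorokhod_convergence_from_grid[where X="\<lambda>n t \<omega>. 1 / real n * comps n t \<omega>"
        and Y="\<lambda>t _. 1 - t / 2" and U="\<lambda>n q j \<omega>. 1 - min 1 (real j / 2 ^ q) / 2"])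
    show "continuous_on {0..1} (\<lambda>t::real. 1 - t / 2)" by (intro continuous_intros) auto
    fix g :: "(nat \<Rightarrow> real) \<Rightarrow> real" and q :: nat
    let ?x = "g (\<lambda>j. 1 - min 1 (real j / 2 ^ q) / 2)"
    have ev: "eventually (\<lambda>n. (\<integral>\<omega>. ?x \<partial>M n) = ?x) sequentially"
      using eventually_ge_at_top[of 1]
    proof eventually_elim
      case (elim n)
      interpret prob_space "M n" by (rule prob_space_M[OF elim])
      show ?case by (simp add: prob_space)
    qed
    have "(\<integral>\<omega>. ?x \<partial>?N) = ?x" using N.prob_space by simp
    with tendsto_eventually[OF ev] show "(\<lambda>n. \<integral>\<omega>. ?x \<partial>M n) \<longlonglongrightarrow> (\<integral>\<omega>. ?x \<partial>?N)" by (simp only:)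
  next
    fix e :: real assume e: "0 < e"
    \<comment> \<open>At level 0 the factor \<open>(4/5) ^ q\<close> gives no decay, so the
      probability of failure is controlled by \<open>R\<close> alone: this value makes it
      \<open>e / 2\<close>.\<close>
    define R where "R = root 4 (32 / e)"
    have R: "0 < R" "16 / R ^ 4 = e / 2" using e by (auto simp: R_def)
    define W where "W = \<bar>\<beta>\<^sub>1\<bar> + \<bar>\<beta>\<^sub>2\<bar> + 10 * R + e / 2"
    have e2: "0 < e / 2" using e by simp
    obtain n1 where n1: "\<And>n. n \<ge> n1 \<Longrightarrow> \<exists>A\<in>sets (M n). 1 - 16 * (4/5) ^ 0 / R ^ 4 - e / 2 \<le> measure (M n) A \<and>
      (\<forall>\<omega>\<in>A. \<forall>t\<in>{0..c}. \<bar>fluct n t \<omega> - (\<beta>\<^sub>1 - \<beta>\<^sub>2 * (t / 2) - (Z n (real (nat \<lfloor>2 ^ 0 * t\<rfloor>) / 2 ^ 0) \<omega> - Z n 0 \<omega>))\<bar>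
        \<le> 10 * R * (9/10) ^ 0 + e / 2)"
      using fluct_deviation[OF c R(1) e2, of 0] by blast
    have "(\<lambda>n. W * (1 / sqrt (real n))) \<longlonglongrightarrow> W * 0" by (intro tendsto_intros inverse_sqrt_tendsto)
    then have "eventually (\<lambda>n. W * (1 / sqrt (real n)) < e / 2) sequentially"
      by (rule order_tendstoD) (use e in simp)
    then obtain n2 where n2: "\<And>n. n \<ge> n2 \<Longrightarrow> W * (1 / sqrt (real n)) < e / 2" by (auto simp: eventually_sequentially)
    have "(\<lambda>q. (1/2::real) ^ q) \<longlonglongrightarrow> 0" by (rule LIMSEQ_realpow_zero) auto
    then have "eventually (\<lambda>q. (1/2::real) ^ q < e / 2) sequentially" by (rule order_tendstoD) (use e in simp)
    then obtain q0 where q0: "\<And>q. q \<ge> q0 \<Longrightarrow> (1/2::real) ^ q < e / 2" by (auto simp: eventually_sequentially)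
    show "\<exists>q0. \<forall>q\<ge>q0. \<exists>n0. \<forall>n\<ge>n0. \<exists>A\<in>sets (M n). 1 - e \<le> measure (M n) A \<and>
        (\<forall>\<omega>\<in>A. \<forall>t\<in>{0..c}. \<bar>1 / real n * comps n t \<omega> - (1 - min 1 (real (nat \<lfloor>2 ^ q * t\<rfloor>) / 2 ^ q) / 2)\<bar> \<le> e)"
    proof (rule exI[of _ q0], intro allI impI, rule exI[of _ "max 1 (max n1 n2)"], intro allI impI)
      fix q n assume q: "q0 \<le> q" and "max 1 (max n1 n2) \<le> n"
      then have n: "1 \<le> n" "n1 \<le> n" "n2 \<le> n" by auto
      then have s0: "0 < sqrt (real n)" by simp
      obtain A where A: "A \<in> sets (M n)" "1 - 16 * (4/5) ^ 0 / R ^ 4 - e / 2 \<le> measure (M n) A"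
        "\<And>\<omega> t. \<omega> \<in> A \<Longrightarrow> t \<in> {0..c} \<Longrightarrow>
          \<bar>fluct n t \<omega> - (\<beta>\<^sub>1 - \<beta>\<^sub>2 * (t / 2) - (Z n (real (nat \<lfloor>2 ^ 0 * t\<rfloor>) / 2 ^ 0) \<omega> - Z n 0 \<omega>))\<bar>
          \<le> 10 * R * (9/10) ^ 0 + e / 2"
        using n1[OF n(2)] by blast
      show "\<exists>A\<in>sets (M n). 1 - e \<le> measure (M n) A \<and>
        (\<forall>\<omega>\<in>A. \<forall>t\<in>{0..c}. \<bar>1 / real n * comps n t \<omega> - (1 - min 1 (real (nat \<lfloor>2 ^ q * t\<rfloor>) / 2 ^ q) / 2)\<bar> \<le> e)"
      proof (intro bexI[OF _ A(1)] conjI ballI)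
        show "1 - e \<le> measure (M n) A" using A(2) R(2) by simp
        fix \<omega> t assume \<omega>: "\<omega> \<in> A" and t: "t \<in> {0..c}"
        then have t1: "0 \<le> t" "t \<le> 1" "\<lfloor>t\<rfloor> = 0" using c by (auto simp: floor_eq_iff)
        define s where "s = real (nat \<lfloor>2 ^ q * t\<rfloor>) / 2 ^ q"
        \<comment> \<open>As \<open>t < 1\<close>, the only grid point of level 0 is the time 0, and
          the centred increment cancels.\<close>
        have "\<bar>fluct n t \<omega> - (\<beta>\<^sub>1 - \<beta>\<^sub>2 * (t / 2))\<bar> \<le> 10 * R + e / 2"
          using A(3)[OF \<omega> t] t1(3) by simp
        moreover have "\<bar>\<beta>\<^sub>2 * (t / 2)\<bar> \<le> \<bar>\<beta>\<^sub>2\<bar> * 1"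
          unfolding abs_mult using t1 by (intro mult_left_mono) auto
        ultimately have "\<bar>fluct n t \<omega>\<bar> \<le> W" unfolding W_def by linarith
        then have "\<bar>fluct n t \<omega>\<bar> / sqrt (real n) \<le> W / sqrt (real n)" using s0 by (intro divide_right_mono) auto
        then have "\<bar>fluct n t \<omega> / sqrt (real n)\<bar> \<le> W * (1 / sqrt (real n))" using s0 by simp
        moreover have "fluct n t \<omega> / sqrt (real n) = 1 / real n * comps n t \<omega> - (1 - t / 2)"
          using s0 by (simp add: fluct_def)
        ultimately have "\<bar>1 / real n * comps n t \<omega> - (1 - t / 2)\<bar> \<le> W * (1 / sqrt (real n))" by simp
        then show "\<bar>1 / real n * comps n t \<omega> - (1 - min 1 (real (nat \<lfloor>2 ^ q * t\<rfloor>) / 2 ^ q) / 2)\<bar> \<le> e"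
          using n2[OF n(3)] q0[OF q] grid_floor(2)[OF t1(1,2), of q]
          unfolding s_def[symmetric] grid_floor(1)[OF t1(1,2), of q, folded s_def] by linarith
      qed
    qed
  qed (use c N prob_space_M measurable_paths(1) in auto)
qed

text \<open>Independence is available for increments and not for grid values. Every function
  \<open>g\<close> of the grid values is therefore rewritten as a function \<open>h\<close> of the
  increments; summation over at most \<open>k\<close> of them multiplies the Lipschitz constant by
  \<open>k\<close>.\<close>

lemma components_central_limit_theorem:
  assumes c: "0 \<le> c" "c < 1" and B: "standard_brownian_motion N B"
  shows "converges_in_distribution (skorokhod_topology c)
    M (\<lambda>n \<omega>. \<lambda>t\<in>{0..c}. fluct n t \<omega>)
    N (\<lambda>\<omega>. \<lambda>t\<in>{0..c}. \<beta>\<^sub>1 - \<beta>\<^sub>2 * (t / 2) + B (t / 2) \<omega>)"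
proof -
  interpret N: prob_space N using B by (simp add: standard_brownian_motion_def)
  have B0: "\<And>\<omega>. \<omega> \<in> space N \<Longrightarrow> B 0 \<omega> = 0"
    and Bc: "\<And>\<omega>. \<omega> \<in> space N \<Longrightarrow> continuous_on {0..} (\<lambda>t. B t \<omega>)"
    and Bd: "\<And>s t. 0 \<le> s \<Longrightarrow> s < t \<Longrightarrow> distributed N lborel (\<lambda>\<omega>. B t \<omega> - B s \<omega>) (normal_density 0 (sqrt (t - s)))"
    and Bi: "\<And>\<tau> k. 0 \<le> \<tau> 0 \<Longrightarrow> strict_mono \<tau> \<Longrightarrow>
        N.indep_vars (\<lambda>_. borel) (\<lambda>i \<omega>. B (\<tau> (Suc i)) \<omega> - B (\<tau> i) \<omega>) {..<k::nat}"
    using B unfolding standard_brownian_motion_def by blast+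
  \<comment> \<open>The definition of Brownian motion speaks about increments only; the increment
    from time 0 is \<open>B t\<close> itself, because the paths start at 0.\<close>
  have Bm: "B t \<in> borel_measurable N" if "0 \<le> t" for t
  proof (cases "t = 0")
    case True
    then show ?thesis using B0 by (subst measurable_cong[where g="\<lambda>_. 0"]) auto
  next
    case False
    then have "(\<lambda>\<omega>. B t \<omega> - B 0 \<omega>) \<in> borel_measurable N"
      using distributed_measurable[OF Bd[of 0 t]] that by simp
    then show ?thesis using B0 by (subst (asm) measurable_cong[where g="B t"]) auto
  qed
  define Y where "Y t \<omega> = \<beta>\<^sub>1 - \<beta>\<^sub>2 * (t / 2) + B (t / 2) \<omega>" for t \<omega>
  define base where "base q j = \<beta>\<^sub>1 - \<beta>\<^sub>2 * (min 1 (real j / 2 ^ q) / 2)" for q j :: nat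
  define U where "U n q j \<omega> = base q j - (Z n (real j / 2 ^ q) \<omega> - Z n 0 \<omega>)" for n q j \<omega>
  have grid: "(\<lambda>n. \<integral>\<omega>. g (\<lambda>j. U n q j \<omega>) \<partial>M n) \<longlonglongrightarrow> (\<integral>\<omega>. g (\<lambda>j. Y (min 1 (real j / 2 ^ q)) \<omega>) \<partial>N)"
    if gC: "\<And>v. \<bar>g v\<bar> \<le> C" and L: "0 \<le> L" and gL: "coord_lipschitz (2 ^ q) L g" for q C L g
  proof -
    define k :: nat where "k = 2 ^ q"
    have k: "1 \<le> k" "0 < real k" "real k = 2 ^ q" by (auto simp: k_def)
    define D where "D n j \<omega> = - (Z n (real (Suc j) / real k) \<omega> - Z n (real j / real k) \<omega>)" for n j \<omega>
    define h where "h v = g (\<lambda>j. base q j + (\<Sum>l<j. v l))" for v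
    \<comment> \<open>The step \<open>1 / (2 * k)\<close> in place of \<open>1 / k\<close> accounts
      for the clock \<open>t / 2\<close>.\<close>
    define E where "E j \<omega> = B (real (Suc j) * (1 / (2 * real k))) \<omega> - B (real j * (1 / (2 * real k))) \<omega>" for j \<omega>
    have h_lip: "coord_lipschitz k (L * real k) h"
      unfolding coord_lipschitz_def h_def
    proof (intro allI impI)
      fix v w :: "nat \<Rightarrow> real" and e assume vw: "\<forall>j\<le>k. \<bar>v j - w j\<bar> \<le> e"
      have e0: "0 \<le> e" using vw abs_ge_zero order_trans by blast
      have "\<bar>g (\<lambda>j. base q j + (\<Sum>l<j. v l)) - g (\<lambda>j. base q j + (\<Sum>l<j. w l))\<bar> \<le> L * (real k * e)"
      proof (rule coord_lipschitzD[OF gL])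
        fix j :: nat assume "j \<le> 2 ^ q"
        then have j: "j \<le> k" by (simp add: k_def)
        have "\<bar>(base q j + (\<Sum>l<j. v l)) - (base q j + (\<Sum>l<j. w l))\<bar> = \<bar>\<Sum>l<j. v l - w l\<bar>"
          by (simp add: sum_subtractf)
        also have "\<dots> \<le> (\<Sum>l<j. e)" by (rule order_trans[OF sum_abs], rule sum_mono) (use vw j in auto)
        also have "\<dots> \<le> real k * e" using j e0 by (simp add: mult_right_mono)
        finally show "\<bar>(base q j + (\<Sum>l<j. v l)) - (base q j + (\<Sum>l<j. w l))\<bar> \<le> real k * e" .
      qed
      then show "\<bar>g (\<lambda>j. base q j + (\<Sum>l<j. v l)) - g (\<lambda>j. base q j + (\<Sum>l<j. w l))\<bar> \<le> L * real k * e"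
        by (simp add: mult.assoc)
    qed
    have Udiff: "U n q j \<omega> = base q j + (\<Sum>l<j. D n l \<omega>)" for n j \<omega>
    proof -
      have "(\<Sum>l<j. D n l \<omega>) = - (\<Sum>l<j. Z n (real (Suc l) / real k) \<omega> - Z n (real l / real k) \<omega>)"
        unfolding D_def sum_negf ..
      also have "\<dots> = - (Z n (real j / real k) \<omega> - Z n (real 0 / real k) \<omega>)"
        by (subst sum_lessThan_telescope) (rule refl)
      finally show ?thesis by (simp add: U_def k(3))
    qed
    have hU: "g (\<lambda>j. U n q j \<omega>) = h (\<lambda>j. D n j \<omega>)" for n \<omega>
      unfolding h_def Udiff ..
    have hY: "g (\<lambda>j. Y (min 1 (real j / 2 ^ q)) \<omega>) = h (\<lambda>j. E j \<omega>)" if \<omega>: "\<omega> \<in> space N" for \<omega>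
    proof -
      \<comment> \<open>The two sequences agree only up to \<open>2 ^ q\<close>, beyond which the
        minimum freezes the sampling time. The Lipschitz property with \<open>e = 0\<close> turns
        this agreement into equality.\<close>
      have "\<bar>g (\<lambda>j. Y (min 1 (real j / 2 ^ q)) \<omega>) - h (\<lambda>j. E j \<omega>)\<bar> \<le> L * 0"
        unfolding h_def
      proof (rule coord_lipschitzD[OF gL])
        fix j :: nat assume "j \<le> 2 ^ q"
        then have "real j \<le> 2 ^ q" by (metis of_nat_le_iff of_nat_numeral of_nat_power)
        then have j: "min 1 (real j / 2 ^ q) = real j / real k" by (simp add: k(3))
        have "(\<Sum>l<j. E l \<omega>) = B (real j * (1 / (2 * real k))) \<omega> - B (real 0 * (1 / (2 * real k))) \<omega>"
          unfolding E_def by (rule sum_lessThan_telescope)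
        also have "\<dots> = B (real j / real k / 2) \<omega>" using B0[OF \<omega>] by (simp add: mult.commute)
        finally have "(\<Sum>l<j. E l \<omega>) = B (real j / real k / 2) \<omega>" .
        then show "\<bar>Y (min 1 (real j / 2 ^ q)) \<omega> - (base q j + (\<Sum>l<j. E l \<omega>))\<bar> \<le> 0"
          unfolding Y_def base_def j by simp
      qed
      then show ?thesis by simp
    qed
    have tau: "strict_mono (\<lambda>i. real i * (1 / (2 * real k)))" using k(2) by (intro strict_monoI mult_strict_right_mono) auto
    have Ed: "distributed N lborel (E j) (normal_density 0 (sqrt (1 / (2 * real k))))" for j
    proof -
      have "real (Suc j) * (1 / (2 * real k)) - real j * (1 / (2 * real k)) = 1 / (2 * real k)"
        unfolding left_diff_distrib[symmetric] by simp
      then show ?thesis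
        using Bd[of "real j * (1 / (2 * real k))" "real (Suc j) * (1 / (2 * real k))"] strict_monoD[OF tau, of j "Suc j"] k(2)
        unfolding E_def[abs_def] by simp
    qed
    have Em: "E j \<in> borel_measurable N" for j using distributed_measurable[OF Ed] by simp
    have Ei: "N.indep_vars (\<lambda>_. borel) E {..<Suc k}"
      unfolding E_def[abs_def] by (rule Bi[OF _ tau]) simp
    have Ec: "char (distr N borel (E j)) x = complex_of_real (exp (- (x\<^sup>2 / (2 * real k)) / 2))" for j x
    proof -
      have "(sqrt (1 / (2 * real k)) * x)\<^sup>2 = x\<^sup>2 / (2 * real k)" using k(2) by (simp add: power_mult_distrib)
      then show ?thesis using N.char_distr_normal[OF _ Ed[of j], of x] k(2) by simp
    qed
    \<comment> \<open>The index is shifted because \<open>lipschitz_convergence_from_char\<close>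
      asks for a probability space at every index, and nothing is known about
      \<open>M 0\<close>.\<close>
    have "(\<lambda>n. \<integral>\<omega>. h (\<lambda>j. D (Suc n) j \<omega>) \<partial>M (Suc n)) \<longlonglongrightarrow> (\<integral>\<omega>. h (\<lambda>j. E j \<omega>) \<partial>N)"
    proof (rule lipschitz_convergence_from_char[OF _ _ N.prob_space_axioms Em Ei _ _ _ h_lip])
      show "prob_space (M (Suc n))" for n by (rule prob_space_M) simp
      show "D (Suc n) j \<in> borel_measurable (M (Suc n))" for n j
        unfolding D_def[abs_def] using measurable_Z[of "Suc n"] by simp
      show "\<bar>h v\<bar> \<le> C" for v unfolding h_def by (rule gC)
      show "0 \<le> L * real k" using L by simp
      fix u
      have "(\<Prod>j<Suc k. char (distr N borel (E j)) (u j)) =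
          complex_of_real (exp (- ((\<Sum>j<Suc k. (u j)\<^sup>2) / (2 * real k)) / 2))"
        unfolding Ec of_real_prod[symmetric] exp_sum[OF finite_lessThan, symmetric]
        by (simp only: sum_divide_distrib sum_negf[symmetric])
      then show "(\<lambda>n. \<integral>\<omega>. iexp (\<Sum>j<Suc k. u j * D (Suc n) j \<omega>) \<partial>M (Suc n)) \<longlonglongrightarrow>
          (\<Prod>j<Suc k. char (distr N borel (E j)) (u j))"
        using LIMSEQ_Suc[OF increments_char_limit[OF k(1), where l="Suc k" and u=u]] unfolding D_def by simp
    qed
    then have "(\<lambda>n. \<integral>\<omega>. h (\<lambda>j. D n j \<omega>) \<partial>M n) \<longlonglongrightarrow> (\<integral>\<omega>. h (\<lambda>j. E j \<omega>) \<partial>N)"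
      by (rule LIMSEQ_imp_Suc)
    moreover have "(\<integral>\<omega>. g (\<lambda>j. Y (min 1 (real j / 2 ^ q)) \<omega>) \<partial>N) = (\<integral>\<omega>. h (\<lambda>j. E j \<omega>) \<partial>N)"
      by (rule Bochner_Integration.integral_cong[OF refl hY])
    ultimately show ?thesis unfolding hU by simp
  qed
  have "converges_in_distribution (skorokhod_topology c)
    M (\<lambda>n \<omega>. \<lambda>t\<in>{0..c}. fluct n t \<omega>) N (\<lambda>\<omega>. \<lambda>t\<in>{0..c}. Y t \<omega>)"
  proof (rule skorokhod_convergence_from_grid[where X=fluct and Y=Y and U=U])
    show "prob_space (M n)" if "1 \<le> n" for n using that by (rule prob_space_M)
    show "(\<lambda>\<omega>. \<lambda>t\<in>{0..c}. fluct n t \<omega>) \<in> M n \<rightarrow>\<^sub>M borel_sigma (skorokhod_topology c)" if "1 \<le> n" for n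
      by (rule measurable_paths(2)[OF that c(1)])
    show "Y t \<in> borel_measurable N" if "t \<in> {0..1}" for t
      unfolding Y_def[abs_def] using Bm[of "t / 2"] that by simp
    show "continuous_on {0..1} (\<lambda>t. Y t \<omega>)" if "\<omega> \<in> space N" for \<omega>
      unfolding Y_def by (intro continuous_intros continuous_on_compose2[OF Bc[OF that]]) auto
    show "U n q j \<in> borel_measurable (M n)" if "1 \<le> n" for n q j
      unfolding U_def[abs_def] using measurable_Z[OF that] by simp
    fix e :: real assume e: "0 < e"
    \<comment> \<open>The failure probability consists of two terms of size at most
      \<open>\<epsilon>\<close>, the uniform error of three: chaining, the remainder of
      \<open>fluct_deviation\<close>, and the variation of the drift within a cell.\<close>
    define \<epsilon> where "\<epsilon> = e / 4"
    have \<epsilon>: "0 < \<epsilon>" using e by (simp add: \<epsilon>_def)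
    have small: "eventually (\<lambda>q. x * y ^ q < \<epsilon>) sequentially" if y: "0 \<le> y" "y < 1" for x y :: real
    proof -
      have "(\<lambda>q. x * y ^ q) \<longlonglongrightarrow> x * 0"
        by (intro tendsto_intros LIMSEQ_realpow_zero y)
      then show ?thesis by (rule order_tendstoD) (use \<epsilon> in simp)
    qed
    have "eventually (\<lambda>q. 16 * (4/5::real) ^ q < \<epsilon>) sequentially"
      "eventually (\<lambda>q. 10 * (9/10::real) ^ q < \<epsilon>) sequentially"
      "eventually (\<lambda>q. \<bar>\<beta>\<^sub>2\<bar> * (1/2::real) ^ q < \<epsilon>) sequentially"
      by (rule small; simp)+
    then have "eventually (\<lambda>q. 16 * (4/5::real) ^ q < \<epsilon> \<and> 10 * (9/10::real) ^ q < \<epsilon> \<and> \<bar>\<beta>\<^sub>2\<bar> * (1/2::real) ^ q < \<epsilon>) sequentially"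
      by eventually_elim simp
    then obtain q0 where q0: "\<And>q. q \<ge> q0 \<Longrightarrow> 16 * (4/5::real) ^ q < \<epsilon> \<and> 10 * (9/10::real) ^ q < \<epsilon> \<and> \<bar>\<beta>\<^sub>2\<bar> * (1/2::real) ^ q < \<epsilon>"
      by (auto simp: eventually_sequentially)
    show "\<exists>q0. \<forall>q\<ge>q0. \<exists>n0. \<forall>n\<ge>n0. \<exists>A\<in>sets (M n). 1 - e \<le> measure (M n) A \<and>
        (\<forall>\<omega>\<in>A. \<forall>t\<in>{0..c}. \<bar>fluct n t \<omega> - U n q (nat \<lfloor>2 ^ q * t\<rfloor>) \<omega>\<bar> \<le> e)"
    proof (rule exI[of _ q0], intro allI impI)
      fix q assume q: "q0 \<le> q"
      obtain n0 where n0: "\<And>n. n \<ge> n0 \<Longrightarrow> \<exists>A\<in>sets (M n). 1 - 16 * (4/5) ^ q / 1 ^ 4 - \<epsilon> \<le> measure (M n) A \<and>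
        (\<forall>\<omega>\<in>A. \<forall>t\<in>{0..c}. \<bar>fluct n t \<omega> - (\<beta>\<^sub>1 - \<beta>\<^sub>2 * (t / 2) - (Z n (real (nat \<lfloor>2 ^ q * t\<rfloor>) / 2 ^ q) \<omega> - Z n 0 \<omega>))\<bar>
          \<le> 10 * 1 * (9/10) ^ q + \<epsilon>)"
        using fluct_deviation[OF c zero_less_one \<epsilon>, of q] by blast
      show "\<exists>n0. \<forall>n\<ge>n0. \<exists>A\<in>sets (M n). 1 - e \<le> measure (M n) A \<and>
        (\<forall>\<omega>\<in>A. \<forall>t\<in>{0..c}. \<bar>fluct n t \<omega> - U n q (nat \<lfloor>2 ^ q * t\<rfloor>) \<omega>\<bar> \<le> e)"
      proof (intro exI[of _ n0] allI impI)
        fix n assume n: "n0 \<le> n"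
        obtain A where A: "A \<in> sets (M n)" "1 - 16 * (4/5) ^ q / 1 ^ 4 - \<epsilon> \<le> measure (M n) A"
          "\<And>\<omega> t. \<omega> \<in> A \<Longrightarrow> t \<in> {0..c} \<Longrightarrow>
            \<bar>fluct n t \<omega> - (\<beta>\<^sub>1 - \<beta>\<^sub>2 * (t / 2) - (Z n (real (nat \<lfloor>2 ^ q * t\<rfloor>) / 2 ^ q) \<omega> - Z n 0 \<omega>))\<bar>
            \<le> 10 * 1 * (9/10) ^ q + \<epsilon>"
          using n0[OF n] by blast
        show "\<exists>A\<in>sets (M n). 1 - e \<le> measure (M n) A \<and>
          (\<forall>\<omega>\<in>A. \<forall>t\<in>{0..c}. \<bar>fluct n t \<omega> - U n q (nat \<lfloor>2 ^ q * t\<rfloor>) \<omega>\<bar> \<le> e)"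
        proof (intro bexI[OF _ A(1)] conjI ballI)
          show "1 - e \<le> measure (M n) A" using A(2) q0[OF q] \<epsilon> unfolding \<epsilon>_def by simp
          fix \<omega> t assume \<omega>: "\<omega> \<in> A" and t: "t \<in> {0..c}"
          then have t1: "0 \<le> t" "t \<le> 1" using c by auto
          define s where "s = real (nat \<lfloor>2 ^ q * t\<rfloor>) / 2 ^ q"
          have "\<bar>\<beta>\<^sub>2 * (t / 2) - \<beta>\<^sub>2 * (s / 2)\<bar> \<le> \<bar>\<beta>\<^sub>2\<bar> * (1/2) ^ q"
          proof -
            have "\<beta>\<^sub>2 * (t / 2) - \<beta>\<^sub>2 * (s / 2) = \<beta>\<^sub>2 * ((t - s) / 2)" by (simp add: algebra_simps diff_divide_distrib)
            then have "\<bar>\<beta>\<^sub>2 * (t / 2) - \<beta>\<^sub>2 * (s / 2)\<bar> = \<bar>\<beta>\<^sub>2\<bar> * (\<bar>t - s\<bar> / 2)"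
              by (simp only: abs_mult abs_divide abs_numeral)
            also have "\<dots> \<le> \<bar>\<beta>\<^sub>2\<bar> * (1/2) ^ q"
              using grid_floor(2)[OF t1, of q] unfolding s_def by (intro mult_left_mono) auto
            finally show ?thesis .
          qed
          moreover have "U n q (nat \<lfloor>2 ^ q * t\<rfloor>) \<omega> = \<beta>\<^sub>1 - \<beta>\<^sub>2 * (s / 2) - (Z n s \<omega> - Z n 0 \<omega>)"
            unfolding U_def base_def grid_floor(1)[OF t1] s_def ..
          moreover have "\<bar>fluct n t \<omega> - (\<beta>\<^sub>1 - \<beta>\<^sub>2 * (t / 2) - (Z n s \<omega> - Z n 0 \<omega>))\<bar> \<le> 10 * (9/10) ^ q + \<epsilon>"
            using A(3)[OF \<omega> t] unfolding s_def by simp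
          ultimately show "\<bar>fluct n t \<omega> - U n q (nat \<lfloor>2 ^ q * t\<rfloor>) \<omega>\<bar> \<le> e"
            using q0[OF q] e unfolding \<epsilon>_def by linarith
        qed
      qed
    qed
  qed (rule grid | use c N.prob_space_axioms in simp)+
  then show ?thesis unfolding Y_def .
qed

end

theorem corollary3p1:
  fixes \<theta> :: "nat \<Rightarrow> real" and m :: "nat \<Rightarrow> nat" and \<beta>\<^sub>1 \<beta>\<^sub>2 c :: real
    and M :: "nat \<Rightarrow> 'w measure" and G :: "nat \<Rightarrow> real \<Rightarrow> 'w \<Rightarrow> graph"
    and K :: "nat \<Rightarrow> real \<Rightarrow> 'w \<Rightarrow> nat"
  assumes "\<And>i. 0 < \<theta> i"
    and "0 \<le> \<beta>\<^sub>1" and "0 \<le> \<beta>\<^sub>2"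
    and "(\<lambda>n. real (m n) / sqrt (real n)) \<longlonglongrightarrow> \<beta>\<^sub>1"
    and "(\<lambda>n. 2 / sqrt (real n) * (\<Sum>i<m n. \<theta> i)) \<longlonglongrightarrow> \<beta>\<^sub>2"
    and "(\<lambda>n. 1 / real n * (\<Sum>i<m n. (\<theta> i)\<^sup>2)) \<longlonglongrightarrow> 0"
    and "\<And>n. 1 \<le> n \<Longrightarrow> multiplicative_graph_process (M n) (initial_masses \<theta> m n) (G n)"
    and "\<And>n t \<omega>. K n t \<omega> = num_components (G n t \<omega>)"
    and "0 \<le> c" and "c < 1"
  shows
    "converges_in_distribution (skorokhod_topology c)
       M (\<lambda>n \<omega>. \<lambda>t\<in>{0..c}. 1 / real n * real (K n (t / real n) \<omega>))
       (return (count_space UNIV) ()) (\<lambda>_. \<lambda>t\<in>{0..c}. 1 - t / 2)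
     \<and>
     (\<forall>(N :: 'v measure) B. standard_brownian_motion N B \<longrightarrow>
        converges_in_distribution (skorokhod_topology c)
          M (\<lambda>n \<omega>. \<lambda>t\<in>{0..c}.
               sqrt (real n) * (1 / real n * real (K n (t / real n) \<omega>) - (1 - t / 2)))
          N (\<lambda>\<omega>. \<lambda>t\<in>{0..c}. \<beta>\<^sub>1 - \<beta>\<^sub>2 * (t / 2) + B (t / 2) \<omega>))"
proof -
  note c = assms(9,10)
  \<comment> \<open>The clocks exist for each \<open>n\<close> separately; the implication makes the
    choice of one family \<open>\<xi>\<close> possible although index 0 is unconstrained.\<close>
  have "\<forall>n. \<exists>\<xi>. 1 \<le> n \<longrightarrow> multiplicative_clocks (M n) (initial_masses \<theta> m n) \<xi> \<and>
      (\<forall>t\<ge>0. \<forall>\<omega>\<in>space (M n). G n t \<omega> =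
        ({i. 0 < initial_masses \<theta> m n i}, multiplicative_clocks.edges_at (initial_masses \<theta> m n) \<xi> t \<omega>))"
  proof (intro allI)
    fix n
    let ?z = "initial_masses \<theta> m n"
    show "\<exists>\<xi>. 1 \<le> n \<longrightarrow> multiplicative_clocks (M n) ?z \<xi> \<and>
      (\<forall>t\<ge>0. \<forall>\<omega>\<in>space (M n). G n t \<omega> = ({i. 0 < ?z i}, multiplicative_clocks.edges_at ?z \<xi> t \<omega>))"
    proof (cases "1 \<le> n")
      case True
      obtain \<xi> where p: "prob_space (M n)" and i: "prob_space.indep_vars (M n) (\<lambda>_. borel) \<xi> (potential_edges ?z)"
        and d: "\<And>i j. i \<noteq> j \<Longrightarrow> 0 < ?z i \<Longrightarrow> 0 < ?z j \<Longrightarrow>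
           distributed (M n) lborel (\<xi> {i, j}) (exponential_density (?z i * ?z j))"
        and g: "\<And>t \<omega>. 0 \<le> t \<Longrightarrow> \<omega> \<in> space (M n) \<Longrightarrow>
           G n t \<omega> = ({i. 0 < ?z i}, {e \<in> potential_edges ?z. \<xi> e \<omega> \<le> t})"
        using assms(7)[OF True] unfolding multiplicative_graph_process_def by blast
      have mc: "multiplicative_clocks (M n) ?z \<xi>"
        by (intro multiplicative_clocks.intro multiplicative_clocks_axioms.intro p i d
            sum_initial_masses(1)[OF assms(1)])
      show ?thesis
        using mc g by (intro exI[of _ \<xi>]) (simp add: multiplicative_clocks.edges_at_def[OF mc])
    qed simp
  qed
  from choice[OF this] obtain \<xi> where
    mc: "\<And>n. 1 \<le> n \<Longrightarrow> multiplicative_clocks (M n) (initial_masses \<theta> m n) (\<xi> n)"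
    and G: "\<And>n t \<omega>. 1 \<le> n \<Longrightarrow> 0 \<le> t \<Longrightarrow> \<omega> \<in> space (M n) \<Longrightarrow> G n t \<omega> =
        ({i. 0 < initial_masses \<theta> m n i}, multiplicative_clocks.edges_at (initial_masses \<theta> m n) (\<xi> n) t \<omega>)"
    by blast
  interpret graph_sequence \<theta> m \<beta>\<^sub>1 \<beta>\<^sub>2 M \<xi>
    by (intro graph_sequence.intro assms(1,4-6) mc)
  have K: "real (K n (t / real n) \<omega>) = comps n t \<omega>" if "1 \<le> n" "\<omega> \<in> space (M n)" "t \<in> {0..c}" for n t \<omega>
    using G[of n "t / real n" \<omega>] that by (simp add: assms(8) comps_def)
  \<comment> \<open>The given process agrees with the one built from the clocks only for
    \<open>n \<ge> 1\<close>, on the sample space and at non-negative times, so the paths have to be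
    exchanged inside the notion of convergence.\<close>
  have cong: "converges_in_distribution T M X N Y"
    if c: "converges_in_distribution T M X' N Y" and eq: "\<And>n \<omega>. 1 \<le> n \<Longrightarrow> \<omega> \<in> space (M n) \<Longrightarrow> X n \<omega> = X' n \<omega>"
    for T :: "(real \<Rightarrow> real) topology" and X X' and N :: "'u measure" and Y
    unfolding converges_in_distribution_def
  proof (intro conjI allI impI)
    note c = c[unfolded converges_in_distribution_def]
    fix n :: nat assume n: "1 \<le> n"
    then show "prob_space (M n)" using c by blast
    have "X' n \<in> M n \<rightarrow>\<^sub>M borel_sigma T" using c n by blast
    then show "X n \<in> M n \<rightarrow>\<^sub>M borel_sigma T" by (subst measurable_cong[OF eq[OF n]])
  next
    fix \<phi> :: "(real \<Rightarrow> real) \<Rightarrow> real"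
    assume "continuous_map T euclideanreal \<phi> \<and> bounded (\<phi> ` topspace T)"
    then have "(\<lambda>n. \<integral>\<omega>. \<phi> (X' n \<omega>) \<partial>M n) \<longlonglongrightarrow> (\<integral>\<omega>. \<phi> (Y \<omega>) \<partial>N)"
      using c unfolding converges_in_distribution_def by blast
    moreover have "eventually (\<lambda>n. (\<integral>\<omega>. \<phi> (X' n \<omega>) \<partial>M n) = (\<integral>\<omega>. \<phi> (X n \<omega>) \<partial>M n)) sequentially"
      using eventually_ge_at_top[of 1] by eventually_elim (rule Bochner_Integration.integral_cong, auto simp: eq)
    ultimately show "(\<lambda>n. \<integral>\<omega>. \<phi> (X n \<omega>) \<partial>M n) \<longlonglongrightarrow> (\<integral>\<omega>. \<phi> (Y \<omega>) \<partial>N)"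
      by (rule Lim_transform_eventually)
  qed (use c in \<open>auto simp: converges_in_distribution_def\<close>)
  show ?thesis
  proof (intro conjI allI impI)
    show "converges_in_distribution (skorokhod_topology c)
       M (\<lambda>n \<omega>. \<lambda>t\<in>{0..c}. 1 / real n * real (K n (t / real n) \<omega>))
       (return (count_space UNIV) ()) (\<lambda>_. \<lambda>t\<in>{0..c}. 1 - t / 2)"
      by (rule cong[OF components_law_of_large_numbers[OF c]]) (auto simp: K)
    fix N :: "'v measure" and B assume "standard_brownian_motion N B"
    from components_central_limit_theorem[OF c this]
    show "converges_in_distribution (skorokhod_topology c)
          M (\<lambda>n \<omega>. \<lambda>t\<in>{0..c}.
               sqrt (real n) * (1 / real n * real (K n (t / real n) \<omega>) - (1 - t / 2)))
          N (\<lambda>\<omega>. \<lambda>t\<in>{0..c}. \<beta>\<^sub>1 - \<beta>\<^sub>2 * (t / 2) + B (t / 2) \<omega>)"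
      by (rule cong) (auto simp: K fluct_def)
  qed
qed

end
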